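(* Let $\mu$ be a full, strictly operator-stable distribution on $\mathbb{R}^m$ with exponent $B$, and let $M$ be the $\mathbb{R}^m$-valued independently scattered random measure generated by $\mu$ and the Lebesgue measure on $(\mathbb{R}^d,\mathcal{B}(\mathbb{R}^d))$. Let $D\in Q(\mathbb{R}^m)$ and $E\in Q(\mathbb{R}^d)$ with $q:=\mathrm{trace}(E)$. Furthermore, let $\phi:\mathbb{R}^d\to[0,\infty)$ be a continuous, $E$-homogeneous and $(\beta,E)$-admissible function for some $\beta>0$ such that $$\lambda_{D-qB}+\lambda_{qB}>0\qquad\text{and}\qquad \Lambda_{D-qB}+\Lambda_{qB}<\beta .$$ Then for each $t\in\mathbb{R}^d$ the stochastic integral $$X_{\phi,D}(t):=\int_{\mathbb{R}^d}\left[\phi(t-s)^{D-qB}-\phi(-s)^{D-qB}\right]M(ds)$$ exists, i.e. the integrand $s\mapsto \phi(t-s)^{D-qB}-\phi(-s)^{D-qB}$ is integrable with respect to $M$.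
   Context: Matrices: $\mathrm{L}(\mathbb{R}^m)$ is the set of real $m\times m$ matrices; $s^A:=\exp((\ln s)A)$ for $s>0$, and $0^A:=0\in \mathrm{L}(\mathbb{R}^m)$ by convention. $A^*$ is the adjoint. $\lambda_A$ and $\Lambda_A$ denote the minimum and maximum of the real parts of the complex eigenvalues of $A$. $Q(\mathbb{R}^m):=\{A\in \mathrm{L}(\mathbb{R}^m):\lambda_A>0\}$. Polar coordinates: for $E\in Q(\mathbb{R}^d)$ fix a norm $\|\cdot\|_E$ on $\mathbb{R}^d$ such that, with $S_E:=\{x:\|x\|_E=1\}$, the map $(0,\infty)\times S_E\to\mathbb{R}^d\setminus\{0\}$, $(s,\theta)\mapsto s^E\theta$ is a homeomorphism (such a norm exists); $\tau_E(x)>0$ and $l_E(x)\in S_E$ are defined by $x=\tau_E(x)^El_E(x)$ for $x\ne0$, and $\tau_E(0):=0$. $E$-homogeneous: $\phi(c^Ex)=c\,\phi(x)$ for all $c>0$, $x\neq0$. $(\beta,E)$-admissible: $\phi:\mathbb{R}^d\to[0,\infty)$ is strictly positive outside the origin and for any $0<a<b$ there is a constant $C>0$ such that for all $z$ with $a\le\|z\|\le b$ (Euclidean norm) and all $x$ with $\tau_E(x)\le1$ one has $|\phi(x+z)-\phi(z)|\le C\,\tau_E(x)^\beta$. Distributions: a probability measure on $\mathbb{R}^m$ is full if it is not concentrated on any hyperplane. An infinitely divisible distribution $\mu$ on $\mathbb{R}^m$ has log-characteristic function $\psi$, the unique continuous function with $\psi(0)=0$ and $\hat\mu=\exp(\psi)$.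 $\mu$ is strictly operator-stable with exponent $B$ if $s\,\psi(u)=\psi(s^{B^*}u)$ for all $s>0$, $u\in\mathbb{R}^m$. (For full $\mu$ one necessarily has $B\in Q(\mathbb{R}^m)$.) Random measure: for a $\sigma$-finite measure space $(S,\Sigma,\Theta)$ (here $S=\mathbb{R}^d$ with Lebesgue measure) let $\mathcal{S}=\{A\in\Sigma:\Theta(A)<\infty\}$. The independently scattered random measure $M$ generated by $\mu$ and $\Theta$ is a family $\{M(A):A\in\mathcal{S}\}$ of $\mathbb{R}^m$-valued random vectors on some probability space such that for pairwise disjoint $A_1,A_2,\dots\in\mathcal{S}$ the $M(A_n)$ are independent, $M(\bigcup_nA_n)=\sum_nM(A_n)$ a.s. if $\bigcup_nA_n\in\mathcal{S}$, and $\mathbb{E}e^{\mathrm{i}\langle M(A),u\rangle}=\exp(\Theta(A)\psi(u))$. Integral: for simple $f=\sum_{j=1}^nR_j\mathbf{1}_{A_j}$ ($R_j\in \mathrm{L}(\mathbb{R}^m)$, $A_j\in\mathcal{S}$ disjoint) put $I_M(f)=\sum_jR_jM(A_j)$. A measurable $f:S\to \mathrm{L}(\mathbb{R}^m)$ is integrable w.r.t. $M$ if there are simple $f_n\to f$ $\Theta$-a.e. such that $I_M(f_n\mathbf{1}_A)$ converges in probability for every $A\in\Sigma$; then $\int f\,dM=I_M(f)$ is the limit for $A=S$. *)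

theory Defs
  imports "HOL-Probability.Probability"
begin

text \<open>On \<open>real^'m^'m\<close> the symbol \<open>*\<close> (hence also \<open>^\<close>) denotes the componentwise product, so the
  library constants for powers and \<open>exp\<close> do not apply; \<open>**\<close> is the matrix product.\<close>

definition mat_exp :: "real^'m^'m \<Rightarrow> real^'m^'m" where
  "mat_exp A = (\<Sum>n. (1 / fact n) *\<^sub>R ((\<lambda>X. A ** X) ^^ n) (mat 1))"

text \<open>The power \<open>s\<^sup>A\<close> for \<open>s \<ge> 0\<close>, with the convention \<open>0\<^sup>A = 0\<close>.
  Negative bases do not occur.\<close>

definition mat_powr :: "real \<Rightarrow> real^'m^'m \<Rightarrow> real^'m^'m" where
  "mat_powr s A = (if s > 0 then mat_exp (ln s *\<^sub>R A) else 0)"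

definition complex_eigenvalues :: "real^'m^'m \<Rightarrow> complex set" where
  "complex_eigenvalues A =
     {z. \<exists>v::complex^'m. v \<noteq> 0 \<and> map_matrix complex_of_real A *v v = z *s v}"

definition min_re_eig :: "real^'m^'m \<Rightarrow> real" where
  "min_re_eig A = Min (Re ` complex_eigenvalues A)"

definition max_re_eig :: "real^'m^'m \<Rightarrow> real" where
  "max_re_eig A = Max (Re ` complex_eigenvalues A)"

definition Q_matrices :: "(real^'m^'m) set" where
  "Q_matrices = {A. min_re_eig A > 0}"

definition is_norm :: "('a::real_vector \<Rightarrow> real) \<Rightarrow> bool" where
  "is_norm N \<longleftrightarrow>
     (\<forall>x. 0 \<le> N x) \<and> (\<forall>x. N x = 0 \<longleftrightarrow> x = 0) \<and>
     (\<forall>c x. N (c *\<^sub>R x) = \<bar>c\<bar> * N x) \<and> (\<forall>x y. N (x + y) \<le> N x + N y)"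

definition polar_norm :: "real^'d^'d \<Rightarrow> (real^'d \<Rightarrow> real) \<Rightarrow> bool" where
  "polar_norm E N \<longleftrightarrow> is_norm N \<and>
     (\<exists>g. homeomorphism ({0<..} \<times> {\<theta>. N \<theta> = 1}) (- {0})
            (\<lambda>(s, \<theta>). mat_powr s E *v \<theta>) g)"

definition polar_radius :: "real^'d^'d \<Rightarrow> (real^'d \<Rightarrow> real) \<Rightarrow> real^'d \<Rightarrow> real" where
  "polar_radius E N x =
     (if x = 0 then 0 else (THE s. s > 0 \<and> (\<exists>\<theta>. N \<theta> = 1 \<and> x = mat_powr s E *v \<theta>)))"

definition E_homogeneous :: "real^'d^'d \<Rightarrow> (real^'d \<Rightarrow> real) \<Rightarrow> bool" where
  "E_homogeneous E \<phi> \<longleftrightarrow> (\<forall>c>0. \<forall>x. x \<noteq> 0 \<longrightarrow> \<phi> (mat_powr c E *v x) = c * \<phi> x)"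

definition admissible ::
  "real \<Rightarrow> real^'d^'d \<Rightarrow> (real^'d \<Rightarrow> real) \<Rightarrow> (real^'d \<Rightarrow> real) \<Rightarrow> bool" where
  "admissible \<beta> E N \<phi> \<longleftrightarrow>
     (\<forall>x. 0 \<le> \<phi> x) \<and> (\<forall>x. x \<noteq> 0 \<longrightarrow> 0 < \<phi> x) \<and>
     (\<forall>a b. 0 < a \<longrightarrow> a < b \<longrightarrow>
        (\<exists>C>0. \<forall>z x. a \<le> norm z \<longrightarrow> norm z \<le> b \<longrightarrow> polar_radius E N x \<le> 1 \<longrightarrow>
           \<bar>\<phi> (x + z) - \<phi> z\<bar> \<le> C * polar_radius E N x powr \<beta>))"

definition prob_distribution :: "'a::topological_space measure \<Rightarrow> bool" where
  "prob_distribution \<mu> \<longleftrightarrow> prob_space \<mu> \<and> sets \<mu> = sets borel"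

text \<open>Hyperplanes are affine: they need not contain the origin.\<close>

definition full_distribution :: "(real^'m) measure \<Rightarrow> bool" where
  "full_distribution \<mu> \<longleftrightarrow> (\<forall>a b. a \<noteq> 0 \<longrightarrow> \<not> (AE x in \<mu>. a \<bullet> x = b))"

definition infinitely_divisible :: "(real^'m) measure \<Rightarrow> bool" where
  "infinitely_divisible \<mu> \<longleftrightarrow> prob_distribution \<mu> \<and>
     (\<forall>n\<ge>1. \<exists>\<nu>. prob_distribution \<nu> \<and> \<mu> = ((\<lambda>\<rho>. \<nu> \<star> \<rho>) ^^ n) (return borel 0))"

definition vec_char :: "(real^'m) measure \<Rightarrow> real^'m \<Rightarrow> complex" where
  "vec_char \<mu> u = (CLINT x|\<mu>. iexp (x \<bullet> u))"

text \<open>Uniquely determined whenever \<open>\<mu>\<close> is infinitely divisible.\<close>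

definition log_char :: "(real^'m) measure \<Rightarrow> real^'m \<Rightarrow> complex" where
  "log_char \<mu> = (THE \<psi>. continuous_on UNIV \<psi> \<and> \<psi> 0 = 0 \<and> (\<forall>u. vec_char \<mu> u = exp (\<psi> u)))"

definition strictly_operator_stable :: "(real^'m) measure \<Rightarrow> real^'m^'m \<Rightarrow> bool" where
  "strictly_operator_stable \<mu> B \<longleftrightarrow> infinitely_divisible \<mu> \<and>
     (\<forall>s>0. \<forall>u. complex_of_real s * log_char \<mu> u = log_char \<mu> (mat_powr s (transpose B) *v u))"

definition finite_sets :: "'s measure \<Rightarrow> 's set set" where
  "finite_sets \<Theta> = {A \<in> sets \<Theta>. emeasure \<Theta> A < \<infinity>}"

definition indep_scattered_random_measure ::
  "'w measure \<Rightarrow> ('s set \<Rightarrow> 'w \<Rightarrow> real^'m) \<Rightarrow> (real^'m) measure \<Rightarrow> 's measure \<Rightarrow> bool" where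
  "indep_scattered_random_measure P M \<mu> \<Theta> \<longleftrightarrow>
     prob_space P \<and>
     (\<forall>A\<in>finite_sets \<Theta>. M A \<in> borel_measurable P) \<and>
     (\<forall>A::nat \<Rightarrow> 's set. range A \<subseteq> finite_sets \<Theta> \<longrightarrow> disjoint_family A \<longrightarrow>
        prob_space.indep_vars P (\<lambda>_. borel) (\<lambda>n. M (A n)) UNIV \<and>
        ((\<Union>n. A n) \<in> finite_sets \<Theta> \<longrightarrow> (AE \<omega> in P. (\<lambda>n. M (A n) \<omega>) sums M (\<Union>n. A n) \<omega>))) \<and>
     (\<forall>A\<in>finite_sets \<Theta>. \<forall>u.
        (CLINT \<omega>|P. iexp (M A \<omega> \<bullet> u)) = exp (complex_of_real (measure \<Theta> A) * log_char \<mu> u))"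

definition converges_in_probability :: "'w measure \<Rightarrow> (nat \<Rightarrow> 'w \<Rightarrow> 'a::euclidean_space) \<Rightarrow> bool" where
  "converges_in_probability P X \<longleftrightarrow>
     (\<exists>Y\<in>borel_measurable P. \<forall>\<epsilon>>0.
        (\<lambda>k. measure P {\<omega>\<in>space P. dist (X k \<omega>) (Y \<omega>) > \<epsilon>}) \<longlonglongrightarrow> 0)"

text \<open>A simple function \<open>f = (\<Sum>j<n. R\<^sub>j 1\<^bsub>A\<^sub>j\<^esub>)\<close> is handled through a representation
  \<open>(n, R, A)\<close>; its product with \<open>1\<^sub>C\<close> is then represented by \<open>(n, R, \<lambda>j. A\<^sub>j \<inter> C)\<close>.
  By finite additivity of \<open>M\<close>, different representations of the same simple function have the same
  integral up to null sets, which does not affect convergence in probability.\<close>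

definition simple_rep :: "'s measure \<Rightarrow> nat \<Rightarrow> (nat \<Rightarrow> 's set) \<Rightarrow> bool" where
  "simple_rep \<Theta> n A \<longleftrightarrow> (\<forall>j<n. A j \<in> finite_sets \<Theta>) \<and> disjoint_family_on A {..<n}"

definition simple_fun ::
  "nat \<Rightarrow> (nat \<Rightarrow> real^'m^'m) \<Rightarrow> (nat \<Rightarrow> 's set) \<Rightarrow> 's \<Rightarrow> real^'m^'m" where
  "simple_fun n R A s = (\<Sum>j<n. indicator (A j) s *\<^sub>R R j)"

definition simple_stoch_integral ::
  "('s set \<Rightarrow> 'w \<Rightarrow> real^'m) \<Rightarrow> nat \<Rightarrow> (nat \<Rightarrow> real^'m^'m) \<Rightarrow> (nat \<Rightarrow> 's set) \<Rightarrow> 'w \<Rightarrow> real^'m" where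
  "simple_stoch_integral M n R A \<omega> = (\<Sum>j<n. R j *v M (A j) \<omega>)"

definition stoch_integrable ::
  "'w measure \<Rightarrow> ('s set \<Rightarrow> 'w \<Rightarrow> real^'m) \<Rightarrow> 's measure \<Rightarrow> ('s \<Rightarrow> real^'m^'m) \<Rightarrow> bool" where
  "stoch_integrable P M \<Theta> f \<longleftrightarrow>
     f \<in> borel_measurable \<Theta> \<and>
     (\<exists>(n::nat \<Rightarrow> nat) (R::nat \<Rightarrow> nat \<Rightarrow> real^'m^'m) (A::nat \<Rightarrow> nat \<Rightarrow> 's set).
        (\<forall>k. simple_rep \<Theta> (n k) (A k)) \<and>
        (AE s in \<Theta>. (\<lambda>k. simple_fun (n k) (R k) (A k) s) \<longlonglongrightarrow> f s) \<and>
        (\<forall>C\<in>sets \<Theta>. converges_in_probability P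
           (\<lambda>k. simple_stoch_integral M (n k) (R k) (\<lambda>j. A k j \<inter> C))))"

end

theory Submission
  imports Defs "HOL-Computational_Algebra.Fundamental_Theorem_Algebra"
begin

text \<open>Write \<open>H = D - qB\<close>, \<open>f\<close> for the integrand and \<open>\<psi>\<close> for the log-characteristic function of
  \<open>\<mu>\<close>. Fullness forces \<open>\<lambda>\<^sub>B > 0\<close>, and then the scaling relation \<open>s \<psi>(u) = \<psi>(s\<^sup>B\<^sup>* u)\<close> gives
  \<open>|\<psi>(u)| \<le> C (|u|\<^sup>p + |u|\<^sup>r)\<close> with \<open>1/p < \<lambda>\<^sub>B\<close> and \<open>1/r > \<Lambda>\<^sub>B\<close>. Hence \<open>f\<close> is integrable with respect to
  \<open>M\<close> as soon as \<open>|f|\<^sup>p + |f|\<^sup>r\<close> is Lebesgue integrable: simple functions \<open>f\<^sub>k\<close> with \<open>|f\<^sub>k| \<le> 2|f|\<close> have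
  integrals that are Cauchy in probability, because the log-characteristic functions of the
  differences tend to \<open>0\<close> by dominated convergence. The function \<open>\<phi>\<close> itself serves as radius: the
  sets \<open>{r \<le> \<phi> < 2r}\<close> are images of each other under \<open>c\<^sup>E\<close> and have volume proportional to \<open>r\<^sup>q\<close>.
  Where \<open>\<phi>(-s)\<close> is bounded, \<open>|f|\<close> is at most a constant times \<open>\<phi>(t - s)\<^sup>\<delta> + \<phi>(-s)\<^sup>\<delta>\<close> with \<open>\<delta>\<close> slightly
  below \<open>min 0 \<lambda>\<^sub>H\<close>; where it is large, admissibility bounds \<open>|f|\<close> by a constant times
  \<open>\<phi>(-s)\<^bsup>a - \<beta>\<^esup>\<close> with \<open>a\<close> slightly above \<open>\<Lambda>\<^sub>H\<close>. Summing over the annuli, the two hypotheses on the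
  eigenvalues are exactly what makes both parts integrable.\<close>

section \<open>Matrix exponentials\<close>

text \<open>Powers \<open>s^A\<close> follow scalar powers of \<open>s\<close> only up to an
  arbitrarily small loss in the exponent, since Jordan blocks contribute powers of
  \<open>ln s\<close>. Every growth estimate therefore uses an exponent strictly beyond the spectral
  bound, and the strictness of the hypotheses pays for all losses together. Jordan forms themselves
  are avoided: a product of factors \<open>A - z\<close> over eigenvalues that annihilates the space
  is enough. With \<open>p = 1/c\<close>, the singularities at \<open>\<phi>(-s) = 0\<close> and
  \<open>\<phi>(t - s) = 0\<close> require \<open>\<delta> + q c > 0\<close>, while infinity
  requires \<open>a - \<beta> + q c < 0\<close>. The two values of \<open>c\<close> lie just below
  \<lambda>_B and just above \<Lambda>_B, so the binding cases are exactly the two hypotheses,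
  because the spectral bounds of \<open>qB\<close> are \<open>q\<close> times those of
  \<open>B\<close>. No limit law is available in advance, so the limit in probability comes from
  completeness. Cauchyness is reduced to the continuity theorem: a sequence whose characteristic
  functions tend to 1 tends to 0 in probability. This needs only upper bounds on the
  log-characteristic function, and those see a matrix through its norm alone.\<close>

definition mat_pow :: "real^'m^'m \<Rightarrow> nat \<Rightarrow> real^'m^'m" where
  "mat_pow A n = ((\<lambda>X. A ** X) ^^ n) (mat 1)"

lemma mat_pow_0 [simp]: "mat_pow A 0 = mat 1"
  by (simp add: mat_pow_def)

lemma mat_pow_Suc: "mat_pow A (Suc n) = A ** mat_pow A n"
  by (simp add: mat_pow_def)

lemma mat_pow_commute: "mat_pow A n ** A = A ** mat_pow A n"
  by (induction n) (simp_all add: mat_pow_Suc matrix_mul_assoc flip: matrix_mul_assoc)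

lemma mat_pow_scaleR: "mat_pow (t *\<^sub>R A) n = t ^ n *\<^sub>R mat_pow A n"
  by (induction n) (simp_all add: mat_pow_Suc matrix_scalar_ac scalar_matrix_assoc mult.commute
      flip: scalar_mult_eq_scaleR)

lemma transpose_mat_pow: "transpose (mat_pow A n) = mat_pow (transpose A) n"
  by (induction n) (simp_all add: mat_pow_Suc matrix_transpose_mul transpose_mat mat_pow_commute)

section \<open>Frobenius norm estimates and convergence of the exponential series\<close>

lemma power2_norm_vec: "(norm v)\<^sup>2 = (\<Sum>i\<in>UNIV. (v$i)\<^sup>2)" for v :: "real^'n"
  by (simp only: power2_norm_eq_inner inner_vec_def) (simp add: power2_eq_square)

lemma power2_norm_matrix: "(norm M)\<^sup>2 = (\<Sum>i\<in>UNIV. \<Sum>j\<in>UNIV. (M$i$j)\<^sup>2)"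
  for M :: "real^'n^'m"
  by (simp only: power2_norm_eq_inner inner_vec_def) (simp add: power2_eq_square)

text \<open>The norm on nested vectors is the Frobenius norm, so Cauchy-Schwarz in each entry gives
  submultiplicativity with constant 1. The price is that \<open>norm (mat 1)\<close> need not be 1,
  whence the extra factor in \<open>norm_mat_pow_le\<close>.\<close>

lemma norm_matrix_mult_le: "norm (A ** B) \<le> norm A * norm (B :: real^'n^'k)"
  for A :: "real^'k^'m"
proof -
  have "((A ** B)$i$j)\<^sup>2 \<le> (\<Sum>k\<in>UNIV. (A$i$k)\<^sup>2) * (\<Sum>k\<in>UNIV. (B$k$j)\<^sup>2)" for i j
    unfolding matrix_matrix_mult_def by (simp add: Cauchy_Schwarz_ineq_sum)
  then have "(norm (A ** B))\<^sup>2 \<le> (\<Sum>i\<in>UNIV. \<Sum>j\<in>UNIV. (\<Sum>k\<in>UNIV. (A$i$k)\<^sup>2) * (\<Sum>k\<in>UNIV. (B$k$j)\<^sup>2))"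
    unfolding power2_norm_matrix by (intro sum_mono)
  also have "\<dots> = (norm A * norm B)\<^sup>2"
    unfolding power_mult_distrib power2_norm_matrix sum.swap[of "\<lambda>k j. (B$k$j)\<^sup>2"] by (simp only: sum_product)
  finally show ?thesis
    by (rule power2_le_imp_le) simp
qed

lemma norm_matrix_vector_mult_le: "norm (A *v x) \<le> norm A * norm (x :: real^'k)"
  for A :: "real^'k^'m"
proof -
  have "((A *v x)$i)\<^sup>2 \<le> (\<Sum>k\<in>UNIV. (A$i$k)\<^sup>2) * (norm x)\<^sup>2" for i
    unfolding matrix_vector_mult_def power2_norm_vec by (simp add: Cauchy_Schwarz_ineq_sum)
  then have "(norm (A *v x))\<^sup>2 \<le> (\<Sum>i\<in>UNIV. (\<Sum>k\<in>UNIV. (A$i$k)\<^sup>2) * (norm x)\<^sup>2)"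
    unfolding power2_norm_vec[of "A *v x"] by (intro sum_mono)
  also have "\<dots> = (norm A * norm x)\<^sup>2"
    unfolding power_mult_distrib power2_norm_matrix by (simp add: sum_distrib_right)
  finally show ?thesis
    by (rule power2_le_imp_le) simp
qed

lemma norm_transpose: "norm (transpose A) = norm (A :: real^'k^'m)"
proof -
  have "(norm (transpose A))\<^sup>2 = (norm A)\<^sup>2"
    unfolding power2_norm_matrix transpose_def by (simp, rule sum.swap)
  then show ?thesis by simp
qed

lemma norm_mat_pow_le: "norm (mat_pow A n) \<le> norm (mat 1 :: real^'m^'m) * norm (A :: real^'m^'m) ^ n"
proof (induction n)
  case (Suc n)
  have "norm (mat_pow A (Suc n)) \<le> norm A * norm (mat_pow A n)"
    by (simp add: mat_pow_Suc norm_matrix_mult_le)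
  also have "\<dots> \<le> norm A * (norm (mat 1 :: real^'m^'m) * norm A ^ n)"
    using Suc by (intro mult_left_mono) auto
  finally show ?case by (simp add: algebra_simps)
qed simp

lemma summable_mat_exp: "summable (\<lambda>n. (1 / fact n) *\<^sub>R mat_pow (A :: real^'m^'m) n)"
proof (rule summable_comparison_test')
  show "summable (\<lambda>n. norm (mat 1 :: real^'m^'m) * (norm A ^ n / fact n))"
    using summable_exp[of "norm A"] by (intro summable_mult) (simp add: field_simps)
  show "norm ((1 / fact n) *\<^sub>R mat_pow A n) \<le> norm (mat 1 :: real^'m^'m) * (norm A ^ n / fact n)" for n
    using norm_mat_pow_le[of A n] by (simp add: divide_simps)
qed

lemma mat_exp_sums: "(\<lambda>n. (1 / fact n) *\<^sub>R mat_pow A n) sums mat_exp A"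
  unfolding mat_exp_def mat_pow_def[symmetric] by (rule summable_sums[OF summable_mat_exp])

text \<open>Each entry is a scalar power series in \<open>t\<close>, the form in which termwise
  differentiation applies.\<close>

lemma mat_exp_scaleR_nth_sums:
  "(\<lambda>n. (mat_pow A n $ i $ j / fact n) * t ^ n) sums (mat_exp (t *\<^sub>R A) $ i $ j)"
proof -
  have "bounded_linear (\<lambda>M :: real^'a^'a. M $ i $ j)"
    by (rule bounded_linear_compose[OF bounded_linear_vec_nth bounded_linear_vec_nth])
  from bounded_linear.sums[OF this mat_exp_sums[of "t *\<^sub>R A"]]
  show ?thesis by (simp add: mat_pow_scaleR field_simps)
qed

lemma mat_exp_0 [simp]: "mat_exp 0 = mat 1"
proof -
  have "(1 / fact n) *\<^sub>R mat_pow (0 :: real^'a^'a) n = (if n = 0 then mat 1 else 0)" for n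
    by (cases n) (auto simp: mat_pow_Suc)
  then have "(\<lambda>n. (1 / fact n) *\<^sub>R mat_pow (0 :: real^'a^'a) n) sums mat 1"
    using sums_single[of 0 "\<lambda>_. mat 1 :: real^'a^'a"] by simp
  then show ?thesis using mat_exp_sums sums_unique2 by blast
qed

lemma transpose_mat_exp: "transpose (mat_exp A) = mat_exp (transpose A)"
proof -
  have "bounded_linear (transpose :: real^'a^'a \<Rightarrow> _)"
    by (intro linear_conv_bounded_linear[THEN iffD1] linearI) (auto simp: transpose_def vec_eq_iff)
  from bounded_linear.sums[OF this mat_exp_sums[of A]]
  have "(\<lambda>n. (1 / fact n) *\<^sub>R mat_pow (transpose A) n) sums transpose (mat_exp A)"
    by (simp add: transpose_mat_pow transpose_scalar)
  then show ?thesis using mat_exp_sums sums_unique2 by blast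
qed

lemma bounded_linear_matrix_mult_left: "bounded_linear (\<lambda>X. A ** (X :: real^'n^'k))"
  for A :: "real^'k^'m"
  by (intro linear_conv_bounded_linear[THEN iffD1] linearI)
     (auto simp: vec_eq_iff matrix_matrix_mult_def sum_distrib_left sum.distrib algebra_simps)

lemma bounded_bilinear_matrix_mult: "bounded_bilinear ((**) :: real^'k^'m \<Rightarrow> real^'n^'k \<Rightarrow> _)"
proof
  fix A A' :: "real^'k^'m" and B B' :: "real^'n^'k" and r :: real
  show "(A + A') ** B = A ** B + A' ** B" by (simp add: vec_eq_iff matrix_matrix_mult_def sum.distrib algebra_simps)
  show "A ** (B + B') = A ** B + A ** B'" by (simp add: matrix_add_ldistrib)
  show "(r *\<^sub>R A) ** B = r *\<^sub>R (A ** B)"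
    by (simp add: vec_eq_iff matrix_matrix_mult_def sum_distrib_left algebra_simps)
  show "A ** (r *\<^sub>R B) = r *\<^sub>R (A ** B)"
    by (simp add: vec_eq_iff matrix_matrix_mult_def sum_distrib_left algebra_simps)
  show "\<exists>K. \<forall>(a :: real^'k^'m) (b :: real^'n^'k). norm (a ** b) \<le> norm a * norm b * K"
    by (rule exI[of _ 1]) (simp add: norm_matrix_mult_le)
qed

lemma bounded_bilinear_matrix_vector_mult:
  "bounded_bilinear ((*v) :: real^'k^'m \<Rightarrow> real^'k \<Rightarrow> _)"
proof
  fix A A' :: "real^'k^'m" and x y :: "real^'k" and r :: real
  show "(A + A') *v x = A *v x + A' *v x" by (simp add: matrix_vector_mult_add_rdistrib)
  show "A *v (x + y) = A *v x + A *v y" by (simp add: matrix_vector_right_distrib)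
  show "(r *\<^sub>R A) *v x = r *\<^sub>R (A *v x)" by (simp add: scaleR_matrix_vector_assoc)
  show "A *v (r *\<^sub>R x) = r *\<^sub>R (A *v x)" by (simp add: matrix_vector_mult_scaleR)
  show "\<exists>K. \<forall>(a :: real^'k^'m) b. norm (a *v b) \<le> norm a * norm b * K"
    by (rule exI[of _ 1]) (simp add: norm_matrix_vector_mult_le)
qed

lemma mat_exp_commute: "mat_exp A ** A = A ** mat_exp A"
proof -
  have "(\<lambda>n. ((1 / fact n) *\<^sub>R mat_pow A n) ** A) sums (mat_exp A ** A)"
    by (rule bounded_linear.sums[OF bounded_bilinear.bounded_linear_left[OF bounded_bilinear_matrix_mult] mat_exp_sums])
  moreover have "(\<lambda>n. A ** ((1 / fact n) *\<^sub>R mat_pow A n)) sums (A ** mat_exp A)"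
    by (rule bounded_linear.sums[OF bounded_bilinear.bounded_linear_right[OF bounded_bilinear_matrix_mult] mat_exp_sums])
  moreover have "((1 / fact n) *\<^sub>R mat_pow A n) ** A = A ** ((1 / fact n) *\<^sub>R mat_pow A n)" for n
    using mat_pow_commute[of A n]
    by (simp add: bounded_bilinear.scaleR_left[OF bounded_bilinear_matrix_mult]
        bounded_bilinear.scaleR_right[OF bounded_bilinear_matrix_mult])
  ultimately show ?thesis by (simp add: sums_unique2)
qed

lemma mat_exp_mult_commute_scaleR: "mat_exp (t *\<^sub>R A) ** A = A ** mat_exp (t *\<^sub>R A)"
proof (cases "t = 0")
  case False
  have "t *\<^sub>R (mat_exp (t *\<^sub>R A) ** A) = t *\<^sub>R (A ** mat_exp (t *\<^sub>R A))"
    using mat_exp_commute[of "t *\<^sub>R A"]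
    by (simp add: bounded_bilinear.scaleR_left[OF bounded_bilinear_matrix_mult]
        bounded_bilinear.scaleR_right[OF bounded_bilinear_matrix_mult])
  then show ?thesis using False by simp
qed simp

text \<open>\<open>diffs\<close> shifts the coefficients by one, and
  \<open>(n + 1) / fact (n + 1) = 1 / fact n\<close> turns the shifted series into that of
  \<open>A ** mat_exp (t *\<^sub>R A)\<close>.\<close>

lemma mat_exp_nth_has_derivative:
  "((\<lambda>t. mat_exp (t *\<^sub>R A) $ i $ j) has_field_derivative (A ** mat_exp (t *\<^sub>R A)) $ i $ j) (at t)"
proof -
  let ?c = "\<lambda>n. mat_pow A n $ i $ j / fact n"
  have eq: "mat_exp (t *\<^sub>R A) $ i $ j = (\<Sum>n. ?c n * t ^ n)" for t
    using mat_exp_scaleR_nth_sums by (rule sums_unique)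
  have "((\<lambda>t. \<Sum>n. ?c n * t ^ n) has_field_derivative (\<Sum>n. diffs ?c n * t ^ n)) (at t)"
    by (rule termdiffs_strong_converges_everywhere)
       (use mat_exp_scaleR_nth_sums sums_summable in blast)
  moreover have "(\<lambda>n. diffs ?c n * t ^ n) sums ((A ** mat_exp (t *\<^sub>R A)) $ i $ j)"
  proof -
    have bl: "bounded_linear (\<lambda>M :: real^'a^'a. (A ** M) $ i $ j)"
      by (rule bounded_linear_compose[OF bounded_linear_vec_nth
            bounded_linear_compose[OF bounded_linear_vec_nth bounded_linear_matrix_mult_left]])
    have "diffs ?c n = (A ** mat_pow A n) $ i $ j / fact n" for n
      by (simp add: diffs_def mat_pow_Suc divide_simps del: of_nat_Suc)
    then have "(\<lambda>n. diffs ?c n * t ^ n) = (\<lambda>n. (A ** mat_pow A n) $ i $ j / fact n * t ^ n)"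
      by (simp only:)
    then show ?thesis
      using bounded_linear.sums[OF bl mat_exp_sums[of "t *\<^sub>R A"]]
      by (simp add: mat_pow_scaleR bounded_bilinear.scaleR_right[OF bounded_bilinear_matrix_mult]
        field_simps)
  qed
  ultimately show ?thesis unfolding eq by (simp add: sums_iff)
qed

lemma has_vector_derivative_vec:
  fixes f :: "real \<Rightarrow> ('a::real_normed_vector)^'n"
  assumes "\<And>i. ((\<lambda>t. f t $ i) has_vector_derivative f' $ i) (at t)"
  shows "(f has_vector_derivative f') (at t)"
proof -
  have "((\<lambda>y. (1 / norm (y - t)) *\<^sub>R (f y - (f t + (y - t) *\<^sub>R f'))) \<longlongrightarrow> 0) (at t)"
    using assms by (intro vec_tendstoI)
      (simp add: has_vector_derivative_def has_derivative_at2)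
  then show ?thesis
    by (simp add: has_vector_derivative_def has_derivative_at2 bounded_linear_scaleR_left)
qed

lemma mat_exp_has_vector_derivative:
  "((\<lambda>t. mat_exp (t *\<^sub>R A)) has_vector_derivative A ** mat_exp (t *\<^sub>R A)) (at t)"
  by (intro has_vector_derivative_vec)
     (simp add: mat_exp_nth_has_derivative flip: has_real_derivative_iff_has_vector_derivative)

text \<open>The product \<open>h u\<close> has derivative zero because \<open>A\<close> commutes
  with its exponentials; comparing \<open>u = t\<close> with \<open>u = 0\<close> gives the
  functional equation without multiplying series.\<close>

lemma mat_exp_add_scaleR: "mat_exp ((s + t) *\<^sub>R A) = mat_exp (s *\<^sub>R A) ** mat_exp (t *\<^sub>R A)"
proof -
  define h where "h = (\<lambda>u. mat_exp ((s + t - u) *\<^sub>R A) ** mat_exp (u *\<^sub>R A))"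
  have "(h has_vector_derivative 0) (at u within UNIV)" for u
  proof -
    have "((\<lambda>u. mat_exp ((s + t - u) *\<^sub>R A)) has_vector_derivative
        (- 1) *\<^sub>R (A ** mat_exp ((s + t - u) *\<^sub>R A))) (at u)"
      by (rule vector_diff_chain_at[unfolded o_def, OF _ mat_exp_has_vector_derivative])
         (auto intro!: derivative_eq_intros simp: has_vector_derivative_def)
    from bounded_bilinear.has_vector_derivative[OF bounded_bilinear_matrix_mult this
        mat_exp_has_vector_derivative]
    have "(h has_vector_derivative mat_exp ((s + t - u) *\<^sub>R A) ** (A ** mat_exp (u *\<^sub>R A))
        + ((- 1) *\<^sub>R (A ** mat_exp ((s + t - u) *\<^sub>R A))) ** mat_exp (u *\<^sub>R A)) (at u)"
      unfolding h_def by simp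
    also have "mat_exp ((s + t - u) *\<^sub>R A) ** (A ** mat_exp (u *\<^sub>R A))
        + ((- 1) *\<^sub>R (A ** mat_exp ((s + t - u) *\<^sub>R A))) ** mat_exp (u *\<^sub>R A) = 0"
      by (simp only: bounded_bilinear.scaleR_left[OF bounded_bilinear_matrix_mult])
         (simp add: matrix_mul_assoc mat_exp_mult_commute_scaleR)
    finally show ?thesis by simp
  qed
  then have "\<And>u. h u = h 0"
    using has_vector_derivative_zero_constant[of UNIV h] by (metis convex_UNIV UNIV_I)
  then have "h t = h 0" .
  then show ?thesis by (simp add: h_def)
qed

section \<open>Growth of matrix exponentials and eigenvalues\<close>

abbreviation cmat :: "real^'m^'m \<Rightarrow> complex^'m^'m" where
  "cmat \<equiv> map_matrix complex_of_real"

lemma cmat_app_smult: "cmat A *v (z *s v) = z *s (cmat A *v v)"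
  by (simp add: vec_eq_iff matrix_vector_mult_def algebra_simps sum_distrib_left)

lemma cmat_mult_app: "cmat (A ** B) *v v = cmat A *v (cmat B *v v)"
  by (simp add: vec_eq_iff matrix_vector_mult_def matrix_matrix_mult_def
      sum_distrib_left sum_distrib_right mult.assoc) (rule allI, rule sum.swap)

text \<open>This is \<open>A - z\<close> acting on complex vectors, kept as a map so that a product
  over a list of eigenvalues is a composition.\<close>

definition eig_shift :: "real^'m^'m \<Rightarrow> complex \<Rightarrow> complex^'m \<Rightarrow> complex^'m" where
  "eig_shift A z v = cmat A *v v - z *s v"

definition eig_shifts :: "real^'m^'m \<Rightarrow> complex list \<Rightarrow> complex^'m \<Rightarrow> complex^'m" where
  "eig_shifts A zs v = foldr (eig_shift A) zs v"

lemma eig_shifts_Nil [simp]: "eig_shifts A [] v = v"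
  and eig_shifts_Cons: "eig_shifts A (z # zs) v = eig_shift A z (eig_shifts A zs v)"
  by (simp_all add: eig_shifts_def)

lemma eig_shift_linear: "linear (eig_shift A z)"
  by (rule linearI)
     (simp_all add: eig_shift_def vec_eq_iff matrix_vector_mult_def algebra_simps sum.distrib scaleR_sum_right)

lemma eig_shift_smult: "eig_shift A z (c *s v) = c *s eig_shift A z v"
  by (simp add: eig_shift_def vec_eq_iff matrix_vector_mult_def algebra_simps sum_distrib_left)

lemma eig_shifts_linear: "linear (eig_shifts A zs)"
proof (induction zs)
  case Nil
  then show ?case by (simp add: eig_shifts_def linear_iff)
next
  case (Cons z zs)
  from linear_compose[OF this eig_shift_linear[of A z]] show ?case
    by (simp add: eig_shifts_def o_def)
qed

lemma eig_shift_commute: "eig_shift A z (eig_shift A w v) = eig_shift A w (eig_shift A z v)"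
  by (simp add: eig_shift_def matrix_vector_mult_diff_distrib vector_sub_rdistrib
      vector_smult_assoc cmat_app_smult algebra_simps)

lemma eig_shifts_commute: "eig_shifts A zs (eig_shift A w v) = eig_shift A w (eig_shifts A zs v)"
  by (induction zs) (simp_all add: eig_shifts_Cons eig_shift_commute[of A w])

lemma eig_shifts_append: "eig_shifts A (zs @ ws) v = eig_shifts A zs (eig_shifts A ws v)"
  by (simp add: eig_shifts_def)

text \<open>Horner's scheme for \<open>p(A) v\<close>.\<close>

definition poly_mat_app :: "real^'m^'m \<Rightarrow> complex poly \<Rightarrow> complex^'m \<Rightarrow> complex^'m" where
  "poly_mat_app A p v = fold_coeffs (\<lambda>a x. a *s v + cmat A *v x) p 0"

lemma poly_mat_app_0 [simp]: "poly_mat_app A 0 v = 0"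
  by (simp add: poly_mat_app_def)

lemma poly_mat_app_pCons [simp]:
  "poly_mat_app A (pCons a p) v = a *s v + cmat A *v poly_mat_app A p v"
  by (cases "p = 0"; cases "a = 0") (simp_all add: poly_mat_app_def)

lemma poly_mat_app_add: "poly_mat_app A (p + q) v = poly_mat_app A p v + poly_mat_app A q v"
  by (induction p q rule: poly_induct2)
     (simp_all add: matrix_vector_right_distrib vector_sadd_rdistrib)

lemma poly_mat_app_smult: "poly_mat_app A (smult c p) v = c *s poly_mat_app A p v"
proof (induction p)
  case (pCons a p)
  then show ?case by (simp add: vector_add_ldistrib vector_smult_assoc cmat_app_smult)
qed simp

lemma poly_mat_app_linear_factor:
  "poly_mat_app A ([:- z, 1:] * p) v = eig_shift A z (poly_mat_app A p v)"
proof -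
  have "[:- z, 1:] * p = smult (- z) p + pCons 0 p" by simp
  then show ?thesis
    by (simp only: poly_mat_app_add poly_mat_app_smult)
       (simp add: eig_shift_def vec_eq_iff)
qed

lemma poly_mat_app_monom:
  "poly_mat_app A (monom c n) v = c *s (cmat (mat_pow A n) *v v)"
proof (induction n)
  case 0
  have "cmat (mat 1) *v v = v"
    by (simp add: vec_eq_iff matrix_vector_mult_def mat_def if_distrib[of complex_of_real] if_distrib[of "\<lambda>x. x * _"] cong: if_cong)
  then show ?case by (simp add: monom_0)
next
  case (Suc n)
  then show ?case by (simp add: monom_Suc mat_pow_Suc cmat_mult_app cmat_app_smult)
qed

text \<open>Dimension count: one more power of \<open>A\<close> than the dimension of the matrix
  space must be linearly dependent. Neither minimality nor the degree of the polynomial matters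
  later.\<close>

lemma exists_annihilating_poly: "\<exists>p \<noteq> 0. \<forall>v. poly_mat_app (A :: real^'m^'m) p v = 0"
proof -
  let ?N = "DIM(real^'m^'m)"
  have "\<exists>c. (\<exists>i\<le>?N. c i \<noteq> 0) \<and> (\<Sum>i\<le>?N. c i *\<^sub>R mat_pow A i) = 0"
  \<comment> \<open>\<open>dependent\<close> speaks of sets and does not see repetitions, so
    coinciding powers are treated separately; there the difference of two equal powers is the
    relation.\<close>
  proof (cases "inj_on (mat_pow A) {..?N}")
    case True
    let ?S = "mat_pow A ` {..?N}"
    have "card ?S = Suc ?N" using True by (simp add: card_image)
    then have "dependent ?S" by (intro dependent_biggerset) simp
    then obtain u where u: "\<exists>v\<in>?S. u v \<noteq> 0" "(\<Sum>v\<in>?S. u v *\<^sub>R v) = 0"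
      by (auto simp: dependent_finite)
    then show ?thesis
      using True by (intro exI[of _ "u \<circ> mat_pow A"]) (auto simp: sum.reindex)
  next
    case False
    then obtain i j where ij: "i \<le> ?N" "j \<le> ?N" "i \<noteq> j" "mat_pow A i = mat_pow A j"
      by (auto simp: inj_on_def)
    have "(\<Sum>k\<le>?N. ((if k = i then 1 else 0) - (if k = j then 1 else 0)) *\<^sub>R mat_pow A k)
      = mat_pow A i - mat_pow A j"
      using ij(1,2) by (simp add: scaleR_left_diff_distrib sum_subtractf if_distrib[of "\<lambda>x. x *\<^sub>R _"] cong: if_cong)
    then show ?thesis using ij
      by (intro exI[of _ "\<lambda>k. (if k = i then 1 else 0) - (if k = j then 1 else 0)"]) auto
  qed
  then obtain c i where c: "i \<le> ?N" "c i \<noteq> 0" "(\<Sum>i\<le>?N. c i *\<^sub>R mat_pow A i) = 0" by blast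
  define p where "p = (\<Sum>i\<le>?N. monom (complex_of_real (c i)) i)"
  have "coeff p i = complex_of_real (c i)"
    using c(1) by (simp add: p_def coeff_sum coeff_monom)
  then have "p \<noteq> 0" using c(2) by auto
  moreover have "poly_mat_app A p v = 0" for v
  proof -
    have "poly_mat_app A (\<Sum>i\<in>I. monom (complex_of_real (c i)) i) v
       = cmat (\<Sum>i\<in>I. c i *\<^sub>R mat_pow A i) *v v" if "finite I" for I
      using that
    proof (induction I rule: finite_induct)
      case empty
      then show ?case by (simp add: vec_eq_iff matrix_vector_mult_def)
    next
      case (insert i I)
      have "cmat (c i *\<^sub>R mat_pow A i + M) *v v = complex_of_real (c i) *s (cmat (mat_pow A i) *v v) + cmat M *v v" for M
        by (simp add: vec_eq_iff matrix_vector_mult_def algebra_simps sum.distrib sum_distrib_left)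
      then show ?case using insert
        by (simp add: poly_mat_app_add poly_mat_app_monom)
    qed
    from this[of "{..?N}"] show ?thesis
      unfolding p_def c(3) by (simp add: vec_eq_iff matrix_vector_mult_def)
  qed
  ultimately show ?thesis by blast
qed

lemma complex_eigenvalues_iff:
  "z \<in> complex_eigenvalues A \<longleftrightarrow> (\<exists>v. v \<noteq> 0 \<and> eig_shift A z v = 0)"
  by (auto simp: complex_eigenvalues_def eig_shift_def)

text \<open>A root \<open>z\<close> of \<open>p\<close> is split off at each step. If
  \<open>z\<close> is an eigenvalue, its factor moves into the list; otherwise \<open>A - z\<close>
  is injective and, commuting with the other factors, can be cancelled. At degree 0 the list alone
  annihilates.\<close>

lemma eig_shifts_annihilate_aux:
  assumes "p \<noteq> 0" "set zs \<subseteq> complex_eigenvalues A"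
    "\<And>v. eig_shifts A zs (poly_mat_app A p v) = 0"
  shows "\<exists>zs. set zs \<subseteq> complex_eigenvalues A \<and> (\<forall>v. eig_shifts A zs v = 0)"
  using assms
proof (induction "degree p" arbitrary: p zs)
  case 0
  then obtain c where c: "p = [:c:]" "c \<noteq> 0"
    by (metis degree_eq_zeroE pCons_0_0)
  have "eig_shifts A zs v = 0" for v
  proof -
    have "v = poly_mat_app A p ((1 / c) *s v)" using c by (simp add: vec_eq_iff)
    then show ?thesis using 0(4) by metis
  qed
  then show ?case using 0 by blast
next
  case (Suc n)
  then obtain z where "poly p z = 0"
    using alg_closed_imp_poly_has_root[of p] by auto
  then obtain r where r: "p = [:- z, 1:] * r"
    by (meson poly_eq_0_iff_dvd dvdE)
  have r0: "r \<noteq> 0" using r Suc.prems by auto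
  have "degree p = Suc (degree r)"
    using r0 unfolding r by (subst degree_mult_eq) auto
  with Suc have deg: "n = degree r" by simp
  have *: "eig_shifts A zs (eig_shift A z (poly_mat_app A r v)) = 0" for v
    using Suc.prems(3)[of v] unfolding r poly_mat_app_linear_factor .
  show ?case
  proof (cases "z \<in> complex_eigenvalues A")
    case True
    show ?thesis
      by (rule Suc.hyps(1)[OF deg r0, of "zs @ [z]"])
         (use True Suc.prems * in \<open>auto simp: eig_shifts_append eig_shifts_Cons\<close>)
  next
    case False
    then have "eig_shifts A zs (poly_mat_app A r v) = 0" for v
      using *[of v] unfolding eig_shifts_commute complex_eigenvalues_iff by blast
    then show ?thesis using Suc.hyps(1)[OF deg r0] Suc.prems by blast
  qed
qed

text \<open>On an eigenvector for \<open>z\<close> the product acts as the scalar product of all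
  \<open>z - w\<close>. Since this is 0, every eigenvalue occurs in the list, which yields the
  finiteness and nonemptiness needed for \<open>Min\<close> and \<open>Max\<close>.\<close>

lemma eig_shifts_annihilate:
  "\<exists>zs. set zs = complex_eigenvalues A \<and> zs \<noteq> [] \<and> (\<forall>v. eig_shifts A zs v = 0)"
proof -
  obtain p where "p \<noteq> 0" "\<And>v. poly_mat_app A p v = 0"
    using exists_annihilating_poly by blast
  then obtain zs where zs: "set zs \<subseteq> complex_eigenvalues A" "\<And>v. eig_shifts A zs v = 0"
    using eig_shifts_annihilate_aux[of p "[]" A] by auto
  have "z \<in> set zs" if "z \<in> complex_eigenvalues A" for z
  proof -
    from that obtain v where v: "v \<noteq> 0" "cmat A *v v = z *s v"
      unfolding complex_eigenvalues_def by blast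
    have "eig_shifts A ws v = (\<Prod>w\<leftarrow>ws. z - w) *s v" for ws
    proof (induction ws)
      case (Cons w ws)
      have "eig_shift A w (c *s v) = ((z - w) * c) *s v" for c
        unfolding eig_shift_smult by (simp add: eig_shift_def v vec_eq_iff algebra_simps)
      then show ?case using Cons by (simp add: eig_shifts_Cons)
    qed simp
    with zs(2) v(1) have "(\<Prod>w\<leftarrow>zs. z - w) = 0"
      by (metis vector_mul_eq_0)
    then show ?thesis by (auto simp: prod_list_zero_iff)
  qed
  \<comment> \<open>The empty product is the identity, which does not kill the all-ones vector
    \<open>1\<close>.\<close>
  moreover have "zs \<noteq> []"
    using zs(2)[of 1] by auto
  ultimately show ?thesis using zs by blast
qed

lemma finite_complex_eigenvalues: "finite (complex_eigenvalues A)"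
  and complex_eigenvalues_nonempty: "complex_eigenvalues A \<noteq> {}"
  proof -
  obtain zs where "set zs = complex_eigenvalues A" "zs \<noteq> []"
    using eig_shifts_annihilate by blast
  then show "finite (complex_eigenvalues A)" "complex_eigenvalues A \<noteq> {}"
    by (metis finite_set) (use \<open>set zs = _\<close> \<open>zs \<noteq> []\<close> in \<open>metis set_empty\<close>)
qed

text \<open>Variation of constants: \<open>h\<close> removes the homogeneous solution, and its
  derivative is at most \<open>K * exp (d * t)\<close> with \<open>d = a - Re z\<close>. Because
  \<open>d > 0\<close>, integration costs only the factor \<open>1 / d\<close>; at
  \<open>d = 0\<close> a factor \<open>t\<close> would appear.\<close>

lemma linear_ode_bound:
  fixes y g :: "real \<Rightarrow> complex"
  assumes y: "\<And>t. (y has_vector_derivative z * y t + g t) (at t)"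
    and g: "\<And>t. t \<ge> 0 \<Longrightarrow> norm (g t) \<le> K * exp (a * t)" and z: "Re z < a"
  shows "\<exists>K. \<forall>t\<ge>0. norm (y t) \<le> K * exp (a * t)"
proof -
  define d where "d = a - Re z"
  define h where "h t = exp (- (z * of_real t)) * y t" for t
  have d: "d > 0" using z by (simp add: d_def)
  have K0: "K \<ge> 0" using g[of 0] norm_ge_zero[of "g 0"] by (simp add: order_trans[OF norm_ge_zero])
  have dh: "(h has_vector_derivative exp (- (z * of_real t)) * g t) (at t)" for t
  proof -
    have "((\<lambda>t. exp (- (z * of_real t))) has_vector_derivative (- z) * exp (- (z * of_real t))) (at t)"
      by (rule has_vector_derivative_real_field) (auto intro!: derivative_eq_intros)
    from has_vector_derivative_mult[OF this y] show ?thesis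
      unfolding h_def by (simp add: algebra_simps)
  qed
  have "norm (y t) \<le> (norm (y 0) + K / d) * exp (a * t)" if t: "t \<ge> 0" for t
  proof (cases "t = 0")
    case True
    then show ?thesis using d K0 by simp
  next
    case False
    with t have t: "t > 0" by simp
    have "norm (h t - h 0) \<le> K / d * exp (d * t) - K / d * exp (d * 0)"
    proof (rule differentiable_bound_general[where f' = "\<lambda>t. exp (- (z * of_real t)) * g t" and \<phi>' = "\<lambda>t. K * exp (d * t)"])
      show "continuous_on {0..t} h"
        using dh by (meson continuous_at_imp_continuous_on has_vector_derivative_continuous)
      show "continuous_on {0..t} (\<lambda>t. K / d * exp (d * t))" by (intro continuous_intros)
      fix x assume x: "0 < x" "x < t"
      show "(h has_vector_derivative exp (- (z * of_real x)) * g x) (at x)" by (rule dh)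
      show "((\<lambda>t. K / d * exp (d * t)) has_vector_derivative K * exp (d * x)) (at x)"
        unfolding has_real_derivative_iff_has_vector_derivative[symmetric]
        using d by (auto intro!: derivative_eq_intros)
      have "norm (exp (- (z * of_real x)) * g x) \<le> exp (- (Re z * x)) * (K * exp (a * x))"
        using g[of x] x by (simp add: norm_mult)
      also have "\<dots> = K * exp (d * x)" by (simp add: d_def algebra_simps flip: exp_add)
      finally show "norm (exp (- (z * of_real x)) * g x) \<le> K * exp (d * x)" .
    qed (use t in auto)
    then have "norm (h t) \<le> norm (h 0) + K / d * exp (d * t)"
      using norm_triangle_ineq2[of "h t" "h 0"] divide_nonneg_pos[OF K0 d] by simp
    then have "exp (Re z * t) * norm (h t) \<le> exp (Re z * t) * (norm (h 0) + K / d * exp (d * t))"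
      by (intro mult_left_mono) auto
    moreover have "exp (Re z * t) * norm (h t) = norm (y t)"
      by (simp add: h_def norm_mult flip: exp_add mult.assoc)
    moreover have "exp (Re z * t) * exp (d * t) = exp (a * t)"
      by (simp add: d_def algebra_simps flip: exp_add)
    moreover have "norm (h 0) = norm (y 0)" by (simp add: h_def)
    moreover have "exp (Re z * t) * norm (y 0) \<le> exp (a * t) * norm (y 0)"
      using z t by (intro mult_right_mono) auto
    ultimately show ?thesis by (simp add: algebra_simps)
  qed
  then show ?thesis by blast
qed

text \<open>Let \<open>w\<close> be a column of \<open>exp(tA)\<close>. Each \<open>(A - z\<^sub>k) \<cdots> (A - z\<^sub>n) w\<close> drives a scalar linear equation
  with rate \<open>z\<^sub>k\<close> for its predecessor \<open>(A - z\<^sub>k\<^sub>+\<^sub>1) \<cdots> (A - z\<^sub>n) w\<close>, and the full product annihilates \<open>w\<close>.\<close>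

lemma norm_mat_exp_le:
  fixes A :: "real^'m^'m"
  assumes "\<And>z. z \<in> complex_eigenvalues A \<Longrightarrow> Re z < a"
  shows "\<exists>K>0. \<forall>t\<ge>0. norm (mat_exp (t *\<^sub>R A)) \<le> K * exp (a * t)"
proof -
  obtain zs where zs: "set zs = complex_eigenvalues A" "\<And>v. eig_shifts A zs v = 0"
    using eig_shifts_annihilate by blast
  have "\<exists>K. \<forall>t\<ge>0. \<bar>mat_exp (t *\<^sub>R A) $ i $ j\<bar> \<le> K * exp (a * t)" for i j
  proof -
    define w :: "real \<Rightarrow> complex^'m" where "w t = (\<chi> i. of_real (mat_exp (t *\<^sub>R A) $ i $ j))" for t
    have dw: "(w has_vector_derivative cmat A *v w t) (at t)" for t
    proof (rule has_vector_derivative_vec)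
      fix i
      have "((\<lambda>t. complex_of_real (mat_exp (t *\<^sub>R A) $ i $ j)) has_vector_derivative
          of_real ((A ** mat_exp (t *\<^sub>R A)) $ i $ j)) (at t)"
        by (intro has_vector_derivative_of_real mat_exp_nth_has_derivative)
      then show "((\<lambda>t. w t $ i) has_vector_derivative (cmat A *v w t) $ i) (at t)"
        by (simp add: w_def matrix_matrix_mult_def matrix_vector_mult_def)
    qed
    have du: "((\<lambda>t. eig_shifts A ws (w t)) has_vector_derivative
       z *s eig_shifts A ws (w t) + eig_shifts A (z # ws) (w t)) (at t)" for ws z t
    proof -
      have "bounded_linear (eig_shifts A ws)"
        using eig_shifts_linear linear_conv_bounded_linear by blast
      from bounded_linear.has_vector_derivative[OF this dw]
      have "((\<lambda>t. eig_shifts A ws (w t)) has_vector_derivative eig_shifts A ws (eig_shift A 0 (w t))) (at t)"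
        by (simp add: eig_shift_def)
      also have "eig_shifts A ws (eig_shift A 0 (w t)) = eig_shift A 0 (eig_shifts A ws (w t))"
        by (rule eig_shifts_commute)
      finally show ?thesis by (simp add: eig_shift_def eig_shifts_Cons)
    qed
    have "set ws \<subseteq> complex_eigenvalues A \<Longrightarrow>
      \<forall>i. \<exists>K. \<forall>t\<ge>0. norm (eig_shifts A ws (w t) $ i) \<le> K * exp (a * t) \<Longrightarrow>
      \<forall>i. \<exists>K. \<forall>t\<ge>0. norm (w t $ i) \<le> K * exp (a * t)" for ws
    proof (induction ws)
      case (Cons z ws)
      have "\<exists>K. \<forall>t\<ge>0. norm (eig_shifts A ws (w t) $ i) \<le> K * exp (a * t)" for i
      proof -
        obtain K where "\<forall>t\<ge>0. norm (eig_shifts A (z # ws) (w t) $ i) \<le> K * exp (a * t)"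
          using Cons.prems(2) by blast
        moreover have "((\<lambda>t. eig_shifts A ws (w t) $ i) has_vector_derivative
          z * eig_shifts A ws (w t) $ i + eig_shifts A (z # ws) (w t) $ i) (at t)" for t
          using bounded_linear.has_vector_derivative[OF bounded_linear_vec_nth[of i] du[of ws z t]]
          by simp
        ultimately show ?thesis
          using assms[of z] Cons.prems(1) by (intro linear_ode_bound) auto
      qed
      then show ?case using Cons by auto
    qed simp
    from this[of zs] have "\<forall>i. \<exists>K. \<forall>t\<ge>0. norm (w t $ i) \<le> K * exp (a * t)"
      using zs by (simp add: exI[of _ 0])
    then show ?thesis by (simp add: w_def)
  qed
  then obtain K where K: "\<And>i j t. t \<ge> 0 \<Longrightarrow> \<bar>mat_exp (t *\<^sub>R A) $ i $ j\<bar> \<le> K i j * exp (a * t)"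
    by metis
  define L where "L = (\<Sum>i\<in>UNIV. \<Sum>j\<in>UNIV. \<bar>K i j\<bar>) + 1"
  have "norm (mat_exp (t *\<^sub>R A)) \<le> L * exp (a * t)" if "t \<ge> 0" for t
  proof -
    have "norm (mat_exp (t *\<^sub>R A)) \<le> (\<Sum>i\<in>UNIV. norm (mat_exp (t *\<^sub>R A) $ i))"
      unfolding norm_vec_def by (rule L2_set_le_sum) simp
    also have "\<dots> \<le> (\<Sum>i\<in>UNIV. \<Sum>j\<in>UNIV. \<bar>mat_exp (t *\<^sub>R A) $ i $ j\<bar>)"
      by (intro sum_mono norm_le_l1_cart)
    also have "\<dots> \<le> (\<Sum>i\<in>UNIV. \<Sum>j\<in>UNIV. \<bar>K i j\<bar> * exp (a * t))"
      by (intro sum_mono order_trans[OF K[OF that]] mult_right_mono) auto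
    also have "\<dots> \<le> L * exp (a * t)"
      unfolding L_def by (simp add: distrib_right flip: sum_distrib_right)
    finally show ?thesis .
  qed
  moreover have "L > 0" unfolding L_def by (intro add_nonneg_pos sum_nonneg) auto
  ultimately show ?thesis by blast
qed

section \<open>Spectral bounds and growth of powers \<open>s^A\<close>\<close>

lemma min_re_eig_le: "z \<in> complex_eigenvalues A \<Longrightarrow> min_re_eig A \<le> Re z"
  and max_re_eig_ge: "z \<in> complex_eigenvalues A \<Longrightarrow> Re z \<le> max_re_eig A"
  unfolding min_re_eig_def max_re_eig_def by (auto simp: finite_complex_eigenvalues)

lemma min_le_max_re_eig: "min_re_eig A \<le> max_re_eig A"
  using complex_eigenvalues_nonempty[of A] min_re_eig_le max_re_eig_ge by (metis ex_in_conv order_trans)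

lemma complex_eigenvalues_scaleR:
  assumes "c \<noteq> 0"
  shows "complex_eigenvalues (c *\<^sub>R A) = (\<lambda>z. of_real c * z) ` complex_eigenvalues A"
proof -
  have *: "cmat (c *\<^sub>R A) *v v = of_real c *s (cmat A *v v)" for v
    by (simp add: vec_eq_iff matrix_vector_mult_def sum_distrib_left algebra_simps)
  have "cmat (c *\<^sub>R A) *v v = z *s v \<longleftrightarrow> cmat A *v v = (z / of_real c) *s v" for z v
    unfolding * using assms by (simp add: vec_eq_iff field_simps)
  then have "z \<in> complex_eigenvalues (c *\<^sub>R A) \<longleftrightarrow> z / of_real c \<in> complex_eigenvalues A" for z
    by (simp add: complex_eigenvalues_def)
  then have "complex_eigenvalues (c *\<^sub>R A) = (\<lambda>z. z / of_real c) -` complex_eigenvalues A"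
    by auto
  also have "\<dots> = (\<lambda>z. of_real c * z) ` complex_eigenvalues A"
  proof (intro equalityI subsetI)
    fix z assume "z \<in> (\<lambda>z. z / of_real c) -` complex_eigenvalues A"
    then show "z \<in> (\<lambda>z. of_real c * z) ` complex_eigenvalues A"
      using assms by (intro image_eqI[of _ _ "z / of_real c"]) auto
  qed (use assms in auto)
  finally show ?thesis .
qed

lemma min_re_eig_scaleR: "c > 0 \<Longrightarrow> min_re_eig (c *\<^sub>R A) = c * min_re_eig A"
  and max_re_eig_scaleR: "c > 0 \<Longrightarrow> max_re_eig (c *\<^sub>R A) = c * max_re_eig A"
proof -
  assume c: "c > 0"
  then have *: "Re ` complex_eigenvalues (c *\<^sub>R A) = (\<lambda>x. c * x) ` Re ` complex_eigenvalues A"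
    by (simp add: complex_eigenvalues_scaleR image_image)
  have m: "mono ((*) c)" using c by (intro monoI) simp
  show "min_re_eig (c *\<^sub>R A) = c * min_re_eig A"
    unfolding min_re_eig_def *
    by (rule mono_Min_commute[OF m, symmetric]) (auto simp: finite_complex_eigenvalues complex_eigenvalues_nonempty)
  show "max_re_eig (c *\<^sub>R A) = c * max_re_eig A"
    unfolding max_re_eig_def *
    by (rule mono_Max_commute[OF m, symmetric]) (auto simp: finite_complex_eigenvalues complex_eigenvalues_nonempty)
qed

text \<open>The determinant form makes invariance of the spectrum under transposition visible; the
  stability relation involves the adjoint of \<open>B\<close>, the hypotheses \<open>B\<close>
  itself.\<close>

lemma complex_eigenvalues_det: "z \<in> complex_eigenvalues A \<longleftrightarrow> det (cmat A - mat z) = 0"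
proof -
  have "(cmat A - mat z) *v v = eig_shift A z v" for v
    by (simp add: eig_shift_def matrix_vector_mult_diff_rdistrib)
       (simp add: vec_eq_iff matrix_vector_mult_def mat_def if_distrib[of "\<lambda>x. x * _"] cong: if_cong)
  then show ?thesis
    unfolding complex_eigenvalues_iff
    using matrix_left_invertible_ker[of "cmat A - mat z"] invertible_det_nz[of "cmat A - mat z"]
      invertible_left_inverse[of "cmat A - mat z"] by auto
qed

lemma complex_eigenvalues_transpose: "complex_eigenvalues (transpose A) = complex_eigenvalues A"
proof -
  have "cmat (transpose A) - mat z = transpose (cmat A - mat z)" for z
    by (auto simp: vec_eq_iff transpose_def mat_def)
  then show ?thesis
    by (auto simp: complex_eigenvalues_det)
qed

lemma mat_powr_bound_ge_1:
  assumes "max_re_eig A < a"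
  shows "\<exists>K>0. \<forall>s\<ge>1. norm (mat_powr s A) \<le> K * s powr a"
proof -
  obtain K where K: "K > 0" "\<And>t. t \<ge> 0 \<Longrightarrow> norm (mat_exp (t *\<^sub>R A)) \<le> K * exp (a * t)"
    using norm_mat_exp_le[of A a] assms max_re_eig_ge[of _ A] by (meson order_le_less_trans)
  then show ?thesis
    by (intro exI[of _ K]) (auto simp: mat_powr_def powr_def)
qed

text \<open>For \<open>s \<le> 1\<close> the power is \<open>mat_exp\<close> of \<open>-A\<close> at
  the nonnegative time \<open>- ln s\<close>, and the eigenvalues of \<open>-A\<close> have real
  part below \<open>- a\<close>.\<close>

lemma mat_powr_bound_le_1:
  assumes "a < min_re_eig A"
  shows "\<exists>K>0. \<forall>s. 0 < s \<longrightarrow> s \<le> 1 \<longrightarrow> norm (mat_powr s A) \<le> K * s powr a"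
proof -
  have "Re z < - a" if "z \<in> complex_eigenvalues ((-1) *\<^sub>R A)" for z
  proof -
    have "- z \<in> complex_eigenvalues A"
      using that unfolding complex_eigenvalues_scaleR[of "-1" A, OF zero_neq_neg_one[symmetric]] by auto
    then show ?thesis using assms min_re_eig_le[of "- z" A] by simp
  qed
  then obtain K where K: "K > 0" "\<And>t. t \<ge> 0 \<Longrightarrow> norm (mat_exp (t *\<^sub>R ((-1) *\<^sub>R A))) \<le> K * exp (- a * t)"
    using norm_mat_exp_le by blast
  have "norm (mat_powr s A) \<le> K * s powr a" if "0 < s" "s \<le> 1" for s
    using K(2)[of "- ln s"] that by (simp add: mat_powr_def powr_def)
  then show ?thesis using K(1) by blast
qed

section \<open>Matrix powers\<close>

text \<open>Product rule in the Leibniz formula at the identity matrix. A permutation other than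
  \<open>id\<close> moves at least two points, so with one factor differentiated an off-diagonal 0
  remains; only \<open>id\<close> contributes, giving the trace.\<close>

lemma det_mat_exp_has_derivative_0:
  "((\<lambda>t. det (mat_exp (t *\<^sub>R A))) has_field_derivative trace A) (at 0)"
proof -
  let ?S = "{p. p permutes (UNIV :: 'a set)}"
  have fin: "finite ?S" by (simp add: finite_permutations)
  have 1: "((\<lambda>t. mat_exp (t *\<^sub>R A) $ i $ j) has_field_derivative A $ i $ j) (at 0)" for i j
    using mat_exp_nth_has_derivative[of A i j 0] by simp
  have "((\<lambda>t. det (mat_exp (t *\<^sub>R A))) has_field_derivative
     (\<Sum>p\<in>?S. of_int (sign p) * (\<Sum>i\<in>UNIV. A $ i $ p i * (\<Prod>j\<in>UNIV - {i}. (mat 1 :: real^'a^'a) $ j $ p j)))) (at 0)"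
    unfolding det_def
  proof (intro DERIV_sum DERIV_cmult)
    fix p :: "'a \<Rightarrow> 'a"
    show "((\<lambda>t. \<Prod>i\<in>UNIV. mat_exp (t *\<^sub>R A) $ i $ p i) has_field_derivative
       (\<Sum>i\<in>UNIV. A $ i $ p i * (\<Prod>j\<in>UNIV - {i}. (mat 1 :: real^'a^'a) $ j $ p j))) (at 0)"
      using has_field_derivative_prod[where A = UNIV and f = "\<lambda>i t. mat_exp (t *\<^sub>R A) $ i $ p i", OF 1]
      by simp
  qed
  moreover have "(\<Sum>p\<in>?S. of_int (sign p) * (\<Sum>i\<in>UNIV. A $ i $ p i * (\<Prod>j\<in>UNIV - {i}. (mat 1 :: real^'a^'a) $ j $ p j)))
     = (\<Sum>p\<in>?S. if p = id then trace A else 0)"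
  proof (intro sum.cong refl)
    fix p assume "p \<in> ?S"
    then have p: "p permutes (UNIV :: 'a set)" by simp
    show "of_int (sign p) * (\<Sum>i\<in>UNIV. A $ i $ p i * (\<Prod>j\<in>UNIV - {i}. (mat 1 :: real^'a^'a) $ j $ p j))
       = (if p = id then trace A else 0)"
    proof (cases "p = id")
      case True
      then show ?thesis by (simp add: trace_def mat_def)
    next
      case False
      have "(\<Prod>j\<in>UNIV - {i}. (mat 1 :: real^'a^'a) $ j $ p j) = 0" for i
      proof -
        have "\<exists>j. j \<noteq> i \<and> p j \<noteq> j"
        proof (rule ccontr)
          assume "\<not> ?thesis"
          then have f: "p j = j" if "j \<noteq> i" for j using that by blast
          have "p i = i"
          proof (rule ccontr)
            assume "p i \<noteq> i"
            then have "p (p i) = p i" by (rule f)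
            then show False using \<open>p i \<noteq> i\<close> permutes_inj[OF p] by (simp add: inj_eq)
          qed
          with f have "p = id" by (metis eq_id_iff)
          then show False using False by blast
        qed
        then obtain j where "j \<noteq> i" "p j \<noteq> j" by blast
        then show ?thesis by (intro prod_zero) (auto simp: mat_def intro!: bexI[of _ j])
      qed
      then show ?thesis using False by (simp del: prod_zero_iff)
    qed
  qed
  moreover have "\<dots> = trace A"
    using fin by (simp add: permutes_id)
  ultimately show ?thesis by simp
qed

text \<open>Multiplicativity of \<open>f\<close> carries the derivative at 0 to every
  \<open>t\<close>, so \<open>f\<close> solves \<open>f' = trace A * f\<close>; its product with
  \<open>exp (- (t * trace A))\<close> is constant.\<close>

lemma det_mat_exp: "det (mat_exp A) = exp (trace A)"
proof -
  define f where "f t = det (mat_exp (t *\<^sub>R A))" for t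
  have mult: "f (s + t) = f s * f t" for s t
    by (simp add: f_def mat_exp_add_scaleR det_mul)
  have df: "(f has_field_derivative f t * trace A) (at t)" for t
  proof -
    have "((\<lambda>s. f t * f s) has_field_derivative f t * trace A) (at 0)"
      using DERIV_cmult[OF det_mat_exp_has_derivative_0[of A]] by (simp add: f_def)
    moreover have "(\<lambda>s. f t * f s) = (\<lambda>s. f (s + t))"
      by (simp add: mult[symmetric] add.commute)
    ultimately show ?thesis using DERIV_shift[of f "f t * trace A" 0 t] by simp
  qed
  have "((\<lambda>t. f t * exp (- (t * trace A))) has_field_derivative 0) (at t)" for t
    by (rule DERIV_cong, rule DERIV_mult[OF df]) (auto intro!: derivative_eq_intros)
  then have "f 1 * exp (- (1 * trace A)) = f 0 * exp (- (0 * trace A))"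
    by (intro DERIV_isconst_all) auto
  then show ?thesis by (simp add: f_def exp_minus field_simps)
qed

lemma mat_powr_1 [simp]: "mat_powr 1 A = mat 1"
  by (simp add: mat_powr_def)

lemma mat_powr_0 [simp]: "mat_powr 0 A = 0"
  by (simp add: mat_powr_def)

lemma mat_powr_mult: "s > 0 \<Longrightarrow> t > 0 \<Longrightarrow> mat_powr (s * t) A = mat_powr s A ** mat_powr t A"
  by (simp add: mat_powr_def ln_mult mat_exp_add_scaleR)

lemma mat_powr_app_mult:
  "s > 0 \<Longrightarrow> t > 0 \<Longrightarrow> mat_powr s A *v (mat_powr t A *v x) = mat_powr (s * t) A *v x"
  by (simp add: mat_powr_mult matrix_vector_mul_assoc)

lemma transpose_mat_powr: "transpose (mat_powr s A) = mat_powr s (transpose A)"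
  by (simp add: mat_powr_def transpose_mat_exp transpose_scalar) (simp add: transpose_def vec_eq_iff)

lemma det_mat_powr: "s > 0 \<Longrightarrow> det (mat_powr s A) = s powr trace A"
  by (simp add: mat_powr_def det_mat_exp powr_def trace_def sum_distrib_left mult.commute)

lemma mat_powr_has_vector_derivative:
  assumes "s > 0"
  shows "((\<lambda>s. mat_powr s A) has_vector_derivative (1 / s) *\<^sub>R (A ** mat_powr s A)) (at s)"
proof -
  have "(ln has_vector_derivative 1 / s) (at s)"
    unfolding has_real_derivative_iff_has_vector_derivative[symmetric]
    using assms by (simp add: DERIV_ln_divide)
  then have "((\<lambda>s. mat_exp (ln s *\<^sub>R A)) has_vector_derivative (1 / s) *\<^sub>R (A ** mat_exp (ln s *\<^sub>R A))) (at s)"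
    by (rule vector_diff_chain_at[unfolded o_def, OF _ mat_exp_has_vector_derivative])
  then have "((\<lambda>s. mat_powr s A) has_vector_derivative (1 / s) *\<^sub>R (A ** mat_exp (ln s *\<^sub>R A))) (at s)"
    by (rule has_vector_derivative_transform_within_open[where S = "{0<..}"])
       (use assms in \<open>auto simp: mat_powr_def\<close>)
  then show ?thesis using assms by (simp add: mat_powr_def)
qed

lemma continuous_on_mat_powr: "continuous_on {0<..} (\<lambda>s. mat_powr s A)"
  by (intro continuous_at_imp_continuous_on ballI
      has_vector_derivative_continuous[OF mat_powr_has_vector_derivative]) simp

lemma borel_measurable_mat_powr [measurable]: "(\<lambda>s. mat_powr s A) \<in> borel_measurable borel"
proof -
  have "(\<lambda>s. if s \<in> {0<..} then mat_powr s A else 0) \<in> borel_measurable borel"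
    by (rule borel_measurable_continuous_on_if) (auto intro: continuous_on_mat_powr)
  moreover have "(\<lambda>s. if s \<in> {0<..} then mat_powr s A else 0) = (\<lambda>s. mat_powr s A)"
    by (auto simp: mat_powr_def fun_eq_iff)
  ultimately show ?thesis by simp
qed

lemma bounded_mat_powr_interval:
  assumes "0 < a"
  shows "\<exists>K>0. \<forall>s. a \<le> s \<longrightarrow> s \<le> b \<longrightarrow> norm (mat_powr s A) \<le> K"
proof -
  have "compact ((\<lambda>s. mat_powr s A) ` {a..b})"
    by (rule compact_continuous_image[OF continuous_on_subset[OF continuous_on_mat_powr]]) (use assms in auto)
  then show ?thesis
    by (metis (no_types, lifting) atLeastAtMost_iff bounded_pos compact_imp_bounded image_eqI)
qed

text \<open>Mean value estimate on a compact interval around 1; it later turns admissibility, an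
  estimate for \<open>\<phi>\<close>, into one for powers of \<open>\<phi>\<close>.\<close>

lemma mat_powr_Lipschitz_near_1:
  "\<exists>K>0. \<forall>s. 1 / 2 \<le> s \<longrightarrow> s \<le> 2 \<longrightarrow> norm (mat_powr s A - mat 1) \<le> K * \<bar>s - 1\<bar>"
proof -
  obtain K where K: "K > 0" "\<And>s. 1 / 2 \<le> s \<Longrightarrow> s \<le> 2 \<Longrightarrow> norm (mat_powr s A) \<le> K"
    using bounded_mat_powr_interval[of "1/2" 2 A] by (meson half_gt_zero zero_less_one)
  \<comment> \<open>The 2 bounds \<open>1 / s\<close> for \<open>s \<ge> 1 / 2\<close>; the added 1
    keeps \<open>L\<close> positive when \<open>A = 0\<close>.\<close>
  define L where "L = 2 * (norm A * K) + 1"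
  have L: "L > 0" using K(1) by (simp add: L_def add_nonneg_pos)
  have "norm (mat_powr s A - mat_powr 1 A) \<le> L * norm (s - 1)" if s: "1 / 2 \<le> s" "s \<le> 2" for s
  proof (rule differentiable_bound[where S = "{1/2..2}" and f = "\<lambda>s. mat_powr s A" and f' = "\<lambda>s h. h *\<^sub>R ((1 / s) *\<^sub>R (A ** mat_powr s A))"])
    fix x :: real assume x: "x \<in> {1/2..2}"
    show "((\<lambda>s. mat_powr s A) has_derivative (\<lambda>h. h *\<^sub>R ((1 / x) *\<^sub>R (A ** mat_powr x A)))) (at x within {1/2..2})"
    proof -
      have "0 < x" using x by simp
      from mat_powr_has_vector_derivative[OF this, of A] show ?thesis
        unfolding has_vector_derivative_def by (rule has_derivative_at_withinI)
    qed
    have "norm (mat_powr x A) \<le> K" using x K(2) by simp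
    then have 1: "norm (A ** mat_powr x A) \<le> norm A * K"
      by (rule order_trans[OF norm_matrix_mult_le mult_left_mono]) simp
    have 2: "1 / x \<le> 2" using x by (simp add: field_simps)
    have "1 / x * norm (A ** mat_powr x A) \<le> 2 * (norm A * K)"
      by (rule mult_mono[OF 2 1]) simp_all
    then have "1 / x * norm (A ** mat_powr x A) \<le> L"
      unfolding L_def by linarith
    moreover have "norm ((1 / x) *\<^sub>R (A ** mat_powr x A)) = 1 / x * norm (A ** mat_powr x A)"
      using x unfolding norm_scaleR by simp
    ultimately have 3: "norm ((1 / x) *\<^sub>R (A ** mat_powr x A)) \<le> L" by linarith
    show "onorm (\<lambda>h. h *\<^sub>R ((1 / x) *\<^sub>R (A ** mat_powr x A))) \<le> L"
    proof (rule onorm_le)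
      fix h :: real
      show "norm (h *\<^sub>R ((1 / x) *\<^sub>R (A ** mat_powr x A))) \<le> L * norm h"
        unfolding norm_scaleR[of h] mult.commute[of L] real_norm_def
        by (rule mult_left_mono[OF 3]) simp
    qed
  next
    show "s \<in> {1/2..2}" using s by simp
  qed simp_all
  then have "\<forall>s. 1 / 2 \<le> s \<longrightarrow> s \<le> 2 \<longrightarrow> norm (mat_powr s A - mat 1) \<le> L * \<bar>s - 1\<bar>"
    unfolding mat_powr_1 real_norm_def by simp
  then show ?thesis using L by (intro exI[of _ L] conjI)
qed

lemma mat_powr_tendsto_0:
  assumes "min_re_eig A > 0"
  shows "((\<lambda>s. mat_powr s A) \<longlongrightarrow> 0) (at_right 0)"
proof -
  define a where "a = min_re_eig A / 2"
  have a: "0 < a" "a < min_re_eig A" using assms by (auto simp: a_def)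
  obtain K where K: "K > 0" "\<And>s. 0 < s \<Longrightarrow> s \<le> 1 \<Longrightarrow> norm (mat_powr s A) \<le> K * s powr a"
    using mat_powr_bound_le_1[OF a(2)] by blast
  have ev: "eventually (\<lambda>s::real. 0 < s \<and> s \<le> 1) (at_right 0)"
    by (rule eventually_at_rightI[of 0 1]) auto
  have "((\<lambda>s::real. s powr a) \<longlongrightarrow> 0) (at_right 0)"
    by (rule tendsto_zero_powrI[OF tendsto_ident_at tendsto_const])
       (use a(1) ev in \<open>auto elim: eventually_mono\<close>)
  then have lim: "((\<lambda>s::real. K * s powr a) \<longlongrightarrow> 0) (at_right 0)"
    by (rule tendsto_mult_right_zero)
  show ?thesis
    by (rule Lim_null_comparison[OF _ lim]) (use ev K(2) in \<open>auto elim!: eventually_mono\<close>)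
qed

text \<open>As \<open>s\<close> tends to 0, \<open>det (mat_powr s A) = s powr trace A\<close> tends
  to \<open>det 0 = 0\<close>, whereas a nonpositive trace would keep it at least 1. The trace need
  not be identified with the sum of the eigenvalues.\<close>

lemma trace_pos:
  assumes "A \<in> Q_matrices"
  shows "trace A > 0"
proof (rule ccontr)
  assume tr: "\<not> ?thesis"
  have "((\<lambda>s. det (mat_powr s A)) \<longlongrightarrow> det (0 :: real^'a^'a)) (at_right 0)"
    unfolding det_def
    by (intro tendsto_sum tendsto_mult tendsto_prod tendsto_const tendsto_vec_nth mat_powr_tendsto_0)
       (use assms in \<open>simp add: Q_matrices_def\<close>)
  moreover have "det (0 :: real^'a^'a) = 0"
    by (intro det_zero_row) (simp add: row_def vec_eq_iff)
  ultimately have "((\<lambda>s. det (mat_powr s A)) \<longlongrightarrow> 0) (at_right 0)" by simp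
  moreover have "eventually (\<lambda>s. 1 \<le> det (mat_powr s A)) (at_right 0)"
  proof (rule eventually_at_rightI[of 0 1])
    fix s :: real assume s: "s \<in> {0<..<1}"
    then have "s powr 0 \<le> s powr trace A"
      using tr by (intro powr_mono') auto
    then show "1 \<le> det (mat_powr s A)" using s by (simp add: det_mat_powr)
  qed simp
  ultimately have "(1::real) \<le> 0"
    by (rule tendsto_lowerbound) simp
  then show False by simp
qed

section \<open>Characteristic functions and their logarithms\<close>

lemma prob_distributionD:
  assumes "prob_distribution \<mu>"
  shows "prob_space \<mu>" "sets \<mu> = sets borel" "space \<mu> = UNIV"
  using assms sets_eq_imp_space_eq[of \<mu> borel] by (auto simp: prob_distribution_def)

lemma integrable_iexp_inner:
  assumes "prob_distribution \<mu>"
  shows "integrable \<mu> (\<lambda>x. iexp (x \<bullet> (u :: real^'m)))"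
proof -
  interpret prob_space \<mu> by (rule prob_distributionD(1)[OF assms])
  have [measurable_cong]: "sets \<mu> = sets borel" by (rule prob_distributionD(2)[OF assms])
  show ?thesis by (intro integrable_const_bound[of _ 1]) auto
qed

lemma vec_char_0:
  assumes "prob_distribution \<mu>"
  shows "vec_char \<mu> 0 = 1"
  using prob_space.prob_space[OF prob_distributionD(1)[OF assms]] by (simp add: vec_char_def)

lemma continuous_on_vec_char:
  assumes "prob_distribution (\<mu> :: (real^'m) measure)"
  shows "continuous_on UNIV (vec_char \<mu>)"
proof -
  interpret prob_space \<mu> by (rule prob_distributionD(1)[OF assms])
  have [measurable_cong]: "sets \<mu> = sets borel" by (rule prob_distributionD(2)[OF assms])
  have "isCont (vec_char \<mu>) u" for u
    unfolding continuous_at_sequentially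
  proof safe
    fix X assume X: "X \<longlonglongrightarrow> u"
    show "(vec_char \<mu> \<circ> X) \<longlonglongrightarrow> vec_char \<mu> u"
      unfolding comp_def vec_char_def
      by (rule integral_dominated_convergence[where w="\<lambda>_. 1"]) (auto intro!: tendsto_intros X)
  qed
  then show ?thesis by (simp add: continuous_at_imp_continuous_on)
qed

lemma prob_distribution_convolution:
  assumes "prob_distribution \<mu>" "prob_distribution (\<nu> :: (real^'m) measure)"
  shows "prob_distribution (\<mu> \<star> \<nu>)"
proof -
  interpret M: prob_space \<mu> by (rule prob_distributionD(1)[OF assms(1)])
  interpret N: prob_space \<nu> by (rule prob_distributionD(1)[OF assms(2)])
  interpret pair_prob_space \<mu> \<nu> ..
  have [measurable_cong]: "sets \<mu> = sets borel" "sets \<nu> = sets borel"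
    using assms by (auto dest: prob_distributionD)
  have "prob_space (\<mu> \<star> \<nu>)" unfolding convolution_def by (rule P.prob_space_distr) simp
  then show ?thesis by (simp add: prob_distribution_def)
qed

lemma vec_char_convolution:
  assumes "prob_distribution \<mu>" "prob_distribution (\<nu> :: (real^'m) measure)"
  shows "vec_char (\<mu> \<star> \<nu>) u = vec_char \<mu> u * vec_char \<nu> u"
proof -
  interpret M: prob_space \<mu> by (rule prob_distributionD(1)[OF assms(1)])
  interpret N: prob_space \<nu> by (rule prob_distributionD(1)[OF assms(2)])
  interpret pair_prob_space \<mu> \<nu> ..
  have [measurable_cong]: "sets \<mu> = sets borel" "sets \<nu> = sets borel"
    using assms by (auto dest: prob_distributionD)
  have "integrable (\<mu> \<Otimes>\<^sub>M \<nu>) (\<lambda>p. iexp ((fst p + snd p) \<bullet> u))"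
    by (intro P.integrable_const_bound[of _ 1]) auto
  from integral_fst'[OF this]
  have "vec_char (\<mu> \<star> \<nu>) u = (\<integral>x. (\<integral>y. iexp ((x + y) \<bullet> u) \<partial>\<nu>) \<partial>\<mu>)"
    unfolding vec_char_def convolution_def
    by (subst integral_distr) (auto simp: case_prod_beta)
  also have "\<dots> = (\<integral>x. iexp (x \<bullet> u) * vec_char \<nu> u \<partial>\<mu>)"
    by (simp add: vec_char_def inner_add_left distrib_left exp_add)
  also have "\<dots> = vec_char \<mu> u * vec_char \<nu> u"
    using integrable_iexp_inner[OF assms(1)] by (simp add: vec_char_def)
  finally show ?thesis .
qed

lemma prob_distribution_uminus:
  assumes "prob_distribution (\<mu> :: (real^'m) measure)"
  shows "prob_distribution (distr \<mu> borel uminus)"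
    and "vec_char (distr \<mu> borel uminus) u = cnj (vec_char \<mu> u)"
proof -
  interpret prob_space \<mu> by (rule prob_distributionD(1)[OF assms])
  have [measurable_cong]: "sets \<mu> = sets borel" by (rule prob_distributionD(2)[OF assms])
  show "prob_distribution (distr \<mu> borel uminus)"
    unfolding prob_distribution_def by (simp add: prob_space_distr)
  show "vec_char (distr \<mu> borel uminus) u = cnj (vec_char \<mu> u)"
  proof -
    have "vec_char (distr \<mu> borel uminus) u = (\<integral>x. cnj (iexp (x \<bullet> u)) \<partial>\<mu>)"
      unfolding vec_char_def by (subst integral_distr) (simp_all add: exp_cnj del: integral_cnj)
    also have "\<dots> = cnj (vec_char \<mu> u)"
      unfolding vec_char_def by (rule Bochner_Integration.integral_cnj)
    finally show ?thesis .
  qed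
qed

text \<open>Follows from \<open>1 - cos 2\<theta> \<le> 4 (1 - cos \<theta>)\<close> applied to the symmetrization of \<open>\<nu>\<close>.\<close>

lemma vec_char_doubling:
  assumes "prob_distribution (\<nu> :: (real^'m) measure)"
  shows "1 - (norm (vec_char \<nu> (2 *\<^sub>R u)))\<^sup>2 \<le> 4 * (1 - (norm (vec_char \<nu> u))\<^sup>2)"
proof -
  define \<sigma> where "\<sigma> = (\<nu> \<star> distr \<nu> borel uminus)"
  have \<sigma>: "prob_distribution \<sigma>"
    unfolding \<sigma>_def by (intro prob_distribution_convolution prob_distribution_uminus assms)
  interpret prob_space \<sigma> by (rule prob_distributionD(1)[OF \<sigma>])
  have [measurable_cong]: "sets \<sigma> = sets borel" by (rule prob_distributionD(2)[OF \<sigma>])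
  have re: "(norm (vec_char \<nu> v))\<^sup>2 = (\<integral>x. cos (x \<bullet> v) \<partial>\<sigma>)" for v
  proof -
    have "of_real ((norm (vec_char \<nu> v))\<^sup>2) = vec_char \<sigma> v"
      unfolding \<sigma>_def using assms
      by (simp only: vec_char_convolution prob_distribution_uminus complex_norm_square)
    then have "(norm (vec_char \<nu> v))\<^sup>2 = Re (vec_char \<sigma> v)"
      by (metis Re_complex_of_real)
    also have "\<dots> = (\<integral>x. Re (iexp (x \<bullet> v)) \<partial>\<sigma>)"
      unfolding vec_char_def by (rule integral_Re[symmetric, OF integrable_iexp_inner[OF \<sigma>]])
    finally show ?thesis by (simp add: Re_exp)
  qed
  have int: "integrable \<sigma> (\<lambda>x. cos (x \<bullet> v))" for v
    by (intro integrable_const_bound[of _ 1]) auto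
  have "1 - cos (2 * y) \<le> 4 * (1 - cos y)" for y :: real
  proof -
    have "0 \<le> 2 * (1 - cos y)\<^sup>2" by simp
    then show ?thesis unfolding cos_double_cos by (simp add: power2_eq_square algebra_simps)
  qed
  then have "(\<integral>x. 1 - cos (x \<bullet> (2 *\<^sub>R u)) \<partial>\<sigma>) \<le> (\<integral>x. 4 * (1 - cos (x \<bullet> u)) \<partial>\<sigma>)"
    by (intro integral_mono Bochner_Integration.integrable_diff integrable_mult_right int) auto
  then show ?thesis
    using int[of u] int[of "2 *\<^sub>R u"] by (simp add: re prob_space)
qed

text \<open>Nonvanishing passes from \<open>u\<close> to \<open>2 u\<close>: a high convolution root
  has modulus close to 1 at \<open>u\<close>, so the doubling inequality keeps it away from 0 at
  \<open>2 u\<close>. Continuity at 0 provides a starting point \<open>u / 2^k\<close>.\<close>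

lemma infinitely_divisible_vec_char_nz:
  assumes "infinitely_divisible (\<mu> :: (real^'m) measure)"
  shows "vec_char \<mu> u \<noteq> 0"
proof -
  have \<mu>: "prob_distribution \<mu>" using assms by (simp add: infinitely_divisible_def)
  have root: "\<exists>\<nu>. prob_distribution \<nu> \<and> (\<forall>u. vec_char \<mu> u = vec_char \<nu> u ^ n)" if n: "n \<ge> 1" for n
  proof -
    obtain \<nu> where \<nu>: "prob_distribution \<nu>" "\<mu> = ((\<lambda>\<rho>. \<nu> \<star> \<rho>) ^^ n) (return borel 0)"
      using assms n by (auto simp: infinitely_divisible_def)
    have "prob_distribution (((\<lambda>\<rho>. \<nu> \<star> \<rho>) ^^ n) (return borel 0)) \<and>
       vec_char (((\<lambda>\<rho>. \<nu> \<star> \<rho>) ^^ n) (return borel 0)) u = vec_char \<nu> u ^ n" for n u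
    proof (induction n)
      case 0
      have "prob_distribution (return borel (0 :: real^'m))"
        by (simp add: prob_distribution_def prob_space_return)
      moreover have "vec_char (return borel (0 :: real^'m)) u = 1"
        unfolding vec_char_def by (subst integral_return) auto
      ultimately show ?case by simp
    next
      case (Suc n)
      then show ?case using \<nu>(1) by (simp add: prob_distribution_convolution vec_char_convolution)
    qed
    with \<nu> show ?thesis by blast
  qed
  have double: "vec_char \<mu> (2 *\<^sub>R u) \<noteq> 0" if nz: "vec_char \<mu> u \<noteq> 0" for u
  proof -
    define a where "a = (norm (vec_char \<mu> u))\<^sup>2"
    have a: "a > 0" using nz by (simp add: a_def)
    \<comment> \<open>The threshold is \<open>3/4\<close> because \<open>4 * (1 - y) < 1\<close>
      exactly when \<open>y > 3/4\<close>.\<close>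
    obtain k where k: "(3/4::real) ^ k < a" using real_arch_pow_inv[OF a, of "3/4"] by auto
    have k': "(3/4::real) ^ Suc k < a" using k by (rule le_less_trans[rotated]) simp
    obtain \<nu> where \<nu>: "prob_distribution \<nu>" "\<And>u. vec_char \<mu> u = vec_char \<nu> u ^ Suc k"
      using root[of "Suc k"] by auto
    have "a = ((norm (vec_char \<nu> u))\<^sup>2) ^ Suc k"
      unfolding a_def \<nu>(2) norm_power by (simp only: power_mult[symmetric] mult.commute)
    then have "(3/4) ^ Suc k < ((norm (vec_char \<nu> u))\<^sup>2) ^ Suc k" using k' by simp
    then have "3/4 < (norm (vec_char \<nu> u))\<^sup>2"
      by (rule power_less_imp_less_base) simp
    moreover have "3/4 < y \<Longrightarrow> 1 - x \<le> 4 * (1 - y) \<Longrightarrow> 0 < x" for x y :: real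
      by (simp add: algebra_simps)
    ultimately have "0 < (norm (vec_char \<nu> (2 *\<^sub>R u)))\<^sup>2"
      using vec_char_doubling[OF \<nu>(1), of u] by blast
    then show ?thesis by (simp add: \<nu>(2))
  qed
  have "(\<lambda>k. (1/2) ^ k *\<^sub>R u) \<longlonglongrightarrow> 0 *\<^sub>R u"
    by (intro tendsto_intros) simp
  then have "(\<lambda>k. vec_char \<mu> ((1/2) ^ k *\<^sub>R u)) \<longlonglongrightarrow> vec_char \<mu> 0"
    using continuous_on_vec_char[OF \<mu>] by (auto intro: continuous_on_tendsto_compose)
  then have "eventually (\<lambda>k. vec_char \<mu> ((1/2) ^ k *\<^sub>R u) \<noteq> 0) sequentially"
    by (rule tendsto_imp_eventually_ne) (simp add: vec_char_0[OF \<mu>])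
  then obtain k where k: "vec_char \<mu> ((1/2) ^ k *\<^sub>R u) \<noteq> 0"
    by (auto simp: eventually_sequentially)
  have "vec_char \<mu> (2 ^ j *\<^sub>R (1/2) ^ k *\<^sub>R u) \<noteq> 0" for j
  proof (induction j)
    case (Suc j)
    from double[OF this] show ?case by (simp add: mult.assoc)
  qed (use k in simp)
  from this[of k] show ?thesis by (simp add: power_one_over)
qed

text \<open>The difference takes values in the integer multiples of \<open>2 \<pi> i\<close>; a
  continuous function with discrete range on a connected space is constant.\<close>

lemma continuous_log_unique:
  fixes f g :: "'a::real_normed_vector \<Rightarrow> complex"
  assumes "continuous_on UNIV f" "continuous_on UNIV g" "f 0 = g 0" "\<And>x. exp (f x) = exp (g x)"
  shows "f = g"
proof -
  have "(\<lambda>x. f x - g x) constant_on UNIV"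
  proof (rule continuous_discrete_range_constant)
    show "continuous_on UNIV (\<lambda>x. f x - g x)" using assms by (intro continuous_intros)
    show "\<exists>e>0. \<forall>y. y \<in> UNIV \<and> f y - g y \<noteq> f x - g x \<longrightarrow> e \<le> norm ((f y - g y) - (f x - g x))" for x
    proof (intro exI[of _ 1] conjI allI impI)
      fix y assume y: "y \<in> UNIV \<and> f y - g y \<noteq> f x - g x"
      have "exp ((f y - g y) - (f x - g x)) = 1"
        by (simp add: exp_diff assms(4))
      then obtain n :: int where n: "Re ((f y - g y) - (f x - g x)) = 0"
          "Im ((f y - g y) - (f x - g x)) = of_int (2 * n) * pi"
        by (auto simp: exp_eq_1)
      with y have "n \<noteq> 0" by (auto simp: complex_eq_iff)
      then have "1 \<le> \<bar>real_of_int n\<bar>" by linarith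
      then have "1 * 1 \<le> \<bar>real_of_int n\<bar> * (2 * pi)"
        using pi_gt3 by (intro mult_mono) auto
      also have "\<dots> = \<bar>Im ((f y - g y) - (f x - g x))\<bar>"
        unfolding n(2) by (simp add: abs_mult)
      also have "\<dots> \<le> norm ((f y - g y) - (f x - g x))" by (rule abs_Im_le_cmod)
      finally show "1 \<le> norm ((f y - g y) - (f x - g x))" by simp
    qed simp
  qed (rule connected_UNIV)
  then obtain c where "\<And>x. f x - g x = c" by (auto simp: constant_on_def)
  then have "f x - g x = f 0 - g 0" for x by metis
  then show ?thesis using assms(3) by auto
qed

text \<open>Discharges the \<open>THE\<close> in \<open>log_char\<close>: a nowhere zero continuous
  function on a contractible space has a continuous logarithm \<open>g\<close>, and subtracting
  \<open>g 0\<close>, whose exponential is 1, normalizes it.\<close>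

lemma log_char_infinitely_divisible:
  assumes "infinitely_divisible (\<mu> :: (real^'m) measure)"
  shows "continuous_on UNIV (log_char \<mu>)" "log_char \<mu> 0 = 0" "vec_char \<mu> u = exp (log_char \<mu> u)"
proof -
  have \<mu>: "prob_distribution \<mu>" using assms by (simp add: infinitely_divisible_def)
  obtain g where g: "continuous_on UNIV g" "\<And>x. vec_char \<mu> x = exp (g x)"
    using continuous_logarithm_on_contractible[OF continuous_on_vec_char[OF \<mu>], OF convex_imp_contractible[OF convex_UNIV]]
      infinitely_divisible_vec_char_nz[OF assms] by (metis UNIV_I)
  have g0: "exp (g 0) = 1" using g(2)[of 0] vec_char_0[OF \<mu>] by simp
  have "\<exists>!\<psi>. continuous_on UNIV \<psi> \<and> \<psi> 0 = 0 \<and> (\<forall>u. vec_char \<mu> u = exp (\<psi> u))"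
  proof (rule ex1I[of _ "\<lambda>x. g x - g 0"])
    show "continuous_on UNIV (\<lambda>x. g x - g 0) \<and> g 0 - g 0 = 0 \<and> (\<forall>u. vec_char \<mu> u = exp (g u - g 0))"
      using g g0 by (auto intro!: continuous_intros simp: exp_diff)
    then show "\<psi> = (\<lambda>x. g x - g 0)"
      if "continuous_on UNIV \<psi> \<and> \<psi> 0 = 0 \<and> (\<forall>u. vec_char \<mu> u = exp (\<psi> u))" for \<psi>
      using that by (intro continuous_log_unique) auto
  qed
  from theI'[OF this, folded log_char_def]
  show "continuous_on UNIV (log_char \<mu>)" "log_char \<mu> 0 = 0" "vec_char \<mu> u = exp (log_char \<mu> u)"
    by auto
qed

text \<open>If the logarithm vanishes on the whole line through \<open>u\<close>, then
  \<open>u \<bullet> x\<close> has characteristic function 1, hence is 0 almost surely, and the law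
  sits on a hyperplane unless \<open>u = 0\<close>.\<close>

lemma full_distribution_log_char_line:
  assumes "full_distribution (\<mu> :: (real^'m) measure)" "infinitely_divisible \<mu>"
    and z: "\<And>\<xi>. log_char \<mu> (\<xi> *\<^sub>R u) = 0"
  shows "u = 0"
proof (rule ccontr)
  assume u: "u \<noteq> 0"
  have \<mu>: "prob_distribution \<mu>" using assms by (simp add: infinitely_divisible_def)
  interpret prob_space \<mu> by (rule prob_distributionD(1)[OF \<mu>])
  have [measurable_cong]: "sets \<mu> = sets borel" by (rule prob_distributionD(2)[OF \<mu>])
  let ?D = "distr \<mu> borel (\<lambda>x. u \<bullet> x)"
  have D: "?D = return borel 0"
  proof (rule Levy_uniqueness)
    show "real_distribution ?D" by (rule real_distribution_distr) simp
    interpret R: prob_space "return borel (0::real)" by (rule prob_space_return) simp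
    show "real_distribution (return borel (0::real))" by unfold_locales simp_all
    have "char ?D t = vec_char \<mu> (t *\<^sub>R u)" for t
      unfolding char_def vec_char_def by (subst integral_distr) (auto simp: inner_commute)
    then have "char ?D t = 1" for t
      using log_char_infinitely_divisible[OF assms(2)] z by simp
    moreover have "char (return borel 0) t = 1" for t
      unfolding char_def by (subst integral_return) auto
    ultimately show "char ?D = char (return borel 0)" by auto
  qed
  have "AE x in ?D. x = 0" unfolding D by (subst AE_return) auto
  then have "AE x in \<mu>. u \<bullet> x = 0" by (subst (asm) AE_distr_iff) auto
  then show False using assms(1) u by (auto simp: full_distribution_def)
qed

section \<open>Operator-stable log-characteristic functions\<close>

lemma bounded_linear_cmat_app: "bounded_linear (\<lambda>M. cmat M *v v)"
  unfolding linear_conv_bounded_linear[symmetric]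
  by (rule linearI) (simp_all add: vec_eq_iff matrix_vector_mult_def algebra_simps sum.distrib scaleR_sum_right scaleR_conv_of_real[where 'a = complex] sum_distrib_left)

lemma mat_exp_eigenvector:
  assumes "cmat A *v v = z *s v"
  shows "cmat (mat_exp A) *v v = exp z *s v"
proof -
  have pow: "cmat (mat_pow A n) *v v = z ^ n *s v" for n
  proof (induction n)
    case 0
    then show ?case using poly_mat_app_monom[of A 1 0 v] by (simp add: monom_0)
  next
    case (Suc n)
    then show ?case using assms
      by (simp add: mat_pow_Suc cmat_mult_app cmat_app_smult vector_smult_assoc mult.commute)
  qed
  have "bounded_linear (\<lambda>c::complex. c *s v)"
    unfolding linear_conv_bounded_linear[symmetric]
    by (rule linearI) (simp_all add: vec_eq_iff algebra_simps)
  from bounded_linear.sums[OF this exp_converges[of z]]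
  have "(\<lambda>n. (z ^ n /\<^sub>R fact n) *s v) sums (exp z *s v)" .
  moreover have "(\<lambda>n. cmat ((1 / fact n) *\<^sub>R mat_pow A n) *v v) sums (cmat (mat_exp A) *v v)"
    by (rule bounded_linear.sums[OF bounded_linear_cmat_app mat_exp_sums])
  moreover have "cmat ((1 / fact n) *\<^sub>R mat_pow A n) *v v = (z ^ n /\<^sub>R fact n) *s v" for n
  proof -
    have "cmat ((1 / fact n) *\<^sub>R mat_pow A n) *v v = (1 / fact n) *\<^sub>R (cmat (mat_pow A n) *v v)"
      by (rule linear_scale[OF bounded_linear.linear[OF bounded_linear_cmat_app]])
    then show ?thesis unfolding pow by (simp add: vec_eq_iff divide_inverse)
  qed
  ultimately show ?thesis by (simp add: sums_unique2)
qed

text \<open>The vector is the real or the imaginary part of a complex eigenvector.\<close>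

lemma bounded_orbit_nonpos_eigenvalue:
  assumes "z \<in> complex_eigenvalues A" "Re z \<le> 0"
  shows "\<exists>u C. u \<noteq> 0 \<and> (\<forall>t\<ge>0. norm (mat_exp (t *\<^sub>R A) *v u) \<le> C)"
proof -
  obtain v where v: "v \<noteq> 0" "cmat A *v v = z *s v"
    using assms(1) unfolding complex_eigenvalues_def by blast
  define x y :: "real^'a" where "x = (\<chi> i. Re (v $ i))" and "y = (\<chi> i. Im (v $ i))"
  have re: "(M *v x) $ j = Re ((cmat M *v v) $ j)" and im: "(M *v y) $ j = Im ((cmat M *v v) $ j)"
    for M :: "real^'a^'a" and j
    by (simp_all add: x_def y_def matrix_vector_mult_def)
  have "cmat (t *\<^sub>R A) *v v = (of_real t * z) *s v" for t
  proof -
    have "cmat (t *\<^sub>R A) *v v = t *\<^sub>R (cmat A *v v)"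
      by (rule linear_scale[OF bounded_linear.linear[OF bounded_linear_cmat_app]])
    then show ?thesis unfolding v(2)
      by (simp add: vec_eq_iff scaleR_conv_of_real[where 'a = complex] mult.assoc)
  qed
  then have e: "cmat (mat_exp (t *\<^sub>R A)) *v v = exp (of_real t * z) *s v" for t
    by (rule mat_exp_eigenvector)
  have n: "norm ((cmat (mat_exp (t *\<^sub>R A)) *v v) $ j) \<le> norm (v $ j)" if "t \<ge> 0" for t j
    unfolding e using assms(2) that
    by (simp add: norm_mult mult_left_le_one_le mult_nonneg_nonpos)
  have bx: "norm (mat_exp (t *\<^sub>R A) *v x) \<le> (\<Sum>j\<in>UNIV. norm (v $ j))" if "t \<ge> 0" for t
    by (rule order_trans[OF norm_le_l1_cart sum_mono])
      (use n[OF that] in \<open>auto simp: re intro: order_trans[OF abs_Re_le_cmod]\<close>)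
  have yb: "norm (mat_exp (t *\<^sub>R A) *v y) \<le> (\<Sum>j\<in>UNIV. norm (v $ j))" if "t \<ge> 0" for t
    by (rule order_trans[OF norm_le_l1_cart sum_mono])
      (use n[OF that] in \<open>auto simp: im intro: order_trans[OF abs_Im_le_cmod]\<close>)
  have "x \<noteq> 0 \<or> y \<noteq> 0"
    using v(1) by (auto simp: x_def y_def vec_eq_iff complex_eq_iff)
  then show ?thesis using bx yb by blast
qed

text \<open>By scaling, \<open>s\<close> times the value at \<open>u\<close> is a value on the
  compact ball of radius \<open>C\<close> for every \<open>s \<ge> 1\<close>, hence bounded in
  \<open>s\<close>; this forces the value to be 0.\<close>

lemma strictly_operator_stable_bounded_orbit:
  assumes "strictly_operator_stable (\<mu> :: (real^'m) measure) B"
    and C: "\<And>t. t \<ge> 0 \<Longrightarrow> norm (mat_exp (t *\<^sub>R transpose B) *v u) \<le> C"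
  shows "log_char \<mu> u = 0"
proof -
  have id: "infinitely_divisible \<mu>" using assms by (simp add: strictly_operator_stable_def)
  have "compact (log_char \<mu> ` cball 0 C)"
    by (rule compact_continuous_image[OF continuous_on_subset[OF log_char_infinitely_divisible(1)[OF id]]]) auto
  then obtain S where S: "\<And>v. norm v \<le> C \<Longrightarrow> norm (log_char \<mu> v) \<le> S"
    by (metis (no_types, lifting) bounded_iff compact_imp_bounded image_eqI mem_cball_0)
  have *: "s * norm (log_char \<mu> u) \<le> S" if s: "s \<ge> 1" for s
  proof -
    have "complex_of_real s * log_char \<mu> u = log_char \<mu> (mat_powr s (transpose B) *v u)"
      using assms s by (simp add: strictly_operator_stable_def)
    then have "s * norm (log_char \<mu> u) = norm (log_char \<mu> (mat_powr s (transpose B) *v u))"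
      using s by (metis norm_mult norm_of_real abs_of_nonneg order_trans zero_le_one)
    also have "\<dots> \<le> S"
      using C[of "ln s"] s by (intro S) (simp add: mat_powr_def)
    finally show ?thesis .
  qed
  show ?thesis
  proof (rule ccontr)
    assume "\<not> ?thesis"
    then have n: "norm (log_char \<mu> u) > 0" by simp
    have "(\<bar>S\<bar> / norm (log_char \<mu> u) + 1) * norm (log_char \<mu> u) \<le> S"
      using n by (intro *) simp
    then have "\<bar>S\<bar> + norm (log_char \<mu> u) \<le> S" using n by (simp add: field_simps)
    then show False using n abs_ge_self[of S] by linarith
  qed
qed

text \<open>An eigenvalue with nonpositive real part yields a vector with bounded forward orbit. All
  its multiples have bounded orbits too, so the log-characteristic function vanishes on a line,
  against fullness.\<close>

lemma strictly_operator_stable_min_re_eig_pos: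
  assumes "full_distribution (\<mu> :: (real^'m) measure)" "strictly_operator_stable \<mu> B"
  shows "min_re_eig B > 0"
proof (rule ccontr)
  assume n: "\<not> ?thesis"
  have id: "infinitely_divisible \<mu>" using assms by (simp add: strictly_operator_stable_def)
  have "min_re_eig B \<in> Re ` complex_eigenvalues B"
    unfolding min_re_eig_def
    by (rule Min_in) (auto simp: finite_complex_eigenvalues complex_eigenvalues_nonempty)
  then obtain z where "z \<in> complex_eigenvalues (transpose B)" "Re z \<le> 0"
    using n by (auto simp: complex_eigenvalues_transpose)
  then obtain u C where u: "u \<noteq> 0" "\<And>t. t \<ge> 0 \<Longrightarrow> norm (mat_exp (t *\<^sub>R transpose B) *v u) \<le> C"
    using bounded_orbit_nonpos_eigenvalue by blast
  have "log_char \<mu> (\<xi> *\<^sub>R u) = 0" for \<xi>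
  proof (rule strictly_operator_stable_bounded_orbit[OF assms(2)])
    show "norm (mat_exp (t *\<^sub>R transpose B) *v (\<xi> *\<^sub>R u)) \<le> \<bar>\<xi>\<bar> * C" if "t \<ge> 0" for t
      using u(2)[OF that] by (simp add: matrix_vector_mult_scaleR mult_left_mono)
  qed
  then show False
    using full_distribution_log_char_line[OF assms(1) id] u(1) by blast
qed

text \<open>If \<open>norm (mat_powr s B) \<le> K * s powr c\<close>, the choice
  \<open>s = (K * norm u) powr (- 1 / c)\<close> moves \<open>u\<close> into the unit ball, where
  the logarithm is at most \<open>S\<close>; scaling back costs \<open>1 / s\<close>. The exponent
  \<open>b\<^sub>2\<close> serves \<open>s \<ge> 1\<close>, that is small \<open>u\<close>, and
  \<open>b\<^sub>1\<close> serves large \<open>u\<close>.\<close>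

lemma norm_log_char_le:
  assumes st: "strictly_operator_stable (\<mu> :: (real^'m) measure) B"
    and b: "0 < b\<^sub>1" "b\<^sub>1 < min_re_eig B" "max_re_eig B < b\<^sub>2"
  shows "\<exists>C>0. \<forall>u. norm (log_char \<mu> u) \<le> C * (norm u powr (1 / b\<^sub>1) + norm u powr (1 / b\<^sub>2))"
proof -
  have id: "infinitely_divisible \<mu>" using st by (simp add: strictly_operator_stable_def)
  have b2: "b\<^sub>2 > 0" using b min_le_max_re_eig[of B] by simp
  obtain K1 where K1: "K1 > 0" "\<And>s. 0 < s \<Longrightarrow> s \<le> 1 \<Longrightarrow> norm (mat_powr s B) \<le> K1 * s powr b\<^sub>1"
    using mat_powr_bound_le_1[OF b(2)] by blast
  obtain K2 where K2: "K2 > 0" "\<And>s. s \<ge> 1 \<Longrightarrow> norm (mat_powr s B) \<le> K2 * s powr b\<^sub>2"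
    using mat_powr_bound_ge_1[OF b(3)] by blast
  define K where "K = max K1 K2"
  have K0: "K > 0" using K1 by (simp add: K_def)
  have nt: "norm (mat_powr s (transpose B)) = norm (mat_powr s B)" for s
    by (simp add: norm_transpose flip: transpose_mat_powr)
  have "compact (log_char \<mu> ` cball 0 1)"
    by (rule compact_continuous_image[OF continuous_on_subset[OF log_char_infinitely_divisible(1)[OF id]]]) auto
  then obtain S where S: "S > 0" "\<And>v. norm v \<le> 1 \<Longrightarrow> norm (log_char \<mu> v) \<le> S"
    by (metis (no_types, lifting) bounded_pos compact_imp_bounded image_eqI mem_cball_0)
  have main: "norm (log_char \<mu> u) \<le> S * (K * norm u) powr (1 / c)"
    if u: "u \<noteq> 0" and c: "c > 0" and s: "s = (K * norm u) powr (- 1 / c)"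
      and bd: "norm (mat_powr s B) \<le> K * s powr c" for u c s
  proof -
    have x: "K * norm u > 0" using u K0 by simp
    have s0: "s > 0" using x by (simp only: s powr_gt_zero)
    have "s powr c = (K * norm u) powr (- 1)"
      unfolding s powr_powr using c by simp
    then have sc: "s powr c = 1 / (K * norm u)" using x by (simp add: powr_minus_divide)
    have "norm (mat_powr s (transpose B) *v u) \<le> norm (mat_powr s B) * norm u"
      using norm_matrix_vector_mult_le[of "mat_powr s (transpose B)" u] by (simp add: nt)
    also have "\<dots> \<le> K * s powr c * norm u"
      using bd by (intro mult_right_mono) auto
    also have "\<dots> = 1"
      unfolding sc using K0 u by simp
    finally have "norm (log_char \<mu> (mat_powr s (transpose B) *v u)) \<le> S" by (rule S(2))
    moreover have "complex_of_real s * log_char \<mu> u = log_char \<mu> (mat_powr s (transpose B) *v u)"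
      using st s0 by (simp add: strictly_operator_stable_def)
    then have "s * norm (log_char \<mu> u) = norm (log_char \<mu> (mat_powr s (transpose B) *v u))"
      using s0 by (metis norm_mult norm_of_real abs_of_nonneg order_less_imp_le)
    ultimately have "s * norm (log_char \<mu> u) \<le> S" by simp
    then have "norm (log_char \<mu> u) \<le> S * (1 / s)" using s0 by (simp add: field_simps)
    also have "1 / s = (K * norm u) powr (1 / c)"
      unfolding s using x K0 u by (simp add: powr_minus_divide)
    finally show ?thesis .
  qed
  define C where "C = S * (K powr (1 / b\<^sub>1) + K powr (1 / b\<^sub>2))"
  have "norm (log_char \<mu> u) \<le> C * (norm u powr (1 / b\<^sub>1) + norm u powr (1 / b\<^sub>2))" for u
  proof (cases "u = 0")
    case True
    then show ?thesis by (simp add: log_char_infinitely_divisible(2)[OF id])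
  next
    case False
    have x: "K * norm u > 0" using False K0 by simp
    have "norm (log_char \<mu> u) \<le> S * (K * norm u) powr (1 / b\<^sub>1) \<or>
        norm (log_char \<mu> u) \<le> S * (K * norm u) powr (1 / b\<^sub>2)"
    proof (cases "K * norm u \<le> 1")
      case True
      define s where "s = (K * norm u) powr (- 1 / b\<^sub>2)"
      have "1 powr (- 1 / b\<^sub>2) \<le> s"
        unfolding s_def using True x b2 by (intro powr_mono2') auto
      then have "norm (mat_powr s B) \<le> K2 * s powr b\<^sub>2" by (intro K2(2)) simp
      also have "\<dots> \<le> K * s powr b\<^sub>2" by (intro mult_right_mono) (auto simp: K_def)
      finally show ?thesis using main[OF False b2 s_def] by blast
    next
      case F: False
      define s where "s = (K * norm u) powr (- 1 / b\<^sub>1)"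
      have "s \<le> 1 powr (- 1 / b\<^sub>1)"
        unfolding s_def using F x b by (intro powr_mono2') auto
      moreover have "s > 0" using x by (simp only: s_def powr_gt_zero)
      ultimately have "norm (mat_powr s B) \<le> K1 * s powr b\<^sub>1" by (intro K1(2)) simp_all
      also have "\<dots> \<le> K * s powr b\<^sub>1" by (intro mult_right_mono) (auto simp: K_def)
      finally show ?thesis using main[OF False b(1) s_def] by blast
    qed
    then have "norm (log_char \<mu> u) \<le> S * (K * norm u) powr (1 / b\<^sub>1) + S * (K * norm u) powr (1 / b\<^sub>2)"
      using S(1) by (smt (verit) mult_nonneg_nonneg powr_ge_zero)
    also have "\<dots> = S * K powr (1 / b\<^sub>1) * norm u powr (1 / b\<^sub>1) + S * K powr (1 / b\<^sub>2) * norm u powr (1 / b\<^sub>2)"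
      using K0 by (simp add: powr_mult)
    also have "\<dots> \<le> C * (norm u powr (1 / b\<^sub>1) + norm u powr (1 / b\<^sub>2))"
      using S(1) by (simp add: C_def algebra_simps)
    finally show ?thesis .
  qed
  moreover have "C > 0" using S(1) K0 by (simp add: C_def add_pos_pos)
  ultimately show ?thesis by blast
qed

section \<open>Convergence in probability\<close>

lemma (in prob_space) tendsto_prob_AE_tendsto_0:
  fixes Z :: "nat \<Rightarrow> 'a \<Rightarrow> real"
  assumes [measurable]: "\<And>n. Z n \<in> borel_measurable M"
    and lim: "AE \<omega> in M. (\<lambda>n. Z n \<omega>) \<longlonglongrightarrow> 0" and e: "e > 0"
  shows "(\<lambda>n. measure M {\<omega>\<in>space M. Z n \<omega> > e}) \<longlonglongrightarrow> 0"
proof -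
  have "(\<lambda>n. \<integral>\<omega>. indicator {\<omega>\<in>space M. Z n \<omega> > e} \<omega> \<partial>M) \<longlonglongrightarrow> (\<integral>\<omega>. 0 \<partial>M :: real)"
  proof (rule integral_dominated_convergence[where w = "\<lambda>_. 1"])
    show "AE \<omega> in M. (\<lambda>n. indicator {\<omega>\<in>space M. Z n \<omega> > e} \<omega>) \<longlonglongrightarrow> (0::real)"
      using lim
    proof (eventually_elim)
      case (elim \<omega>)
      then have "eventually (\<lambda>n. Z n \<omega> < e) sequentially"
        using e by (rule order_tendstoD(2))
      then have "eventually (\<lambda>n. indicator {\<omega>\<in>space M. Z n \<omega> > e} \<omega> = (0::real)) sequentially"
        by eventually_elim auto
      then show ?case by (rule tendsto_eventually)
    qed
  qed auto
  then show ?thesis by simp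
qed

text \<open>Completeness: along a fast subsequence Borel-Cantelli makes the increments eventually
  geometric, so it converges almost surely. The Cauchy property carries the limit over to the full
  sequence.\<close>

lemma (in prob_space) converges_in_probability_Cauchy:
  fixes X :: "nat \<Rightarrow> 'a \<Rightarrow> 'b::euclidean_space"
  assumes X [measurable]: "\<And>k. X k \<in> borel_measurable M"
    and Cauchy: "\<And>e. e > 0 \<Longrightarrow> \<exists>N. \<forall>k\<ge>N. \<forall>l\<ge>N. measure M {\<omega>\<in>space M. dist (X k \<omega>) (X l \<omega>) > e} < e"
  shows "converges_in_probability M X"
proof -
  have "\<forall>j. \<exists>N. \<forall>k\<ge>N. \<forall>l\<ge>N. measure M {\<omega>\<in>space M. dist (X k \<omega>) (X l \<omega>) > (1/2)^j} < (1/2)^j"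
    by (intro allI Cauchy) simp
  then obtain N where N: "\<And>j k l. k \<ge> N j \<Longrightarrow> l \<ge> N j \<Longrightarrow>
      measure M {\<omega>\<in>space M. dist (X k \<omega>) (X l \<omega>) > (1/2)^j} < (1/2)^j"
    by metis
  \<comment> \<open>Partial sums make \<open>r k\<close> dominate every threshold \<open>N j\<close>
    with \<open>j \<le> k\<close> at once.\<close>
  define r where "r j = (\<Sum>i\<le>j. N i)" for j
  have rN: "r k \<ge> N j" if "k \<ge> j" for j k
    unfolding r_def by (rule member_le_sum) (use that in auto)
  let ?A = "\<lambda>j. {\<omega>\<in>space M. dist (X (r (Suc j)) \<omega>) (X (r j) \<omega>) > (1/2)^j}"
  have "AE \<omega> in M. eventually (\<lambda>j. \<omega> \<in> space M - ?A j) sequentially"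
  proof (rule borel_cantelli_AE1)
    show "summable (\<lambda>j. measure M (?A j))"
    proof (rule summable_comparison_test')
      show "summable (\<lambda>j. (1/2)^j :: real)" by (rule summable_geometric) simp
      show "norm (measure M (?A j)) \<le> (1/2)^j" for j
        using N[of j "r (Suc j)" "r j"] rN by (simp add: less_imp_le)
    qed
  qed (auto simp: emeasure_eq_measure)
  then have conv: "AE \<omega> in M. (\<lambda>j. X (r j) \<omega>) \<longlonglongrightarrow> lim (\<lambda>j. X (r j) \<omega>)"
  proof eventually_elim
    case (elim \<omega>)
    have "summable (\<lambda>j. X (r (Suc j)) \<omega> - X (r j) \<omega>)"
    proof (rule summable_comparison_test_ev)
      show "summable (\<lambda>j. (1/2)^j :: real)" by (rule summable_geometric) simp
      show "eventually (\<lambda>j. norm (X (r (Suc j)) \<omega> - X (r j) \<omega>) \<le> (1/2)^j) sequentially"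
        using elim by eventually_elim (auto simp: dist_norm not_less)
    qed
    then have "(\<lambda>n. (\<Sum>j<n. X (r (Suc j)) \<omega> - X (r j) \<omega>) + X (r 0) \<omega>)
        \<longlonglongrightarrow> suminf (\<lambda>j. X (r (Suc j)) \<omega> - X (r j) \<omega>) + X (r 0) \<omega>"
      by (intro tendsto_add tendsto_const summable_LIMSEQ)
    moreover have "(\<Sum>j<n. X (r (Suc j)) \<omega> - X (r j) \<omega>) + X (r 0) \<omega> = X (r n) \<omega>" for n
      by (simp add: sum_lessThan_telescope[of "\<lambda>j. X (r j) \<omega>"])
    ultimately have "convergent (\<lambda>j. X (r j) \<omega>)" by (auto simp: convergent_def)
    then show ?case by (simp add: convergent_LIMSEQ_iff)
  qed
  \<comment> \<open>Where the subsequence diverges, a null set, \<open>lim\<close> is an arbitrary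
    value; measurability is unaffected.\<close>
  define Y where "Y \<omega> = lim (\<lambda>j. X (r j) \<omega>)" for \<omega>
  have Y [measurable]: "Y \<in> borel_measurable M"
    unfolding Y_def by (rule borel_measurable_lim_metric) simp
  have lim0: "(\<lambda>j. measure M {\<omega>\<in>space M. dist (X (r j) \<omega>) (Y \<omega>) > e}) \<longlonglongrightarrow> 0" if "e > 0" for e
  proof (rule tendsto_prob_AE_tendsto_0[OF _ _ that])
    show "AE \<omega> in M. (\<lambda>j. dist (X (r j) \<omega>) (Y \<omega>)) \<longlonglongrightarrow> 0"
      using conv unfolding Y_def by eventually_elim (rule tendsto_dist_iff[THEN iffD1])
  qed simp
  have "(\<lambda>k. measure M {\<omega>\<in>space M. dist (X k \<omega>) (Y \<omega>) > e}) \<longlonglongrightarrow> 0" if e: "e > 0" for e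
  proof (rule LIMSEQ_I)
    fix d :: real assume d: "d > 0"
    \<comment> \<open>Half of the minimum serves both splittings: the distance \<open>e\<close> into
      two parts and the probability \<open>d\<close> into two parts.\<close>
    define m where "m = min d e / 2"
    have m: "m > 0" using d e by (simp add: m_def)
    obtain j0 where j0: "(1/2::real)^j0 < m" using real_arch_pow_inv[OF m, of "1/2"] by auto
    have "eventually (\<lambda>j. measure M {\<omega>\<in>space M. dist (X (r j) \<omega>) (Y \<omega>) > e/2} < m) sequentially"
      using lim0[of "e/2"] e m by (intro order_tendstoD(2)) auto
    then obtain j1 where j1: "\<And>j. j \<ge> j1 \<Longrightarrow> measure M {\<omega>\<in>space M. dist (X (r j) \<omega>) (Y \<omega>) > e/2} < m"
      by (auto simp: eventually_sequentially)
    define j where "j = max j0 j1"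
    have "measure M {\<omega>\<in>space M. dist (X k \<omega>) (Y \<omega>) > e} < d" if k: "k \<ge> N j0" for k
    proof -
      have "measure M {\<omega>\<in>space M. dist (X k \<omega>) (Y \<omega>) > e}
        \<le> measure M ({\<omega>\<in>space M. dist (X k \<omega>) (X (r j) \<omega>) > (1/2)^j0} \<union> {\<omega>\<in>space M. dist (X (r j) \<omega>) (Y \<omega>) > e/2})"
      proof (rule finite_measure_mono)
        show "{\<omega>\<in>space M. dist (X k \<omega>) (Y \<omega>) > e} \<subseteq>
          {\<omega>\<in>space M. dist (X k \<omega>) (X (r j) \<omega>) > (1/2)^j0} \<union> {\<omega>\<in>space M. dist (X (r j) \<omega>) (Y \<omega>) > e/2}"
        proof safe
          fix \<omega> assume "e < dist (X k \<omega>) (Y \<omega>)" "\<not> e/2 < dist (X (r j) \<omega>) (Y \<omega>)"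
          moreover have "dist (X k \<omega>) (Y \<omega>) \<le> dist (X k \<omega>) (X (r j) \<omega>) + dist (X (r j) \<omega>) (Y \<omega>)"
            by (rule dist_triangle)
          moreover have "(1/2)^j0 < e/2" using j0 by (simp add: m_def)
          ultimately show "(1/2)^j0 < dist (X k \<omega>) (X (r j) \<omega>)" by linarith
        qed
      qed simp
      also have "\<dots> \<le> measure M {\<omega>\<in>space M. dist (X k \<omega>) (X (r j) \<omega>) > (1/2)^j0}
         + measure M {\<omega>\<in>space M. dist (X (r j) \<omega>) (Y \<omega>) > e/2}"
        by (rule measure_Un_le) auto
      also have "\<dots> < (1/2)^j0 + m"
        using N[OF k rN[of j0 j]] j1[of j] by (intro add_strict_mono) (auto simp: j_def)
      also have "\<dots> \<le> d"
      proof -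
        have "m \<le> d / 2" by (simp add: m_def)
        then show ?thesis using j0 by linarith
      qed
      finally show ?thesis .
    qed
    then show "\<exists>no. \<forall>k\<ge>no. norm (measure M {\<omega>\<in>space M. dist (X k \<omega>) (Y \<omega>) > e} - 0) < d"
      by (intro exI[of _ "N j0"]) simp
  qed
  then show ?thesis
    unfolding converges_in_probability_def using Y by blast
qed

text \<open>The continuity theorem gives weak convergence to the point mass at 0. Its distribution
  function jumps only at 0, so the distribution functions converge at \<open>e\<close> and
  \<open>- e\<close>, which control both tails.\<close>

lemma (in prob_space) tendsto_prob_0_real:
  fixes Z :: "nat \<Rightarrow> 'a \<Rightarrow> real"
  assumes [measurable]: "\<And>n. Z n \<in> borel_measurable M"
    and ch: "\<And>t. (\<lambda>n. CLINT \<omega>|M. iexp (t * Z n \<omega>)) \<longlonglongrightarrow> 1" and e: "e > 0"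
  shows "(\<lambda>n. measure M {\<omega>\<in>space M. \<bar>Z n \<omega>\<bar> > e}) \<longlonglongrightarrow> 0"
proof -
  let ?D = "\<lambda>n. distr M borel (Z n)" and ?R = "return borel (0::real)"
  interpret R: prob_space ?R by (rule prob_space_return) simp
  have R: "real_distribution ?R" by unfold_locales simp_all
  have D: "real_distribution (?D n)" for n by (rule real_distribution_distr) simp
  have "char ?R t = 1" for t
    unfolding char_def by (subst integral_return) auto
  moreover have "char (?D n) t = (CLINT \<omega>|M. iexp (t * Z n \<omega>))" for n t
    unfolding char_def by (subst integral_distr) auto
  ultimately have wc: "weak_conv_m ?D ?R"
    using ch by (intro levy_continuity D R) simp
  have cR: "cdf ?R x = (if 0 \<le> x then 1 else 0)" for x
    by (simp add: cdf_def measure_return)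
  have cont: "isCont (cdf ?R) x" if "x \<noteq> 0" for x
  proof (cases "x > 0")
    case True
    have "eventually (\<lambda>y. cdf ?R y = 1) (nhds x)"
      using eventually_nhds_in_open[of "{0<..}" x] True by (auto simp: cR elim!: eventually_mono)
    then show ?thesis by (simp add: isCont_cong)
  next
    case False
    have "eventually (\<lambda>y. cdf ?R y = 0) (nhds x)"
      using eventually_nhds_in_open[of "{..<0}" x] False that by (auto simp: cR elim!: eventually_mono)
    then show ?thesis by (simp add: isCont_cong)
  qed
  have "(\<lambda>n. (1 - cdf (?D n) e) + cdf (?D n) (- e)) \<longlonglongrightarrow> (1 - cdf ?R e) + cdf ?R (- e)"
    using wc e cont[of e] cont[of "- e"] unfolding weak_conv_m_def weak_conv_def
    by (intro tendsto_intros) auto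
  then have lim: "(\<lambda>n. (1 - cdf (?D n) e) + cdf (?D n) (- e)) \<longlonglongrightarrow> 0"
    using e by (simp add: cR)
  show ?thesis
  proof (rule tendsto_sandwich[OF _ _ tendsto_const lim])
    show "eventually (\<lambda>n. measure M {\<omega>\<in>space M. \<bar>Z n \<omega>\<bar> > e} \<le> (1 - cdf (?D n) e) + cdf (?D n) (- e)) sequentially"
    proof (intro always_eventually allI)
      fix n
      have c: "cdf (?D n) x = measure M {\<omega>\<in>space M. Z n \<omega> \<le> x}" for x
        unfolding cdf_def by (subst measure_distr) (auto intro!: arg_cong[of _ _ "measure M"])
      have "measure M {\<omega>\<in>space M. \<bar>Z n \<omega>\<bar> > e} \<le>
          measure M ({\<omega>\<in>space M. \<not> Z n \<omega> \<le> e} \<union> {\<omega>\<in>space M. Z n \<omega> \<le> - e})"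
        by (intro finite_measure_mono) auto
      also have "\<dots> \<le> measure M {\<omega>\<in>space M. \<not> Z n \<omega> \<le> e} + measure M {\<omega>\<in>space M. Z n \<omega> \<le> - e}"
        by (intro measure_Un_le) auto
      also have "measure M {\<omega>\<in>space M. \<not> Z n \<omega> \<le> e} = 1 - cdf (?D n) e"
        unfolding c by (rule prob_neg) simp
      finally show "measure M {\<omega>\<in>space M. \<bar>Z n \<omega>\<bar> > e} \<le> (1 - cdf (?D n) e) + cdf (?D n) (- e)"
        by (simp add: c)
    qed
  qed simp
qed

lemma (in prob_space) tendsto_prob_0_vec:
  fixes Z :: "nat \<Rightarrow> 'a \<Rightarrow> real^'m"
  assumes [measurable]: "\<And>n. Z n \<in> borel_measurable M"
    and ch: "\<And>u. (\<lambda>n. CLINT \<omega>|M. iexp (Z n \<omega> \<bullet> u)) \<longlonglongrightarrow> 1" and e: "e > 0"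
  shows "(\<lambda>n. measure M {\<omega>\<in>space M. norm (Z n \<omega>) > e}) \<longlonglongrightarrow> 0"
proof -
  \<comment> \<open>If every coordinate is at most \<open>d\<close> in modulus, the l1 norm is at
    most \<open>e / 2\<close>; hence a large vector has a large coordinate and the union bound
    applies.\<close>
  define d where "d = e / (2 * CARD('m))"
  have d: "d > 0" using e by (simp add: d_def)
  have [measurable]: "(\<lambda>\<omega>. Z n \<omega> $ i) \<in> borel_measurable M" for n i
    by (rule measurable_compose[OF _ borel_measurable_continuous_onI[OF continuous_on_component]]) (auto intro: continuous_intros)
  have "(\<lambda>n. measure M {\<omega>\<in>space M. \<bar>Z n \<omega> $ i\<bar> > d}) \<longlonglongrightarrow> 0" for i
    using ch[of "_ *\<^sub>R axis i 1"] d
    by (intro tendsto_prob_0_real) (simp_all add: inner_axis)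
  then have "(\<lambda>n. \<Sum>i\<in>UNIV. measure M {\<omega>\<in>space M. \<bar>Z n \<omega> $ i\<bar> > d}) \<longlonglongrightarrow> (\<Sum>i\<in>(UNIV::'m set). 0)"
    by (intro tendsto_sum)
  then have lim: "(\<lambda>n. \<Sum>i\<in>UNIV. measure M {\<omega>\<in>space M. \<bar>Z n \<omega> $ i\<bar> > d}) \<longlonglongrightarrow> 0" by simp
  show ?thesis
  proof (rule tendsto_sandwich[OF _ _ tendsto_const lim])
    show "eventually (\<lambda>n. measure M {\<omega>\<in>space M. norm (Z n \<omega>) > e} \<le>
       (\<Sum>i\<in>UNIV. measure M {\<omega>\<in>space M. \<bar>Z n \<omega> $ i\<bar> > d})) sequentially"
    proof (intro always_eventually allI)
      fix n
      have "measure M {\<omega>\<in>space M. norm (Z n \<omega>) > e} \<le>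
          measure M (\<Union>i\<in>UNIV. {\<omega>\<in>space M. \<bar>Z n \<omega> $ i\<bar> > d})"
      proof (rule finite_measure_mono)
        show "{\<omega>\<in>space M. norm (Z n \<omega>) > e} \<subseteq> (\<Union>i\<in>UNIV. {\<omega>\<in>space M. \<bar>Z n \<omega> $ i\<bar> > d})"
        proof
          fix \<omega> assume \<omega>: "\<omega> \<in> {\<omega>\<in>space M. norm (Z n \<omega>) > e}"
          have "\<exists>i. \<bar>Z n \<omega> $ i\<bar> > d"
          proof (rule ccontr)
            assume "\<not> ?thesis"
            then have "(\<Sum>i\<in>UNIV. \<bar>Z n \<omega> $ i\<bar>) \<le> (\<Sum>i\<in>(UNIV::'m set). d)"
              by (intro sum_mono) (auto simp: not_less)
            also have "\<dots> = e / 2" by (simp add: d_def)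
            finally show False using norm_le_l1_cart[of "Z n \<omega>"] \<omega> e by simp
          qed
          with \<omega> show "\<omega> \<in> (\<Union>i\<in>UNIV. {\<omega>\<in>space M. \<bar>Z n \<omega> $ i\<bar> > d})" by auto
        qed
      qed auto
      also have "\<dots> \<le> (\<Sum>i\<in>UNIV. measure M {\<omega>\<in>space M. \<bar>Z n \<omega> $ i\<bar> > d})"
        by (rule finite_measure_subadditive_finite) auto
      finally show "measure M {\<omega>\<in>space M. norm (Z n \<omega>) > e} \<le>
        (\<Sum>i\<in>UNIV. measure M {\<omega>\<in>space M. \<bar>Z n \<omega> $ i\<bar> > d})" .
    qed
  qed simp
qed

section \<open>Independently scattered random measures\<close>

locale scattered_measure =
  fixes P :: "'w measure" and M :: "'s set \<Rightarrow> 'w \<Rightarrow> real^'m"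
    and \<mu> :: "(real^'m) measure" and \<Theta> :: "'s measure"
  assumes random_measure: "indep_scattered_random_measure P M \<mu> \<Theta>"
begin

sublocale prob_space P
  using random_measure by (simp add: indep_scattered_random_measure_def)

lemma measurable_M: "A \<in> finite_sets \<Theta> \<Longrightarrow> M A \<in> borel_measurable P"
  using random_measure by (simp add: indep_scattered_random_measure_def)

lemma indep_vars_M:
  "range A \<subseteq> finite_sets \<Theta> \<Longrightarrow> disjoint_family A \<Longrightarrow> indep_vars (\<lambda>_. borel) (\<lambda>n. M (A n)) (UNIV :: nat set)"
  using random_measure unfolding indep_scattered_random_measure_def by blast

lemma M_sums:
  "range A \<subseteq> finite_sets \<Theta> \<Longrightarrow> disjoint_family A \<Longrightarrow> (\<Union>n. A n) \<in> finite_sets \<Theta> \<Longrightarrow>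
    AE \<omega> in P. (\<lambda>n. M (A n) \<omega>) sums M (\<Union>n::nat. A n) \<omega>"
  using random_measure unfolding indep_scattered_random_measure_def by blast

lemma char_M:
  "A \<in> finite_sets \<Theta> \<Longrightarrow>
    (CLINT \<omega>|P. iexp (M A \<omega> \<bullet> u)) = exp (complex_of_real (measure \<Theta> A) * log_char \<mu> u)"
  using random_measure unfolding indep_scattered_random_measure_def by blast

lemma empty_finite_sets [simp]: "{} \<in> finite_sets \<Theta>"
  by (simp add: finite_sets_def)

lemma finite_sets_subset: "A \<in> finite_sets \<Theta> \<Longrightarrow> B \<in> sets \<Theta> \<Longrightarrow> B \<subseteq> A \<Longrightarrow> B \<in> finite_sets \<Theta>"
  unfolding finite_sets_def by (auto intro: le_less_trans[OF emeasure_mono])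

lemma finite_sets_Un: "A \<in> finite_sets \<Theta> \<Longrightarrow> B \<in> finite_sets \<Theta> \<Longrightarrow> A \<union> B \<in> finite_sets \<Theta>"
  unfolding finite_sets_def
  by (auto intro: le_less_trans[OF emeasure_subadditive])

lemma finite_sets_UN:
  "finite I \<Longrightarrow> (\<And>i. i \<in> I \<Longrightarrow> A i \<in> finite_sets \<Theta>) \<Longrightarrow> (\<Union>i\<in>I. A i) \<in> finite_sets \<Theta>"
  by (induction I rule: finite_induct) (auto intro: finite_sets_Un)

text \<open>The empty set is the disjoint union of countably many copies of itself, and a constant
  series converges only if its terms are 0.\<close>

lemma M_empty: "AE \<omega> in P. M {} \<omega> = 0"
proof -
  have "AE \<omega> in P. (\<lambda>n. M ((\<lambda>n::nat. {}) n) \<omega>) sums M (\<Union>n::nat. (\<lambda>n. {}) n) \<omega>"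
    by (rule M_sums) (auto simp: disjoint_family_on_def)
  then show ?thesis
  proof eventually_elim
    case (elim \<omega>)
    then have "(\<lambda>n::nat. M {} \<omega>) \<longlonglongrightarrow> 0" using sums_summable summable_LIMSEQ_zero by blast
    then show ?case using LIMSEQ_unique tendsto_const by blast
  qed
qed

lemma M_Un:
  assumes A: "A \<in> finite_sets \<Theta>" "B \<in> finite_sets \<Theta>" "A \<inter> B = {}"
  shows "AE \<omega> in P. M (A \<union> B) \<omega> = M A \<omega> + M B \<omega>"
proof -
  have "AE \<omega> in P. (\<lambda>n. M (binaryset A B n) \<omega>) sums M (\<Union>n. binaryset A B n) \<omega>"
    using A by (intro M_sums)
      (auto simp: range_binaryset_eq UN_binaryset_eq finite_sets_Un disjoint_family_on_def binaryset_def)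
  then show ?thesis using M_empty
  proof eventually_elim
    case (elim \<omega>)
    have "(\<lambda>n. M (binaryset A B n) \<omega>) sums (\<Sum>n\<in>{0, 1}. M (binaryset A B n) \<omega>)"
      by (rule sums_finite) (auto simp: binaryset_def elim)
    with elim(1) have "M (\<Union>n. binaryset A B n) \<omega> = (\<Sum>n\<in>{0, 1}. M (binaryset A B n) \<omega>)"
      by (rule sums_unique2)
    then show ?case by (simp add: UN_binaryset_eq) (simp add: binaryset_def)
  qed
qed

lemma M_UN:
  assumes "finite I" "\<And>i. i \<in> I \<Longrightarrow> A i \<in> finite_sets \<Theta>" "disjoint_family_on A I"
  shows "AE \<omega> in P. M (\<Union>i\<in>I. A i) \<omega> = (\<Sum>i\<in>I. M (A i) \<omega>)"
  using assms
proof (induction I rule: finite_induct)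
  case empty
  then show ?case using M_empty by simp
next
  case (insert i I)
  have "AE \<omega> in P. M (A i \<union> (\<Union>i\<in>I. A i)) \<omega> = M (A i) \<omega> + M (\<Union>i\<in>I. A i) \<omega>"
    using insert by (intro M_Un finite_sets_UN) (auto simp: disjoint_family_on_def)
  moreover have "AE \<omega> in P. M (\<Union>i\<in>I. A i) \<omega> = (\<Sum>i\<in>I. M (A i) \<omega>)"
    using insert by (intro insert.IH) (auto simp: disjoint_family_on_def)
  ultimately show ?case
    by eventually_elim (use insert in simp)
qed

text \<open>Independence turns the characteristic function of the sum into a product, and each
  matrix moves to \<open>u\<close> as its transpose.\<close>

lemma char_sum_M:
  assumes I: "finite I" "\<And>i. i \<in> I \<Longrightarrow> A i \<in> finite_sets \<Theta>" "disjoint_family_on A I"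
  shows "(CLINT \<omega>|P. iexp ((\<Sum>i\<in>I. R i *v M (A i) \<omega>) \<bullet> u)) =
     exp (\<Sum>i\<in>I. complex_of_real (measure \<Theta> (A i)) * log_char \<mu> (transpose (R i) *v u))"
proof -
  obtain h where h: "bij_betw h {0..<card I} I"
    using ex_bij_betw_nat_finite[OF I(1)] by blast
  \<comment> \<open>Independence is postulated for infinite sequences of sets, so the finite family
    is enumerated and padded with empty sets.\<close>
  define B where "B k = (if k < card I then A (h k) else {})" for k
  have hI: "h k \<in> I" if "k < card I" for k
    using h that by (auto simp: bij_betw_def)
  have inj: "h j \<noteq> h k" if "j < card I" "k < card I" "j \<noteq> k" for j k
    using h that by (auto simp: bij_betw_def inj_on_def)
  have iv: "indep_vars (\<lambda>_. borel) (\<lambda>n. M (B n)) (UNIV :: nat set)"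
  proof (rule indep_vars_M)
    show "range B \<subseteq> finite_sets \<Theta>" using I(2) hI by (auto simp: B_def)
    show "disjoint_family B"
      unfolding disjoint_family_on_def B_def using I(3) hI inj by (auto simp: disjoint_family_on_def)
  qed
  have iv': "indep_vars (\<lambda>_. borel) (\<lambda>k \<omega>. iexp (M (B k) \<omega> \<bullet> (transpose (R (h k)) *v u))) {0..<card I}"
    by (rule indep_vars_compose2[where Y = "\<lambda>k x. iexp (x \<bullet> (transpose (R (h k)) *v u))", OF indep_vars_subset[OF iv subset_UNIV]])
       auto
  have "(CLINT \<omega>|P. iexp ((\<Sum>i\<in>I. R i *v M (A i) \<omega>) \<bullet> u))
     = (CLINT \<omega>|P. \<Prod>k\<in>{0..<card I}. iexp (M (B k) \<omega> \<bullet> (transpose (R (h k)) *v u)))"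
  proof (intro Bochner_Integration.integral_cong refl)
    fix \<omega>
    have "(\<Sum>i\<in>I. R i *v M (A i) \<omega>) \<bullet> u = (\<Sum>i\<in>I. M (A i) \<omega> \<bullet> (transpose (R i) *v u))"
      by (simp add: inner_sum_left dot_lmul_matrix flip: vector_transpose_matrix)
    also have "\<dots> = (\<Sum>k\<in>{0..<card I}. M (B k) \<omega> \<bullet> (transpose (R (h k)) *v u))"
      by (subst sum.reindex_bij_betw[OF h, symmetric]) (simp add: B_def)
    finally show "iexp ((\<Sum>i\<in>I. R i *v M (A i) \<omega>) \<bullet> u) =
        (\<Prod>k\<in>{0..<card I}. iexp (M (B k) \<omega> \<bullet> (transpose (R (h k)) *v u)))"
      by (simp add: sum_distrib_left exp_sum)
  qed
  also have "\<dots> = (\<Prod>k\<in>{0..<card I}. CLINT \<omega>|P. iexp (M (B k) \<omega> \<bullet> (transpose (R (h k)) *v u)))"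
  proof (rule indep_vars_lebesgue_integral[OF _ iv'])
    show "integrable P (\<lambda>\<omega>. iexp (M (B k) \<omega> \<bullet> (transpose (R (h k)) *v u)))" if "k \<in> {0..<card I}" for k
    proof -
      have [measurable]: "M (B k) \<in> borel_measurable P"
        using measurable_M[OF I(2)[OF hI]] that by (simp add: B_def)
      show ?thesis by (intro integrable_const_bound[of _ 1]) auto
    qed
  qed simp
  also have "\<dots> = (\<Prod>k\<in>{0..<card I}. exp (complex_of_real (measure \<Theta> (A (h k))) * log_char \<mu> (transpose (R (h k)) *v u)))"
    by (intro prod.cong refl) (simp add: B_def char_M I(2) hI)
  also have "\<dots> = (\<Prod>i\<in>I. exp (complex_of_real (measure \<Theta> (A i)) * log_char \<mu> (transpose (R i) *v u)))"
    by (rule prod.reindex_bij_betw[OF h])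
  finally show ?thesis by (simp add: exp_sum I(1))
qed

section \<open>Integrals of simple functions through level sets\<close>

definition level_set :: "('s \<Rightarrow> 'b) \<Rightarrow> 'b \<Rightarrow> 's set" where
  "level_set p y = p -` {y} \<inter> space \<Theta>"

text \<open>The canonical representation, indexed by the values of \<open>F\<close>. The value 0 is
  left out because its level set may have infinite measure, where \<open>M\<close> is
  unspecified.\<close>

definition level_integral :: "('s \<Rightarrow> real^'m^'m) \<Rightarrow> 's set \<Rightarrow> 'w \<Rightarrow> real^'m" where
  "level_integral F C \<omega> = (\<Sum>r\<in>F ` space \<Theta> - {0}. r *v M (level_set F r \<inter> C) \<omega>)"

lemma level_set_sets: "simple_function \<Theta> p \<Longrightarrow> level_set p y \<in> sets \<Theta>"
  unfolding level_set_def by (rule simple_functionD(2))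

text \<open>Each level set of \<open>g\<close> composed with \<open>p\<close> is a finite disjoint
  union of level sets of \<open>p\<close>, so additivity of \<open>M\<close> rewrites the integral
  over the finer partition. Indices with \<open>g y = 0\<close> may be present in \<open>Y\<close>;
  they contribute 0.\<close>

lemma level_integral_refine:
  fixes p :: "'s \<Rightarrow> 'b"
  assumes p: "simple_function \<Theta> p" and F: "\<And>s. s \<in> space \<Theta> \<Longrightarrow> F s = g (p s)"
    and C: "C \<in> sets \<Theta>"
    and fin: "\<And>y. y \<in> p ` space \<Theta> \<Longrightarrow> g y \<noteq> 0 \<Longrightarrow> level_set p y \<in> finite_sets \<Theta>"
    and Y: "finite Y" "\<And>y. y \<in> p ` space \<Theta> \<Longrightarrow> g y \<noteq> 0 \<Longrightarrow> y \<in> Y" "Y \<subseteq> p ` space \<Theta>"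
  shows "AE \<omega> in P. level_integral F C \<omega> = (\<Sum>y\<in>Y. g y *v M (level_set p y \<inter> C) \<omega>)"
proof -
  define Y' where "Y' = {y \<in> p ` space \<Theta>. g y \<noteq> 0}"
  have Y'Y: "Y' \<subseteq> Y" using Y by (auto simp: Y'_def)
  have finY': "finite Y'" using Y'Y Y(1) finite_subset by blast
  have im: "F ` space \<Theta> - {0} = g ` Y'"
    using F by (auto simp: Y'_def image_iff)
  have "AE \<omega> in P. M (level_set F r \<inter> C) \<omega> = (\<Sum>y\<in>{y\<in>Y'. g y = r}. M (level_set p y \<inter> C) \<omega>)"
    if r: "r \<in> F ` space \<Theta> - {0}" for r
  proof -
    have "level_set F r \<inter> C = (\<Union>y\<in>{y\<in>Y'. g y = r}. level_set p y \<inter> C)"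
      using F r by (auto simp: level_set_def Y'_def)
    moreover have "AE \<omega> in P. M (\<Union>y\<in>{y\<in>Y'. g y = r}. level_set p y \<inter> C) \<omega>
        = (\<Sum>y\<in>{y\<in>Y'. g y = r}. M (level_set p y \<inter> C) \<omega>)"
    proof (rule M_UN)
      show "level_set p y \<inter> C \<in> finite_sets \<Theta>" if "y \<in> {y\<in>Y'. g y = r}" for y
        using fin[of y] that C level_set_sets[OF p, of y]
        by - (rule finite_sets_subset[of "level_set p y"], auto simp: Y'_def)
    qed (use finY' in \<open>auto simp: disjoint_family_on_def level_set_def\<close>)
    ultimately show ?thesis by simp
  qed
  moreover have "finite (F ` space \<Theta> - {0})" unfolding im using finY' by simp
  ultimately have "AE \<omega> in P. \<forall>r\<in>F ` space \<Theta> - {0}.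
      M (level_set F r \<inter> C) \<omega> = (\<Sum>y\<in>{y\<in>Y'. g y = r}. M (level_set p y \<inter> C) \<omega>)"
    by (intro AE_finite_allI)
  then show ?thesis
  proof eventually_elim
    case (elim \<omega>)
    have "level_integral F C \<omega> = (\<Sum>r\<in>g ` Y'. r *v (\<Sum>y\<in>{y\<in>Y'. g y = r}. M (level_set p y \<inter> C) \<omega>))"
      unfolding level_integral_def im[symmetric] using elim by (intro sum.cong) auto
    also have "\<dots> = (\<Sum>r\<in>g ` Y'. \<Sum>y\<in>{y\<in>Y'. g y = r}. g y *v M (level_set p y \<inter> C) \<omega>)"
    proof (intro sum.cong refl)
      fix r
      have "r *v (\<Sum>y\<in>{y\<in>Y'. g y = r}. M (level_set p y \<inter> C) \<omega>)
        = (\<Sum>y\<in>{y\<in>Y'. g y = r}. r *v M (level_set p y \<inter> C) \<omega>)"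
        by (rule linear_sum[OF matrix_vector_mul_linear])
      also have "\<dots> = (\<Sum>y\<in>{y\<in>Y'. g y = r}. g y *v M (level_set p y \<inter> C) \<omega>)"
        by (rule sum.cong) simp_all
      finally show "r *v (\<Sum>y\<in>{y\<in>Y'. g y = r}. M (level_set p y \<inter> C) \<omega>) = \<dots>" .
    qed
    also have "\<dots> = (\<Sum>y\<in>Y'. g y *v M (level_set p y \<inter> C) \<omega>)"
      using finY' by (intro sum.group) auto
    also have "\<dots> = (\<Sum>y\<in>Y. g y *v M (level_set p y \<inter> C) \<omega>)"
      using Y by (intro sum.mono_neutral_left Y'Y) (auto simp: Y'_def)
    finally show ?case .
  qed
qed

lemma measurable_level_integral:
  assumes F: "simple_function \<Theta> F" and C: "C \<in> sets \<Theta>"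
    and fin: "\<And>r. r \<noteq> 0 \<Longrightarrow> level_set F r \<in> finite_sets \<Theta>"
  shows "level_integral F C \<in> borel_measurable P"
proof -
  have "M (level_set F r \<inter> C) \<in> borel_measurable P" if "r \<noteq> 0" for r
    using fin[OF that] C level_set_sets[OF F, of r]
    by (intro measurable_M) (rule finite_sets_subset[of "level_set F r"], auto)
  moreover have "(\<lambda>x. r *v x) \<in> borel_measurable borel" for r :: "real^'m^'m"
    by (intro borel_measurable_continuous_onI linear_continuous_on) simp
  ultimately have "(\<lambda>\<omega>. r *v M (level_set F r \<inter> C) \<omega>) \<in> borel_measurable P" if "r \<noteq> 0" for r
    using that measurable_compose by blast
  then show ?thesis unfolding level_integral_def by (intro borel_measurable_sum) auto
qed

text \<open>Over a common refinement the exponent is a sum of measures times values of the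
  logarithm, in effect an integral over \<open>C\<close>, so it is dominated by the integral of
  \<open>w\<close> uniformly in \<open>C\<close>. Stating the result through an exponent
  \<open>c\<close> avoids choosing a branch of the logarithm.\<close>

lemma char_level_integral_diff:
  assumes F: "simple_function \<Theta> F" "\<And>r. r \<noteq> 0 \<Longrightarrow> level_set F r \<in> finite_sets \<Theta>"
    and F': "simple_function \<Theta> F'" "\<And>r. r \<noteq> 0 \<Longrightarrow> level_set F' r \<in> finite_sets \<Theta>"
    and C: "C \<in> sets \<Theta>"
    and b: "\<And>R. norm (log_char \<mu> (transpose R *v u)) \<le> H (norm R)" and H: "\<And>x. H x \<ge> 0"
    and w: "integrable \<Theta> w" "\<And>s. s \<in> space \<Theta> \<Longrightarrow> H (norm (F s - F' s)) \<le> w s"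
  shows "\<exists>c. (CLINT \<omega>|P. iexp ((level_integral F C \<omega> - level_integral F' C \<omega>) \<bullet> u)) = exp c \<and>
    norm c \<le> (\<integral>s. w s \<partial>\<Theta>)"
proof -
  \<comment> \<open>The pair of values is the common refinement. Only the value
    \<open>(0, 0)\<close> can have a level set of infinite measure, and there the difference
    vanishes.\<close>
  define p where "p s = (F s, F' s)" for s
  define Y where "Y = p ` space \<Theta> - {(0, 0)}"
  let ?A = "\<lambda>y. level_set p y \<inter> C"
  have p: "simple_function \<Theta> p"
    unfolding p_def[abs_def] by (rule simple_function_Pair[OF F(1) F'(1)])
  have Y: "finite Y" using simple_functionD(1)[OF p] by (simp add: Y_def)
  have lev: "level_set p y \<in> finite_sets \<Theta>" if "y \<noteq> (0, 0)" for y
  proof (cases "fst y = 0")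
    case True
    with that have "snd y \<noteq> 0" by (metis prod.collapse)
    then show ?thesis
      by (rule finite_sets_subset[OF F'(2)[of "snd y"] level_set_sets[OF p]])
         (auto simp: level_set_def p_def)
  next
    case False
    then show ?thesis
      by (rule finite_sets_subset[OF F(2)[of "fst y"] level_set_sets[OF p]])
         (auto simp: level_set_def p_def)
  qed
  have A: "?A y \<in> finite_sets \<Theta>" if "y \<in> Y" for y
    using lev[of y] that C level_set_sets[OF p, of y]
    by - (rule finite_sets_subset[of "level_set p y"], auto simp: Y_def)
  have dis: "disjoint_family_on ?A Y"
    by (auto simp: disjoint_family_on_def level_set_def)
  have "AE \<omega> in P. level_integral F C \<omega> = (\<Sum>y\<in>Y. fst y *v M (?A y) \<omega>)"
    by (rule level_integral_refine[OF p _ C]) (use Y lev in \<open>auto simp: p_def Y_def\<close>)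
  moreover have "AE \<omega> in P. level_integral F' C \<omega> = (\<Sum>y\<in>Y. snd y *v M (?A y) \<omega>)"
    by (rule level_integral_refine[OF p _ C]) (use Y lev in \<open>auto simp: p_def Y_def\<close>)
  ultimately have ae: "AE \<omega> in P. level_integral F C \<omega> - level_integral F' C \<omega> = (\<Sum>y\<in>Y. (fst y - snd y) *v M (?A y) \<omega>)"
    by eventually_elim (simp add: sum_subtractf matrix_vector_mult_diff_rdistrib)
  have mM: "M (?A y) \<in> borel_measurable P" if "y \<in> Y" for y
    using A[OF that] by (rule measurable_M)
  have mul: "(\<lambda>x. R *v x) \<in> borel_measurable borel" for R :: "real^'m^'m"
    by (intro borel_measurable_continuous_onI linear_continuous_on) simp
  have [measurable]: "(\<lambda>\<omega>. \<Sum>y\<in>Y. (fst y - snd y) *v M (?A y) \<omega>) \<in> borel_measurable P"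
    by (intro borel_measurable_sum measurable_compose[OF mM mul])
  have [measurable]: "level_integral F C \<in> borel_measurable P" "level_integral F' C \<in> borel_measurable P"
    using assms by (auto intro!: measurable_level_integral)
  define c where "c = (\<Sum>y\<in>Y. complex_of_real (measure \<Theta> (?A y)) * log_char \<mu> (transpose (fst y - snd y) *v u))"
  have "(CLINT \<omega>|P. iexp ((level_integral F C \<omega> - level_integral F' C \<omega>) \<bullet> u))
     = (CLINT \<omega>|P. iexp ((\<Sum>y\<in>Y. (fst y - snd y) *v M (?A y) \<omega>) \<bullet> u))"
    by (intro integral_cong_AE) (use ae in \<open>auto elim!: eventually_mono\<close>)
  also have "\<dots> = exp c"
    unfolding c_def by (rule char_sum_M[OF Y A dis])
  finally have "(CLINT \<omega>|P. iexp ((level_integral F C \<omega> - level_integral F' C \<omega>) \<bullet> u)) = exp c" .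
  moreover have "norm c \<le> (\<integral>s. w s \<partial>\<Theta>)"
  proof -
    have em: "?A y \<in> sets \<Theta>" "emeasure \<Theta> (?A y) < \<infinity>" if "y \<in> Y" for y
      using A[OF that] by (auto simp: finite_sets_def)
    have int: "integrable \<Theta> (\<lambda>s. H (norm (fst y - snd y)) * indicator (?A y) s)" if "y \<in> Y" for y
      using em[OF that] by (intro integrable_mult_right integrable_real_indicator)
    have "norm c \<le> (\<Sum>y\<in>Y. measure \<Theta> (?A y) * H (norm (fst y - snd y)))"
      unfolding c_def
    proof (intro order_trans[OF norm_sum] sum_mono)
      fix y
      show "norm (complex_of_real (measure \<Theta> (?A y)) * log_char \<mu> (transpose (fst y - snd y) *v u))
          \<le> measure \<Theta> (?A y) * H (norm (fst y - snd y))"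
        using mult_left_mono[OF b[of "fst y - snd y"], of "measure \<Theta> (?A y)"] by (simp add: norm_mult)
    qed
    also have "\<dots> = (\<Sum>y\<in>Y. \<integral>s. H (norm (fst y - snd y)) * indicator (?A y) s \<partial>\<Theta>)"
      using em by (intro sum.cong refl) (simp add: mult.commute)
    also have "\<dots> = (\<integral>s. (\<Sum>y\<in>Y. H (norm (fst y - snd y)) * indicator (?A y) s) \<partial>\<Theta>)"
      using int by (intro Bochner_Integration.integral_sum[symmetric])
    also have "\<dots> \<le> (\<integral>s. w s \<partial>\<Theta>)"
    proof (rule integral_mono)
      show "integrable \<Theta> (\<lambda>s. \<Sum>y\<in>Y. H (norm (fst y - snd y)) * indicator (?A y) s)"
        using int by (rule Bochner_Integration.integrable_sum)
      show "(\<Sum>y\<in>Y. H (norm (fst y - snd y)) * indicator (?A y) s) \<le> w s" if s: "s \<in> space \<Theta>" for s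
      proof -
        have "(\<Sum>y\<in>Y. H (norm (fst y - snd y)) * indicator (?A y) s)
           \<le> (\<Sum>y\<in>Y. if y = p s then H (norm (F s - F' s)) else 0)"
          by (intro sum_mono) (auto simp: level_set_def p_def H indicator_def)
        also have "\<dots> \<le> H (norm (F s - F' s))"
          using Y H by simp
        also have "\<dots> \<le> w s" by (rule w(2)[OF s])
        finally show ?thesis .
      qed
    qed (rule w(1))
    finally show ?thesis .
  qed
  ultimately show ?thesis by blast
qed

end

section \<open>A sufficient criterion for integrability\<close>

text \<open>Submultiplicativity of \<open>x powr p + x powr q\<close>: it separates the argument
  \<open>u\<close>, the matrix norm and numerical constants in one stroke.\<close>

lemma powr_sum_mult_le:
  fixes a b c :: real
  assumes "a \<ge> 0" "b \<ge> 0" "c \<ge> 0" "a \<le> c * b" "p > 0" "q > 0"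
  shows "a powr p + a powr q \<le> (c powr p + c powr q) * (b powr p + b powr q)"
proof -
  have "a powr p + a powr q \<le> (c * b) powr p + (c * b) powr q"
    using assms by (intro add_mono powr_mono2) auto
  also have "\<dots> = c powr p * b powr p + c powr q * b powr q"
    using assms by (simp add: powr_mult)
  also have "\<dots> \<le> (c powr p + c powr q) * (b powr p + b powr q)"
    by (simp add: algebra_simps)
  finally show ?thesis .
qed

context scattered_measure
begin

lemma converges_in_probability_level_integral:
  fixes f :: "'s \<Rightarrow> real^'m^'m" and F :: "nat \<Rightarrow> 's \<Rightarrow> real^'m^'m"
  defines "G \<equiv> \<lambda>p q x :: real. x powr p + x powr q"
  assumes p: "p > 0" "q > 0" and K: "K > 0" "\<And>u. norm (log_char \<mu> u) \<le> K * G p q (norm u)"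
    and F: "\<And>k. simple_function \<Theta> (F k)" "\<And>k r. r \<noteq> 0 \<Longrightarrow> level_set (F k) r \<in> finite_sets \<Theta>"
    and int: "\<And>k. integrable \<Theta> (\<lambda>s. G p q (norm (F k s - f s)))"
    and lim: "(\<lambda>k. \<integral>s. G p q (norm (F k s - f s)) \<partial>\<Theta>) \<longlonglongrightarrow> 0"
    and C: "C \<in> sets \<Theta>"
  shows "converges_in_probability P (\<lambda>k. level_integral (F k) C)"
proof -
  let ?X = "\<lambda>k. level_integral (F k) C" and ?G = "G p q"
  define e where "e k = (\<integral>s. ?G (norm (F k s - f s)) \<partial>\<Theta>)" for k
  have X [measurable]: "?X k \<in> borel_measurable P" for k
    using F C by (intro measurable_level_integral) auto
  have G0: "?G x \<ge> 0" for x by (simp add: G_def)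
  have ch: "\<exists>c. (CLINT \<omega>|P. iexp ((?X k \<omega> - ?X l \<omega>) \<bullet> u)) = exp c \<and>
      norm c \<le> K * ?G (norm u) * ?G 2 * (e k + e l)" for k l u
  proof -
    define w where "w s = K * ?G (norm u) * ?G 2 * (?G (norm (F k s - f s)) + ?G (norm (F l s - f s)))" for s
    have "\<exists>c. (CLINT \<omega>|P. iexp ((?X k \<omega> - ?X l \<omega>) \<bullet> u)) = exp c \<and> norm c \<le> (\<integral>s. w s \<partial>\<Theta>)"
    proof (rule char_level_integral_diff[OF F(1) F(2) F(1) F(2) C, where H = "\<lambda>x. K * (?G (norm u) * ?G x)"])
      fix R :: "real^'m^'m"
      have "?G (norm (transpose R *v u)) \<le> ?G (norm u) * ?G (norm R)"
        unfolding G_def using p norm_matrix_vector_mult_le[of "transpose R" u]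
        by (intro powr_sum_mult_le) (auto simp: norm_transpose mult.commute)
      then show "norm (log_char \<mu> (transpose R *v u)) \<le> K * (?G (norm u) * ?G (norm R))"
        using K(1) by (intro order_trans[OF K(2)] mult_left_mono) auto
    next
      show "K * (?G (norm u) * ?G x) \<ge> 0" for x using K(1) G0 by simp
    next
      show "integrable \<Theta> w"
        unfolding w_def by (intro integrable_mult_right Bochner_Integration.integrable_add int)
    next
      fix s
      \<comment> \<open>The function \<open>?G\<close> need not be subadditive, as its exponents may
        exceed 1. Passing through \<open>2 * max a b\<close> costs only the factor
        \<open>?G 2\<close>.\<close>
      define a b where "a = norm (F k s - f s)" and "b = norm (F l s - f s)"
      have "norm (F k s - F l s) \<le> a + b"
        unfolding a_def b_def using norm_triangle_ineq4[of "F k s - f s" "F l s - f s"] by simp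
      also have "\<dots> \<le> 2 * max a b" by simp
      finally have "?G (norm (F k s - F l s)) \<le> ?G 2 * ?G (max a b)"
        unfolding G_def using p by (intro powr_sum_mult_le) (auto simp: a_def b_def max_def)
      also have "\<dots> \<le> ?G 2 * (?G a + ?G b)"
        using G0 by (intro mult_left_mono) (auto simp: max_def)
      finally show "K * (?G (norm u) * ?G (norm (F k s - F l s))) \<le> w s"
        unfolding w_def a_def b_def mult.assoc using K(1) G0 by (intro mult_left_mono) auto
    qed
    moreover have "(\<integral>s. w s \<partial>\<Theta>) = K * ?G (norm u) * ?G 2 * (e k + e l)"
      unfolding w_def e_def by (simp add: int Bochner_Integration.integral_add)
    ultimately show ?thesis by simp
  qed
  show ?thesis
  proof (rule converges_in_probability_Cauchy[OF X])
    fix \<epsilon> :: real assume \<epsilon>: "\<epsilon> > 0"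
    show "\<exists>N. \<forall>k\<ge>N. \<forall>l\<ge>N. measure P {\<omega>\<in>space P. dist (?X k \<omega>) (?X l \<omega>) > \<epsilon>} < \<epsilon>"
    \<comment> \<open>The estimate \<open>ch\<close> depends on \<open>u\<close>, so the two-index
      Cauchy condition is reduced to one sequence: bad indices \<open>k N\<close> and
      \<open>l N\<close> tend to infinity, and for each fixed \<open>u\<close> the exponents tend to
      0.\<close>
    proof (rule ccontr)
      assume "\<not> ?thesis"
      then have "\<forall>N. \<exists>k l. k \<ge> N \<and> l \<ge> N \<and> measure P {\<omega>\<in>space P. dist (?X k \<omega>) (?X l \<omega>) > \<epsilon>} \<ge> \<epsilon>"
        by (meson not_less)
      from this[THEN choice] obtain k where "\<forall>N. \<exists>l. k N \<ge> N \<and> l \<ge> N \<and> measure P {\<omega>\<in>space P. dist (?X (k N) \<omega>) (?X l \<omega>) > \<epsilon>} \<ge> \<epsilon>"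
        by blast
      from choice[OF this] obtain l where kl: "\<And>N. k N \<ge> N" "\<And>N. l N \<ge> N"
        "\<And>N. measure P {\<omega>\<in>space P. dist (?X (k N) \<omega>) (?X (l N) \<omega>) > \<epsilon>} \<ge> \<epsilon>"
        by blast
      have kl_lim: "filterlim k at_top sequentially" "filterlim l at_top sequentially"
        by (rule filterlim_at_top_mono[OF filterlim_ident], use kl in simp)+
      have "(\<lambda>N. measure P {\<omega>\<in>space P. norm (?X (k N) \<omega> - ?X (l N) \<omega>) > \<epsilon>}) \<longlonglongrightarrow> 0"
      proof (rule tendsto_prob_0_vec[OF _ _ \<epsilon>])
        fix u
        have "\<forall>N. \<exists>c. (CLINT \<omega>|P. iexp ((?X (k N) \<omega> - ?X (l N) \<omega>) \<bullet> u)) = exp c \<and>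
            norm c \<le> K * ?G (norm u) * ?G 2 * (e (k N) + e (l N))"
          by (intro allI ch)
        from choice[OF this] obtain c where c: "\<And>N. (CLINT \<omega>|P. iexp ((?X (k N) \<omega> - ?X (l N) \<omega>) \<bullet> u)) = exp (c N)"
          "\<And>N. norm (c N) \<le> K * ?G (norm u) * ?G 2 * (e (k N) + e (l N))"
          by blast
        have "(\<lambda>N. e (k N)) \<longlonglongrightarrow> 0" "(\<lambda>N. e (l N)) \<longlonglongrightarrow> 0"
          using filterlim_compose[OF lim kl_lim(1)] filterlim_compose[OF lim kl_lim(2)]
          by (simp_all add: e_def)
        then have "(\<lambda>N. K * ?G (norm u) * ?G 2 * (e (k N) + e (l N))) \<longlonglongrightarrow> K * ?G (norm u) * ?G 2 * (0 + 0)"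
          by (intro tendsto_intros)
        then have "(\<lambda>N. K * ?G (norm u) * ?G 2 * (e (k N) + e (l N))) \<longlonglongrightarrow> 0" by simp
        then have "c \<longlonglongrightarrow> 0"
          by (rule Lim_null_comparison[rotated]) (simp add: c(2))
        then have "(\<lambda>N. exp (c N)) \<longlonglongrightarrow> exp 0" by (rule tendsto_exp)
        then show "(\<lambda>N. CLINT \<omega>|P. iexp ((?X (k N) \<omega> - ?X (l N) \<omega>) \<bullet> u)) \<longlonglongrightarrow> 1"
          by (simp add: c(1))
      qed simp
      then have "\<epsilon> \<le> 0"
        by (rule tendsto_lowerbound) (use kl(3) in \<open>auto simp: dist_norm\<close>)
      then show False using \<epsilon> by simp
    qed
  qed
qed

theorem stoch_integrableI:
  fixes f :: "'s \<Rightarrow> real^'m^'m"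
  assumes p: "p > 0" "q > 0"
    and K: "K > 0" "\<And>u. norm (log_char \<mu> u) \<le> K * (norm u powr p + norm u powr q)"
    and f [measurable]: "f \<in> borel_measurable \<Theta>"
    and int: "integrable \<Theta> (\<lambda>s. norm (f s) powr p + norm (f s) powr q)"
  shows "stoch_integrable P M \<Theta> f"
proof -
  define G where "G = (\<lambda>x :: real. x powr p + x powr q)"
  have G0: "G x \<ge> 0" for x by (simp add: G_def)
  have [measurable]: "G \<in> borel_measurable borel" by (simp add: G_def)
  have int': "integrable \<Theta> (\<lambda>s. G (norm (f s)))" using int by (simp add: G_def)
  obtain F where F: "\<And>k. simple_function \<Theta> (F k)" "\<And>s. s \<in> space \<Theta> \<Longrightarrow> (\<lambda>k. F k s) \<longlonglongrightarrow> f s"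
      "\<And>k s. s \<in> space \<Theta> \<Longrightarrow> norm (F k s) \<le> 2 * norm (f s)"
    using borel_measurable_implies_sequence_metric[OF f, of 0] unfolding dist_norm diff_zero by metis
  have [measurable]: "F k \<in> borel_measurable \<Theta>" for k
    using F(1) by (rule borel_measurable_simple_function)
  have intF: "integrable \<Theta> (\<lambda>s. G (norm (F k s)))" for k
  proof (rule Bochner_Integration.integrable_bound)
    show "integrable \<Theta> (\<lambda>s. G 2 * G (norm (f s)))" using int' by simp
    show "AE s in \<Theta>. norm (G (norm (F k s))) \<le> norm (G 2 * G (norm (f s)))"
    proof (rule AE_I2)
      fix s assume "s \<in> space \<Theta>"
      then have "G (norm (F k s)) \<le> G 2 * G (norm (f s))"
        unfolding G_def using p F(3) by (intro powr_sum_mult_le) auto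
      then show "norm (G (norm (F k s))) \<le> norm (G 2 * G (norm (f s)))" using G0 by (simp add: abs_of_nonneg)
    qed
  qed simp
  \<comment> \<open>The 3 comes from \<open>norm (F k s) + norm (f s)\<close> with
    \<open>norm (F k s) \<le> 2 * norm (f s)\<close>.\<close>
  have bd: "G (norm (F k s - f s)) \<le> G 3 * G (norm (f s))" if "s \<in> space \<Theta>" for k s
    unfolding G_def using p F(3)[OF that, of k] norm_triangle_ineq4[of "F k s" "f s"]
    by (intro powr_sum_mult_le) auto
  have bd': "AE s in \<Theta>. norm (G (norm (F k s - f s))) \<le> G 3 * G (norm (f s))" for k
    using bd G0 by (intro AE_I2) (simp add: abs_of_nonneg)
  have intd: "integrable \<Theta> (\<lambda>s. G (norm (F k s - f s)))" for k
    by (rule Bochner_Integration.integrable_bound[OF integrable_mult_right[OF int', of "G 3"]])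
       (use bd'[of k] G0 in \<open>auto elim!: eventually_mono simp: abs_mult\<close>)
  have lim: "(\<lambda>k. \<integral>s. G (norm (F k s - f s)) \<partial>\<Theta>) \<longlonglongrightarrow> 0"
  proof -
    have "(\<lambda>k. \<integral>s. G (norm (F k s - f s)) \<partial>\<Theta>) \<longlonglongrightarrow> (\<integral>s. 0 \<partial>\<Theta>)"
    proof (rule integral_dominated_convergence[where w = "\<lambda>s. G 3 * G (norm (f s))"])
      show "AE s in \<Theta>. (\<lambda>k. G (norm (F k s - f s))) \<longlonglongrightarrow> 0"
      proof (rule AE_I2)
        fix s assume "s \<in> space \<Theta>"
        then have "(\<lambda>k. norm (F k s - f s)) \<longlonglongrightarrow> 0"
          using F(2) tendsto_norm_zero LIM_zero by blast
        then have "(\<lambda>k. norm (F k s - f s) powr p + norm (F k s - f s) powr q) \<longlonglongrightarrow> 0 + 0"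
          using p by (intro tendsto_add tendsto_zero_powrI[OF _ tendsto_const]) auto
        then show "(\<lambda>k. G (norm (F k s - f s))) \<longlonglongrightarrow> 0" by (simp add: G_def)
      qed
    qed (use bd' int' in auto)
    then show ?thesis by simp
  qed
  have fin: "level_set (F k) r \<in> finite_sets \<Theta>" if r: "r \<noteq> 0" for k r
  proof -
    let ?A = "level_set (F k) r"
    have A [measurable]: "?A \<in> sets \<Theta>" by (rule level_set_sets[OF F(1)])
    \<comment> \<open>Markov's argument: on the level set the integrable function
      \<open>G (norm (F k s))\<close> equals the positive constant \<open>G (norm r)\<close>, so the
      measure is finite.\<close>
    have Gr: "G (norm r) > 0" using r by (simp add: G_def add_pos_pos)
    have "integrable \<Theta> (\<lambda>s. G (norm r) * indicator ?A s)"
      by (rule Bochner_Integration.integrable_bound[OF intF[of k]])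
         (use G0 in \<open>auto simp: level_set_def indicator_def\<close>)
    then have "integrable \<Theta> (indicator ?A :: 's \<Rightarrow> real)"
      using Gr by simp
    then show ?thesis using A by (simp add: finite_sets_def integrable_indicator_iff)
  qed
  have conv: "converges_in_probability P (\<lambda>k. level_integral (F k) C)" if "C \<in> sets \<Theta>" for C
    by (rule converges_in_probability_level_integral[OF p K F(1) fin _ _ that, where f = f])
       (use intd lim in \<open>simp_all add: G_def\<close>)
  define n where "n k = card (F k ` space \<Theta> - {0})" for k
  have "\<exists>h. bij_betw h {0..<n k} (F k ` space \<Theta> - {0})" for k
    unfolding n_def by (rule ex_bij_betw_nat_finite) (use simple_functionD(1)[OF F(1)] in simp)
  then obtain R where R: "\<And>k. bij_betw (R k) {0..<n k} (F k ` space \<Theta> - {0})" by metis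
  have Rne: "R k j \<noteq> 0" if "j < n k" for k j
    using R[of k] that by (auto simp: bij_betw_def)
  define A where "A k j = level_set (F k) (R k j)" for k j
  have rep: "simple_rep \<Theta> (n k) (A k)" for k
    unfolding simple_rep_def
  proof
    show "\<forall>j<n k. A k j \<in> finite_sets \<Theta>" using fin Rne by (simp add: A_def)
    show "disjoint_family_on (A k) {..<n k}"
      using R[of k] by (auto simp: disjoint_family_on_def A_def level_set_def bij_betw_def inj_on_def)
  qed
  have sf: "simple_fun (n k) (R k) (A k) s = F k s" if s: "s \<in> space \<Theta>" for k s
  proof -
    have "simple_fun (n k) (R k) (A k) s = (\<Sum>j\<in>{0..<n k}. indicator (level_set (F k) (R k j)) s *\<^sub>R R k j)"
      by (simp add: simple_fun_def A_def atLeast0LessThan)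
    also have "\<dots> = (\<Sum>r\<in>F k ` space \<Theta> - {0}. indicator (level_set (F k) r) s *\<^sub>R r)"
      by (rule sum.reindex_bij_betw[OF R])
    also have "\<dots> = (\<Sum>r\<in>F k ` space \<Theta> - {0}. if r = F k s then F k s else 0)"
      using s by (intro sum.cong) (auto simp: level_set_def indicator_def)
    also have "\<dots> = F k s"
      using s simple_functionD(1)[OF F(1), of k] by auto
    finally show ?thesis .
  qed
  have si: "simple_stoch_integral M (n k) (R k) (\<lambda>j. A k j \<inter> C) = level_integral (F k) C" for k C
  proof
    fix \<omega>
    show "simple_stoch_integral M (n k) (R k) (\<lambda>j. A k j \<inter> C) \<omega> = level_integral (F k) C \<omega>"
      unfolding simple_stoch_integral_def level_integral_def A_def
      by (subst sum.reindex_bij_betw[OF R, symmetric]) (simp add: atLeast0LessThan)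
  qed
  show ?thesis
    unfolding stoch_integrable_def
  proof (intro conjI exI ballI allI)
    show "AE s in \<Theta>. (\<lambda>k. simple_fun (n k) (R k) (A k) s) \<longlonglongrightarrow> f s"
      by (rule AE_I2) (simp add: sf F(2))
    show "simple_rep \<Theta> (n k) (A k)" for k by (rule rep)
    show "converges_in_probability P (\<lambda>k. simple_stoch_integral M (n k) (R k) (\<lambda>j. A k j \<inter> C))"
      if "C \<in> sets \<Theta>" for C
      unfolding si by (rule conv[OF that])
  qed (rule f)
qed

end

section \<open>Volume scaling by matrix powers\<close>

text \<open>\<^const>\<open>measure\<close> of linear images is only available for well-ordered index types in the library,
  so an arbitrary finite index type is copied to one that is well-ordered by an enumeration.\<close>

typedef 'a enumerated = "UNIV :: 'a set" ..

lemma bij_Rep_enumerated: "bij Rep_enumerated"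
  by (rule o_bij[of Abs_enumerated]) (auto simp: Rep_enumerated_inverse Abs_enumerated_inverse)

instance enumerated :: (finite) finite
proof
  show "finite (UNIV :: 'a enumerated set)"
    using finite_imageD[of "Rep_enumerated :: 'a enumerated \<Rightarrow> 'a" UNIV] bij_Rep_enumerated[THEN bij_is_inj]
    by (meson finite_class.finite_UNIV finite_subset subset_UNIV)
qed

definition enumeration :: "'a::finite \<Rightarrow> nat" where
  "enumeration = (SOME f. inj f)"

lemma inj_enumeration: "inj enumeration"
proof -
  have "\<exists>f :: 'a \<Rightarrow> nat. inj f"
    using finite_imp_inj_to_nat_seg[OF finite_class.finite_UNIV] by meson
  then show ?thesis unfolding enumeration_def by (rule someI_ex)
qed

instantiation enumerated :: (finite) wellorder
begin

definition less_eq_enumerated :: "'a enumerated \<Rightarrow> 'a enumerated \<Rightarrow> bool" where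
  "x \<le> y \<longleftrightarrow> enumeration (Rep_enumerated x) \<le> enumeration (Rep_enumerated y)"

definition less_enumerated :: "'a enumerated \<Rightarrow> 'a enumerated \<Rightarrow> bool" where
  "x < y \<longleftrightarrow> enumeration (Rep_enumerated x) < enumeration (Rep_enumerated y)"

instance
proof
  fix x y z :: "'a enumerated" and Q :: "'a enumerated \<Rightarrow> bool" and a :: "'a enumerated"
  show "x < y \<longleftrightarrow> x \<le> y \<and> \<not> y \<le> x" "x \<le> x" "x \<le> y \<or> y \<le> x"
    by (auto simp: less_eq_enumerated_def less_enumerated_def)
  show "x \<le> y \<Longrightarrow> y \<le> z \<Longrightarrow> x \<le> z" by (simp add: less_eq_enumerated_def)
  show "x = y" if "x \<le> y" "y \<le> x"
  proof -
    have "enumeration (Rep_enumerated x) = enumeration (Rep_enumerated y)"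
      using that unfolding less_eq_enumerated_def by (rule antisym)
    then show ?thesis using inj_eq[OF inj_enumeration] Rep_enumerated_inject by blast
  qed
  show "Q a" if "\<And>x. (\<And>y. y < x \<Longrightarrow> Q y) \<Longrightarrow> Q x"
    using that unfolding less_enumerated_def
    by (rule measure_induct_rule[of "\<lambda>x. enumeration (Rep_enumerated x)" Q a]) blast
qed

end

definition reindex_mat :: "real^'d^'d \<Rightarrow> real^('d enumerated)^('d enumerated)" where
  "reindex_mat A = (\<chi> i j. A $ Rep_enumerated i $ Rep_enumerated j)"

definition unindex_vec :: "real^('d enumerated) \<Rightarrow> real^'d" where
  "unindex_vec x = (\<chi> i. x $ Abs_enumerated i)"

lemma sum_Rep_enumerated: "(\<Sum>j\<in>UNIV. f (Rep_enumerated j)) = (\<Sum>j\<in>UNIV. f j)"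
  by (rule sum.reindex_bij_betw) (use bij_Rep_enumerated in simp)

lemma reindex_mat_mult: "reindex_mat (A ** B) = reindex_mat A ** reindex_mat B"
  unfolding reindex_mat_def matrix_matrix_mult_def
  by (simp add: vec_eq_iff) (intro allI sum_Rep_enumerated[symmetric])

lemma reindex_mat_1: "reindex_mat (mat 1) = mat 1"
  by (simp add: reindex_mat_def mat_def vec_eq_iff Rep_enumerated_inject)

lemma mat_exp_reindex: "mat_exp (reindex_mat A) = reindex_mat (mat_exp A)"
proof -
  have pow: "mat_pow (reindex_mat A) n = reindex_mat (mat_pow A n)" for n
    by (induction n) (simp_all add: mat_pow_Suc reindex_mat_mult reindex_mat_1)
  have "bounded_linear (reindex_mat :: real^'a^'a \<Rightarrow> _)"
    unfolding linear_conv_bounded_linear[symmetric]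
    by (rule linearI) (simp_all add: reindex_mat_def vec_eq_iff)
  from bounded_linear.sums[OF this mat_exp_sums[of A]]
  have "(\<lambda>n. (1 / fact n) *\<^sub>R mat_pow (reindex_mat A) n) sums reindex_mat (mat_exp A)"
    unfolding pow by (simp add: reindex_mat_def vec_eq_iff[symmetric] scaleR_vec_def)
  then show ?thesis using mat_exp_sums sums_unique2 by blast
qed

lemma mat_powr_reindex: "mat_powr s (reindex_mat A) = reindex_mat (mat_powr s A)"
proof -
  have "t *\<^sub>R reindex_mat A = reindex_mat (t *\<^sub>R A)" for t
    by (simp add: reindex_mat_def vec_eq_iff)
  then show ?thesis
    by (simp add: mat_powr_def mat_exp_reindex) (simp add: reindex_mat_def vec_eq_iff)
qed

lemma trace_reindex: "trace (reindex_mat A) = trace A"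
  unfolding trace_def reindex_mat_def by (simp add: sum_Rep_enumerated[of "\<lambda>i. A $ i $ i"])

lemma unindex_reindex_app: "unindex_vec (reindex_mat A *v x) = A *v unindex_vec x"
proof -
  have "(\<Sum>j\<in>UNIV. A $ i $ Rep_enumerated j * x $ j) = (\<Sum>j\<in>UNIV. A $ i $ j * x $ Abs_enumerated j)" for i
    using sum_Rep_enumerated[of "\<lambda>j. A $ i $ j * x $ Abs_enumerated j"]
    by (simp add: Rep_enumerated_inverse)
  then show ?thesis
    by (simp add: unindex_vec_def reindex_mat_def matrix_vector_mult_def vec_eq_iff Abs_enumerated_inverse)
qed

lemma continuous_on_unindex: "continuous_on UNIV unindex_vec"
  unfolding unindex_vec_def by (intro continuous_intros)

lemma norm_unindex: "norm (unindex_vec x) = norm x"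
proof -
  have "(\<Sum>i\<in>UNIV. (x $ Abs_enumerated i)\<^sup>2) = (\<Sum>i\<in>UNIV. (x $ i)\<^sup>2)"
    using sum_Rep_enumerated[of "\<lambda>j. (x $ Abs_enumerated j)\<^sup>2"] by (simp add: Rep_enumerated_inverse)
  then show ?thesis by (simp add: norm_vec_def L2_set_def unindex_vec_def)
qed

text \<open>Lebesgue measure is determined by boxes; the preimage of a box is a box with the same
  side lengths under renamed coordinates.\<close>

lemma distr_unindex: "distr lborel borel unindex_vec = (lborel :: (real^'d) measure)"
proof (rule lborel_eqI[symmetric])
  have [measurable]: "(unindex_vec :: _ \<Rightarrow> real^'d) \<in> borel_measurable borel"
    by (rule borel_measurable_continuous_onI[OF continuous_on_unindex])
  fix l u :: "real^'d"
  assume lu: "\<And>b. b \<in> Basis \<Longrightarrow> l \<bullet> b \<le> u \<bullet> b"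
  then have lu': "l $ i \<le> u $ i" for i
    using lu[of "axis i 1"] by (simp add: axis_in_Basis_iff inner_axis)
  define v where "v y = (\<chi> i. (y :: real^'d) $ Rep_enumerated i)" for y
  have "unindex_vec -` box l u = box (v l) (v u)"
  proof -
    have "(\<forall>i. l $ i < x $ Abs_enumerated i \<and> x $ Abs_enumerated i < u $ i) \<longleftrightarrow>
      (\<forall>j. l $ Rep_enumerated j < x $ j \<and> x $ j < u $ Rep_enumerated j)" for x :: "real^('d enumerated)"
      by (metis Abs_enumerated_inverse Rep_enumerated_inverse UNIV_I)
    then show ?thesis by (auto simp: mem_box_cart unindex_vec_def v_def)
  qed
  then have "emeasure (distr lborel borel unindex_vec) (box l u) = emeasure lborel (box (v l) (v u))"
    by (subst emeasure_distr) auto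
  also have "\<dots> = ennreal (\<Prod>b\<in>Basis. (v u - v l) \<bullet> b)"
    by (rule emeasure_lborel_box) (auto simp: Basis_vec_def v_def inner_axis lu')
  also have "(\<Prod>b\<in>Basis. (v u - v l) \<bullet> b) = (\<Prod>i\<in>UNIV. (v u - v l) $ i)"
    by (subst prod.reindex_bij_betw[symmetric, of "\<lambda>i. axis i 1" UNIV])
       (auto simp: bij_betw_def inj_on_def axis_eq_axis Basis_vec_def inner_axis)
  also have "\<dots> = (\<Prod>i\<in>UNIV. (u - l) $ Rep_enumerated i)"
    by (simp add: v_def)
  also have "\<dots> = (\<Prod>i\<in>UNIV. (u - l) $ i)"
    by (rule prod.reindex_bij_betw) (use bij_Rep_enumerated in simp)
  also have "\<dots> = (\<Prod>b\<in>Basis. (u - l) \<bullet> b)"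
    by (subst prod.reindex_bij_betw[symmetric, of "\<lambda>i. axis i 1" UNIV Basis])
       (auto simp: bij_betw_def inj_on_def axis_eq_axis Basis_vec_def inner_axis)
  finally show "emeasure (distr lborel borel unindex_vec) (box l u) = ennreal (\<Prod>b\<in>Basis. (u - l) \<bullet> b)" .
qed simp

text \<open>The set is the image of \<open>S\<close> under \<open>mat_powr s E\<close>, whose
  determinant is \<open>s powr trace E\<close>. Boundedness makes the measure finite, so that
  real-valued \<open>measure\<close> may be used.\<close>

lemma measure_mat_powr_preimage:
  fixes S :: "(real^'d) set"
  assumes s: "s > 0" and S: "S \<in> sets borel" "bounded S"
  shows "measure lborel {x. mat_powr (1 / s) E *v x \<in> S} = s powr trace E * measure lborel S"
proof -
  let ?f = "\<lambda>x. mat_powr s (reindex_mat E) *v x"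
  have m1: "(unindex_vec :: _ \<Rightarrow> real^'d) \<in> borel_measurable borel"
    by (rule borel_measurable_continuous_onI[OF continuous_on_unindex])
  have m2: "(\<lambda>x. mat_powr (1 / s) E *v x) \<in> borel_measurable borel"
    by (intro borel_measurable_continuous_onI linear_continuous_on) simp
  have T: "{x. mat_powr (1 / s) E *v x \<in> S} \<in> sets borel"
    using measurable_sets[OF m2 S(1)] by (simp add: vimage_def)
  have vS: "unindex_vec -` S \<in> sets borel"
    using measurable_sets[OF m1 S(1)] by simp
  have bS: "bounded (unindex_vec -` S)"
    using S(2) unfolding bounded_iff by (metis norm_unindex vimageE)
  have im: "?f ` (unindex_vec -` S) = unindex_vec -` {x. mat_powr (1 / s) E *v x \<in> S}"
  proof (intro equalityI subsetI)
    fix y assume "y \<in> ?f ` (unindex_vec -` S)"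
    then obtain x where x: "y = ?f x" "unindex_vec x \<in> S" by auto
    have "mat_powr (1 / s) E *v unindex_vec y = unindex_vec x"
      unfolding x(1) mat_powr_reindex unindex_reindex_app using s by (simp add: mat_powr_app_mult)
    then show "y \<in> unindex_vec -` {x. mat_powr (1 / s) E *v x \<in> S}" using x(2) by simp
  next
    fix y assume y: "y \<in> unindex_vec -` {x. mat_powr (1 / s) E *v x \<in> S}"
    define x where "x = mat_powr (1 / s) (reindex_mat E) *v y"
    have "y = ?f x" using s by (simp add: x_def mat_powr_app_mult)
    moreover have "unindex_vec x \<in> S"
      using y unfolding x_def mat_powr_reindex unindex_reindex_app by simp
    ultimately show "y \<in> ?f ` (unindex_vec -` S)" by auto
  qed
  have ms: "measure lborel X = measure lebesgue (unindex_vec -` X)" if "X \<in> sets borel" for X :: "(real^'d) set"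
  proof -
    have "measure lborel X = measure (distr lborel borel unindex_vec) X"
      by (simp only: distr_unindex)
    also have "\<dots> = measure lborel (unindex_vec -` X)"
      using that m1 by (subst measure_distr) auto
    also have "\<dots> = measure lebesgue (unindex_vec -` X)"
      using measurable_sets[OF m1 that] by simp
    finally show ?thesis .
  qed
  have "measure lborel {x. mat_powr (1 / s) E *v x \<in> S} = measure lebesgue (?f ` (unindex_vec -` S))"
    by (simp only: ms[OF T] im)
  also have "\<dots> = \<bar>det (matrix ?f)\<bar> * measure lebesgue (unindex_vec -` S)"
    by (rule measure_linear_image)
       (use vS bS in \<open>auto intro!: bounded_set_imp_lmeasurable\<close>)
  also have "\<dots> = s powr trace E * measure lborel S"
    unfolding ms[OF S(1)] matrix_of_matrix_vector_mul using s by (simp add: det_mat_powr trace_reindex)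
  finally show ?thesis .
qed

section \<open>Homogeneous functions\<close>

text \<open>The inverse \<open>g\<close> of the polar map makes the \<open>THE\<close> well defined,
  and \<open>mat_powr c E\<close> multiplies the radial coordinate by \<open>c\<close> without
  changing the spherical one.\<close>

lemma polar_radius_props:
  assumes "polar_norm E N" "x \<noteq> 0"
  shows "polar_radius E N x > 0" "c > 0 \<Longrightarrow> polar_radius E N (mat_powr c E *v x) = c * polar_radius E N x"
proof -
  obtain g where g: "homeomorphism ({0<..} \<times> {\<theta>. N \<theta> = 1}) (- {0}) (\<lambda>(s, \<theta>). mat_powr s E *v \<theta>) g"
    using assms by (auto simp: polar_norm_def)
  let ?R = "\<lambda>x s. s > 0 \<and> (\<exists>\<theta>. N \<theta> = 1 \<and> x = mat_powr s E *v \<theta>)"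
  have ex: "\<exists>s. ?R x s" if "x \<noteq> 0" for x
  proof -
    have "g x \<in> g ` (- {0})" using that by simp
    then have "g x \<in> {0<..} \<times> {\<theta>. N \<theta> = 1}" "(\<lambda>(s, \<theta>). mat_powr s E *v \<theta>) (g x) = x"
      using g that unfolding homeomorphism_def by simp_all
    then show ?thesis by (cases "g x") (auto intro!: exI[of _ "fst (g x)"] exI[of _ "snd (g x)"])
  qed
  have un: "s = t" if st: "?R x s" "?R x t" for x s t
  proof -
    obtain \<theta> \<eta> where *: "N \<theta> = 1" "x = mat_powr s E *v \<theta>" "N \<eta> = 1" "x = mat_powr t E *v \<eta>"
      using st by blast
    have inv: "g (mat_powr s E *v \<theta>) = (s, \<theta>)" if "s > 0" "N \<theta> = 1" for s \<theta>
      using g that unfolding homeomorphism_def by auto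
    have "(s, \<theta>) = (t, \<eta>)"
      using inv[of s \<theta>] inv[of t \<eta>] * st by metis
    then show ?thesis by simp
  qed
  have eq: "polar_radius E N x = s" if "x \<noteq> 0" "?R x s" for x s
  proof -
    have "(THE s. ?R x s) = s" by (rule the_equality[of "?R x"]) (use that un in blast)+
    then show ?thesis using that(1) by (simp add: polar_radius_def)
  qed
  obtain s where s: "?R x s" using ex[OF assms(2)] by blast
  then show pos: "polar_radius E N x > 0" using eq[OF assms(2) s] by simp
  show "polar_radius E N (mat_powr c E *v x) = c * polar_radius E N x" if c: "c > 0"
  proof -
    have "mat_powr c E *v x \<noteq> 0"
    proof
      assume "mat_powr c E *v x = 0"
      then have "mat_powr (1 / c) E *v (mat_powr c E *v x) = 0" by simp
      then show False using c assms(2) by (simp add: mat_powr_app_mult)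
    qed
    moreover obtain \<theta> where "N \<theta> = 1" "x = mat_powr s E *v \<theta>" using s by blast
    then have "?R (mat_powr c E *v x) (c * s)"
      using s c by (auto simp: mat_powr_app_mult)
    ultimately have "polar_radius E N (mat_powr c E *v x) = c * s" by (rule eq)
    then show ?thesis using eq[OF assms(2) s] by simp
  qed
qed

locale homogeneous_function =
  fixes E :: "real^'d^'d" and \<phi> :: "real^'d \<Rightarrow> real"
  assumes Q: "E \<in> Q_matrices" and cont: "continuous_on UNIV \<phi>" and hom: "E_homogeneous E \<phi>"
    and pos: "\<And>x. x \<noteq> 0 \<Longrightarrow> \<phi> x > 0"
begin

lemma continuous_on_orbit: "continuous_on {0<..} (\<lambda>c. mat_powr c E *v x)"
  by (rule bounded_linear.continuous_on[OF
      bounded_bilinear.bounded_linear_left[OF bounded_bilinear_matrix_vector_mult] continuous_on_mat_powr])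

lemma orbit_tendsto_0: "((\<lambda>c. mat_powr c E *v x) \<longlongrightarrow> 0) (at_right 0)"
proof -
  have "min_re_eig E > 0" using Q by (simp add: Q_matrices_def)
  from bounded_bilinear.tendsto[OF bounded_bilinear_matrix_vector_mult mat_powr_tendsto_0[OF this] tendsto_const]
  show ?thesis by simp
qed

lemma hom_eq: "c > 0 \<Longrightarrow> x \<noteq> 0 \<Longrightarrow> \<phi> (mat_powr c E *v x) = c * \<phi> x"
  using hom by (simp add: E_homogeneous_def)

text \<open>Homogeneity is postulated only off the origin. Along an orbit shrinking to 0 the values
  \<open>c * \<phi> x\<close> tend to 0, and continuity gives the value there.\<close>

lemma zero [simp]: "\<phi> 0 = 0"
proof -
  define x :: "real^'d" where "x = axis undefined 1"
  have x: "x \<noteq> 0" by (simp add: x_def axis_eq_0_iff)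
  have "((\<lambda>c. \<phi> (mat_powr c E *v x)) \<longlongrightarrow> \<phi> 0) (at_right 0)"
    using continuous_on_tendsto_compose[OF cont orbit_tendsto_0] by simp
  moreover have "((\<lambda>c. \<phi> (mat_powr c E *v x)) \<longlongrightarrow> 0) (at_right 0)"
  proof (rule Lim_transform_eventually)
    show "((\<lambda>c. c * \<phi> x) \<longlongrightarrow> 0) (at_right 0)"
      by (rule tendsto_mult_left_zero[OF tendsto_ident_at])
    show "eventually (\<lambda>c. c * \<phi> x = \<phi> (mat_powr c E *v x)) (at_right 0)"
      using x by (intro eventually_at_rightI[of 0 1]) (auto simp: hom_eq)
  qed
  ultimately show ?thesis by (intro tendsto_unique[of "at_right 0"]) auto
qed

lemma hom_eq': "c > 0 \<Longrightarrow> \<phi> (mat_powr c E *v x) = c * \<phi> x"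
  by (cases "x = 0") (simp_all add: hom_eq)

lemma nonneg: "\<phi> x \<ge> 0"
  using pos[of x] by (cases "x = 0") auto

lemma borel [measurable]: "\<phi> \<in> borel_measurable borel"
  by (rule borel_measurable_continuous_onI[OF cont])

lemma inverse_orbit: "c > 0 \<Longrightarrow> mat_powr c E *v (mat_powr (1 / c) E *v x) = x"
  by (simp add: mat_powr_app_mult)

lemma norm_mat_powr_bounded:
  assumes "S > 0"
  shows "\<exists>K>0. \<forall>s. 0 < s \<longrightarrow> s \<le> S \<longrightarrow> norm (mat_powr s E) \<le> K"
proof -
  have "0 < min_re_eig E" using Q by (simp add: Q_matrices_def)
  then obtain K1 where K1: "K1 > 0" "\<And>s. 0 < s \<Longrightarrow> s \<le> 1 \<Longrightarrow> norm (mat_powr s E) \<le> K1 * s powr 0"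
    using mat_powr_bound_le_1 by blast
  obtain K2 where K2: "K2 > 0" "\<And>s. 1 \<le> s \<Longrightarrow> s \<le> S \<Longrightarrow> norm (mat_powr s E) \<le> K2"
    using bounded_mat_powr_interval[of 1 S E] by auto
  have "norm (mat_powr s E) \<le> max K1 K2" if "0 < s" "s \<le> S" for s
    using K1(2)[of s] K2(2)[of s] that by (cases "s \<le> 1") auto
  then show ?thesis using K1(1) by (intro exI[of _ "max K1 K2"]) auto
qed

text \<open>Intermediate value argument on the orbit: the norm tends to 0 as \<open>c\<close> does,
  and it reaches at least 1 at \<open>1 / c\<close> once
  \<open>norm (mat_powr c E) < norm x\<close>, because \<open>mat_powr c E\<close> maps that point
  back to \<open>x\<close>.\<close>

lemma exists_unit_orbit:
  assumes x: "x \<noteq> 0"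
  shows "\<exists>c>0. norm (mat_powr c E *v x) = 1"
proof -
  let ?h = "\<lambda>c. norm (mat_powr c E *v x)"
  have conn: "connected (?h ` {0<..})"
    by (intro connected_continuous_image continuous_on_norm continuous_on_orbit) simp
  have "min_re_eig E > 0" using Q by (simp add: Q_matrices_def)
  note lim0 = tendsto_norm_zero[OF mat_powr_tendsto_0[OF this]]
  have "eventually (\<lambda>c. norm (mat_powr c E) < norm x \<and> 0 < c) (at_right 0)"
    using order_tendstoD(2)[OF lim0, of "norm x"] x eventually_at_right_less
    by (intro eventually_conj) auto
  then obtain c where c: "norm (mat_powr c E) < norm x" "0 < c"
    using eventually_happens[of _ "at_right (0::real)"] by auto
  have "norm x \<le> norm (mat_powr c E) * norm (mat_powr (1 / c) E *v x)"
    using norm_matrix_vector_mult_le[of "mat_powr c E" "mat_powr (1 / c) E *v x"] inverse_orbit[OF c(2), of x] by simp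
  have big: "1 \<le> ?h (1 / c)"
  proof (rule ccontr)
    assume "\<not> ?thesis"
    then have "norm (mat_powr c E) * norm (mat_powr (1 / c) E *v x) \<le> norm (mat_powr c E) * 1"
      by (intro mult_left_mono) auto
    with \<open>norm x \<le> _\<close> c(1) show False by simp
  qed
  have "eventually (\<lambda>c. ?h c < 1 \<and> 0 < c) (at_right 0)"
    using order_tendstoD(2)[OF tendsto_norm_zero[OF orbit_tendsto_0], of 1 x] eventually_at_right_less
    by (intro eventually_conj) auto
  then obtain b where b: "?h b < 1" "0 < b"
    using eventually_happens[of _ "at_right (0::real)"] by auto
  have "?h b \<in> ?h ` {0<..}" "?h (1 / c) \<in> ?h ` {0<..}"
    using b c by auto
  then have "1 \<in> ?h ` {0<..}"
    using conn big b(1) unfolding connected_iff_interval by (meson less_imp_le)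
  then show ?thesis by auto
qed

text \<open>Let \<open>m > 0\<close> be the minimum of \<open>\<phi>\<close> on the unit sphere. A
  nonzero \<open>x\<close> with \<open>\<phi> x \<le> r\<close> is a unit vector moved by
  \<open>mat_powr (1 / c) E\<close>, and homogeneity gives
  \<open>1 / c \<le> \<bar>r\<bar> / m\<close>, a range where these matrices are bounded.\<close>

lemma bounded_sublevel: "bounded {x. \<phi> x \<le> r}"
proof -
  have "compact (\<phi> ` sphere 0 1)"
    by (intro compact_continuous_image continuous_on_subset[OF cont]) auto
  moreover have "\<phi> ` sphere 0 1 \<noteq> {}" by simp
  ultimately obtain m where m: "m \<in> \<phi> ` sphere 0 1" "\<And>x. x \<in> \<phi> ` sphere 0 1 \<Longrightarrow> m \<le> x"
    by (meson compact_attains_inf)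
  obtain z where "norm z = 1" "m = \<phi> z" using m(1) by auto
  then have m0: "m > 0" using pos[of z] by force
  define S where "S = \<bar>r\<bar> / m + 1"
  have "S > 0" unfolding S_def using m0 by (intro add_nonneg_pos) auto
  then obtain K where K: "K > 0" "\<And>s. 0 < s \<Longrightarrow> s \<le> S \<Longrightarrow> norm (mat_powr s E) \<le> K"
    using norm_mat_powr_bounded by blast
  have "norm x \<le> K" if "\<phi> x \<le> r" for x
  proof (cases "x = 0")
    case False
    then obtain c where c: "c > 0" "norm (mat_powr c E *v x) = 1"
      using exists_unit_orbit by blast
    have "\<phi> (mat_powr c E *v x) \<in> \<phi> ` sphere 0 1"
      using c(2) by (intro imageI) simp
    from m(2)[OF this] have "m \<le> c * \<phi> x" using c(1) by (simp add: hom_eq')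
    also have "\<dots> \<le> c * r" using that c by simp
    finally have "m \<le> c * \<bar>r\<bar>" using c(1) by (meson abs_ge_self mult_left_mono order_trans less_imp_le)
    then have "1 / c \<le> \<bar>r\<bar> / m" using c(1) m0 by (simp add: field_simps)
    then have "1 / c \<le> S" unfolding S_def by linarith
    then have "norm (mat_powr (1 / c) E) \<le> K" using c by (intro K(2)) auto
    moreover have "norm x \<le> norm (mat_powr (1 / c) E) * norm (mat_powr c E *v x)"
      using norm_matrix_vector_mult_le[of "mat_powr (1 / c) E" "mat_powr c E *v x"] inverse_orbit[of "1 / c" x] c by simp
    ultimately show ?thesis using c by simp
  qed (use K in simp)
  then show ?thesis by (auto simp: bounded_iff)
qed

section \<open>Integrals of powers of \<open>\<phi>\<close> over annuli\<close>

definition annulus :: "real \<Rightarrow> (real^'d) set" where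
  "annulus r = {x. r \<le> \<phi> x \<and> \<phi> x < 2 * r}"

lemma annulus_borel [measurable]: "annulus r \<in> sets borel"
  unfolding annulus_def by measurable

lemma bounded_annulus: "bounded (annulus r)"
  by (rule bounded_subset[OF bounded_sublevel[of "2 * r"]]) (auto simp: annulus_def)

lemma emeasure_annulus:
  assumes "r > 0"
  shows "emeasure lborel (annulus r) = ennreal (r powr trace E * measure lborel (annulus 1))"
proof -
  have "annulus r = {x. mat_powr (1 / r) E *v x \<in> annulus 1}"
    using assms by (auto simp: annulus_def hom_eq' field_simps)
  then have "measure lborel (annulus r) = r powr trace E * measure lborel (annulus 1)"
    using measure_mat_powr_preimage[OF assms, of "annulus 1" E] bounded_annulus[of 1] by simp
  moreover have "emeasure lborel (annulus r) < \<infinity>"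
    by (rule emeasure_bounded_finite[OF bounded_annulus])
  ultimately show ?thesis by (simp add: emeasure_eq_ennreal_measure less_top[symmetric])
qed

text \<open>Both ends are covered at once: \<open>b = 2\<close> runs to infinity,
  \<open>b = 1/2\<close> to the origin. As \<open>\<gamma> \<le> 0\<close>, the power is largest at
  the inner edge, and the contributions form a geometric series with ratio
  \<open>b powr (\<gamma> + trace E)\<close>.\<close>

lemma integrable_annuli:
  assumes \<gamma>: "\<gamma> \<le> 0" and R: "R > 0" and b: "b > 0" "b powr (\<gamma> + trace E) < 1"
  shows "integrable lborel (\<lambda>x. indicator (\<Union>n. annulus (R * b ^ n)) x * \<phi> x powr \<gamma>)"
proof (rule integrableI_bounded)
  let ?r = "\<lambda>n. R * b ^ n"
  define V where "V = measure lborel (annulus 1)"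
  have r: "?r n > 0" for n using R b by simp
  have "(\<integral>\<^sup>+x. ennreal (norm (indicator (\<Union>n. annulus (?r n)) x * \<phi> x powr \<gamma>)) \<partial>lborel)
    \<le> (\<integral>\<^sup>+x. (\<Sum>n. ennreal (?r n powr \<gamma>) * indicator (annulus (?r n)) x) \<partial>lborel)"
  proof (intro nn_integral_mono)
    fix x
    show "ennreal (norm (indicator (\<Union>n. annulus (?r n)) x * \<phi> x powr \<gamma>))
       \<le> (\<Sum>n. ennreal (?r n powr \<gamma>) * indicator (annulus (?r n)) x)"
    proof (cases "x \<in> (\<Union>n. annulus (?r n))")
      case True
      then obtain n where n: "x \<in> annulus (?r n)" by blast
      then have "\<phi> x powr \<gamma> \<le> ?r n powr \<gamma>"
        using \<gamma> r[of n] by (intro powr_mono2') (auto simp: annulus_def)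
      then have "ennreal (norm (indicator (\<Union>n. annulus (?r n)) x * \<phi> x powr \<gamma>))
          \<le> ennreal (?r n powr \<gamma>) * indicator (annulus (?r n)) x"
        using True n by (simp add: ennreal_leI)
      also have "\<dots> = (\<Sum>k\<in>{n}. ennreal (?r k powr \<gamma>) * indicator (annulus (?r k)) x)"
        by (simp only: sum.insert finite.emptyI empty_iff not_False_eq_True sum.empty add_0_right)
      also have "\<dots> \<le> (\<Sum>n. ennreal (?r n powr \<gamma>) * indicator (annulus (?r n)) x)"
        by (intro sum_le_suminf) auto
      finally show ?thesis .
    qed simp
  qed
  also have "\<dots> = (\<Sum>n. \<integral>\<^sup>+x. ennreal (?r n powr \<gamma>) * indicator (annulus (?r n)) x \<partial>lborel)"
    by (intro nn_integral_suminf) simp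
  also have "\<dots> = (\<Sum>n. ennreal ((R powr (\<gamma> + trace E) * V) * (b powr (\<gamma> + trace E)) ^ n))"
  proof (intro suminf_cong)
    fix n
    have "(\<integral>\<^sup>+x. ennreal (?r n powr \<gamma>) * indicator (annulus (?r n)) x \<partial>lborel)
      = ennreal (?r n powr \<gamma>) * emeasure lborel (annulus (?r n))"
      by (rule nn_integral_cmult_indicator) simp
    also have "\<dots> = ennreal (?r n powr \<gamma> * (?r n powr trace E * V))"
      by (simp add: emeasure_annulus[OF r] V_def ennreal_mult)
    also have "?r n powr \<gamma> * (?r n powr trace E * V) = ?r n powr (\<gamma> + trace E) * V"
      by (simp add: powr_add)
    also have "?r n powr (\<gamma> + trace E) = R powr (\<gamma> + trace E) * (b powr (\<gamma> + trace E)) ^ n"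
    proof -
      have "(b ^ n) powr c = (b powr c) ^ n" for c
        using b by (simp add: powr_powr powr_realpow[symmetric] mult.commute)
      then show ?thesis using R b by (simp add: powr_mult)
    qed
    finally show "(\<integral>\<^sup>+x. ennreal (?r n powr \<gamma>) * indicator (annulus (?r n)) x \<partial>lborel)
      = ennreal ((R powr (\<gamma> + trace E) * V) * (b powr (\<gamma> + trace E)) ^ n)"
      by (simp add: algebra_simps)
  qed
  also have "\<dots> = ennreal (\<Sum>n. (R powr (\<gamma> + trace E) * V) * (b powr (\<gamma> + trace E)) ^ n)"
    using b by (intro suminf_ennreal2) (auto simp: V_def intro!: summable_mult summable_geometric)
  also have "\<dots> < \<infinity>" by simp
  finally show "(\<integral>\<^sup>+x. ennreal (norm (indicator (\<Union>n. annulus (?r n)) x * \<phi> x powr \<gamma>)) \<partial>lborel) < \<infinity>" .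
qed measurable

lemma integrable_far:
  assumes \<gamma>: "\<gamma> \<le> 0" "\<gamma> + trace E < 0" and R: "R > 0"
  shows "integrable lborel (\<lambda>x. indicator {x. \<phi> x \<ge> R} x * \<phi> x powr \<gamma>)"
proof (rule Bochner_Integration.integrable_bound)
  have "(2::real) powr (\<gamma> + trace E) < 2 powr 0" using \<gamma> by (intro powr_less_mono) auto
  then show "integrable lborel (\<lambda>x. indicator (\<Union>n. annulus (R * 2 ^ n)) x * \<phi> x powr \<gamma>)"
    by (intro integrable_annuli \<gamma> R) auto
  have "x \<in> (\<Union>n. annulus (R * 2 ^ n))" if x: "R \<le> \<phi> x" for x
  proof -
    let ?P = "\<lambda>n::nat. \<phi> x < R * 2 ^ Suc n"
    obtain k where "\<phi> x / R < 2 ^ k" using real_arch_pow[of 2 "\<phi> x / R"] by auto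
    then have "\<phi> x < R * 2 ^ k" using R by (simp add: field_simps)
    also have "\<dots> \<le> R * 2 ^ Suc k" using R by simp
    finally have k: "?P k" .
    \<comment> \<open>The upper bound holds at the least index; its failure one index earlier is the
      lower bound.\<close>
    define n where "n = (LEAST n. ?P n)"
    have n: "?P n" unfolding n_def by (rule LeastI[of ?P, OF k])
    have "R * 2 ^ n \<le> \<phi> x"
    proof (cases n)
      case (Suc m)
      then have "m < (LEAST n. ?P n)" using n_def by linarith
      then have "\<not> ?P m" by (rule not_less_Least)
      then show ?thesis using Suc by simp
    qed (use x in simp)
    then show ?thesis using n by (auto simp: annulus_def intro!: exI[of _ n])
  qed
  then show "AE x in lborel. norm (indicator {x. \<phi> x \<ge> R} x * \<phi> x powr \<gamma>)
      \<le> norm (indicator (\<Union>n. annulus (R * 2 ^ n)) x * \<phi> x powr \<gamma>)"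
    by (intro AE_I2) (auto simp: indicator_def)
qed measurable

text \<open>The radii start at \<open>R / 2\<close>, so the outermost annulus ends at
  \<open>R\<close>. The origin lies in no annulus, but there the integrand is 0 because
  \<open>0 powr \<gamma> = 0\<close>.\<close>

lemma integrable_near:
  assumes \<gamma>: "\<gamma> \<le> 0" "\<gamma> + trace E > 0" and R: "R > 0"
  shows "integrable lborel (\<lambda>x. indicator {x. \<phi> x < R} x * \<phi> x powr \<gamma>)"
proof (rule Bochner_Integration.integrable_bound)
  have "(1/2::real) powr (\<gamma> + trace E) < (1/2) powr 0" using \<gamma> by (intro powr_less_mono') auto
  then show "integrable lborel (\<lambda>x. indicator (\<Union>n. annulus (R / 2 * (1/2) ^ n)) x * \<phi> x powr \<gamma>)"
    using R by (intro integrable_annuli \<gamma>) auto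
  have "x \<in> (\<Union>n. annulus (R / 2 * (1/2) ^ n))" if x: "\<phi> x < R" "x \<noteq> 0" for x
  proof -
    let ?P = "\<lambda>n::nat. R / 2 * (1/2) ^ n \<le> \<phi> x"
    have "\<phi> x / R > 0" using pos[OF x(2)] R by simp
    then obtain k where "(1/2) ^ k < \<phi> x / R" using real_arch_pow_inv[of "\<phi> x / R" "1/2"] by auto
    then have "R * (1/2) ^ k < \<phi> x" using R by (simp add: field_simps)
    moreover have "R / 2 * (1/2) ^ k \<le> R * (1/2) ^ k" using R by (intro mult_right_mono) auto
    ultimately have k: "?P k" by linarith
    define n where "n = (LEAST n. ?P n)"
    have n: "?P n" unfolding n_def by (rule LeastI[of ?P, OF k])
    have "\<phi> x < 2 * (R / 2 * (1/2) ^ n)"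
    proof (cases n)
      case (Suc m)
      then have "m < (LEAST n. ?P n)" using n_def by linarith
      then have "\<not> ?P m" by (rule not_less_Least)
      then show ?thesis using Suc by simp
    qed (use x in simp)
    then show ?thesis using n by (auto simp: annulus_def intro!: exI[of _ n])
  qed
  then show "AE x in lborel. norm (indicator {x. \<phi> x < R} x * \<phi> x powr \<gamma>)
      \<le> norm (indicator (\<Union>n. annulus (R / 2 * (1/2) ^ n)) x * \<phi> x powr \<gamma>)"
    by (intro AE_I2) (auto simp: indicator_def, metis zero)
qed measurable

end

section \<open>Increments of matrix powers of a homogeneous function\<close>

text \<open>Beyond 1 the norm is bounded while \<open>s powr \<delta>\<close> stays above
  \<open>R powr \<delta>\<close>, so enlarging the constant suffices. At \<open>s = 0\<close> both
  sides are 0 by the conventions for powers.\<close>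

lemma mat_powr_bound_le:
  assumes "\<delta> < min_re_eig A" "\<delta> \<le> 0" "R > 0"
  shows "\<exists>K>0. \<forall>s. 0 \<le> s \<longrightarrow> s \<le> R \<longrightarrow> norm (mat_powr s A) \<le> K * s powr \<delta>"
proof -
  obtain K1 where K1: "K1 > 0" "\<And>s. 0 < s \<Longrightarrow> s \<le> 1 \<Longrightarrow> norm (mat_powr s A) \<le> K1 * s powr \<delta>"
    using mat_powr_bound_le_1[OF assms(1)] by blast
  obtain K2 where K2: "K2 > 0" "\<And>s. 1 \<le> s \<Longrightarrow> s \<le> R \<Longrightarrow> norm (mat_powr s A) \<le> K2"
    using bounded_mat_powr_interval[of 1 R A] by auto
  define K where "K = max K1 (K2 / R powr \<delta>)"
  have K0: "K > 0" using K1(1) by (simp add: K_def)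
  have "norm (mat_powr s A) \<le> K * s powr \<delta>" if s: "0 \<le> s" "s \<le> R" for s
  proof -
    consider "s = 0" | "0 < s" "s \<le> 1" | "1 \<le> s" using s by linarith
    then show ?thesis
    proof cases
      case 2
      have "K1 * s powr \<delta> \<le> K * s powr \<delta>"
        by (intro mult_right_mono) (simp_all add: K_def)
      then show ?thesis using K1(2)[OF 2] by linarith
    next
      case 3
      have "R powr \<delta> \<le> s powr \<delta>" using assms s 3 by (intro powr_mono2') auto
      then have "K2 / R powr \<delta> * R powr \<delta> \<le> K * s powr \<delta>"
        using K0 by (intro mult_mono) (auto simp: K_def)
      then show ?thesis using K2(2)[OF 3 s(2)] assms(3) by simp
    qed simp
  qed
  then show ?thesis using K0 by blast
qed

context homogeneous_function
begin

text \<open>Rescaling by \<open>1 / r\<close> with \<open>r = \<phi> x\<close> moves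
  \<open>x\<close> to \<open>y\<close> on the level \<open>\<phi> y = 1\<close>, confined to a fixed
  range of norms, and shrinks \<open>t\<close> to polar radius \<open>\<tau> / r\<close>.
  Admissibility gives \<open>v = \<phi> (t' + y)\<close> within order
  \<open>r powr (- \<beta>)\<close> of 1, and the increment factors as
  \<open>mat_powr r H ** (mat_powr v H - mat 1)\<close>.\<close>

lemma increment_far:
  fixes H :: "real^'m^'m"
  assumes N: "polar_norm E N" and adm: "admissible \<beta> E N \<phi>" and \<beta>: "\<beta> > 0" and a: "max_re_eig H < a"
  shows "\<exists>R>0. \<exists>K>0. \<forall>x. \<phi> x \<ge> R \<longrightarrow>
    norm (mat_powr (\<phi> (t + x)) H - mat_powr (\<phi> x) H) \<le> K * \<phi> x powr (a - \<beta>)"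
proof -
  obtain K1 where K1: "K1 > 0" "\<And>s. 1 \<le> s \<Longrightarrow> norm (mat_powr s H) \<le> K1 * s powr a"
    using mat_powr_bound_ge_1[OF a] by blast
  obtain L where L: "L > 0" "\<And>s. 1 / 2 \<le> s \<Longrightarrow> s \<le> 2 \<Longrightarrow> norm (mat_powr s H - mat 1) \<le> L * \<bar>s - 1\<bar>"
    using mat_powr_Lipschitz_near_1 by blast
  obtain b where b: "\<And>y. \<phi> y \<le> 1 \<Longrightarrow> norm y \<le> b"
    using bounded_sublevel[of 1] by (auto simp: bounded_iff)
  obtain d where d: "d > 0" "\<And>y. norm y < d \<Longrightarrow> \<phi> y < 1"
  proof -
    have "isCont \<phi> 0" using cont by (simp add: continuous_on_eq_continuous_at)
    then obtain d where "d > 0" "\<forall>y. dist y 0 < d \<longrightarrow> dist (\<phi> y) (\<phi> 0) < 1"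
      unfolding continuous_at_eps_delta by (metis zero_less_one)
    then have "\<phi> y < 1" if "norm y < d" for y
      using that abs_ge_self[of "\<phi> y"] by (fastforce simp: dist_real_def)
    then show ?thesis using that \<open>d > 0\<close> by blast
  qed
  define b' where "b' = \<bar>b\<bar> + d + 1"
  obtain C where C: "C > 0" "\<And>z x. d \<le> norm z \<Longrightarrow> norm z \<le> b' \<Longrightarrow> polar_radius E N x \<le> 1 \<Longrightarrow>
      \<bar>\<phi> (x + z) - \<phi> z\<bar> \<le> C * polar_radius E N x powr \<beta>"
  proof -
    have "d < b'" using d by (simp add: b'_def)
    then show ?thesis using adm d(1) that unfolding admissible_def by blast
  qed
  define \<tau> where "\<tau> = polar_radius E N t"
  have \<tau>0: "\<tau> \<ge> 0"
    using polar_radius_props(1)[OF N, of t] by (cases "t = 0") (auto simp: \<tau>_def polar_radius_def)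
  \<comment> \<open>The three terms secure, in order, the growth bound for
    \<open>mat_powr r H\<close>, the requirement \<open>\<tau> / r \<le> 1\<close> of admissibility,
    and \<open>\<bar>v - 1\<bar> \<le> 1 / 2\<close>.\<close>
  define R where "R = max 1 (max \<tau> ((2 * C * \<tau> powr \<beta>) powr (1 / \<beta>)))"
  define K where "K = K1 * L * C * \<tau> powr \<beta> + 1"
  have "norm (mat_powr (\<phi> (t + x)) H - mat_powr (\<phi> x) H) \<le> K * \<phi> x powr (a - \<beta>)" if x: "\<phi> x \<ge> R" for x
  proof -
    define r where "r = \<phi> x"
    have r: "r \<ge> 1" "r \<ge> \<tau>" "r \<ge> (2 * C * \<tau> powr \<beta>) powr (1 / \<beta>)"
      using x by (auto simp: r_def R_def)
    define y where "y = mat_powr (1 / r) E *v x"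
    define t' where "t' = mat_powr (1 / r) E *v t"
    have y1: "\<phi> y = 1" using r by (simp add: y_def hom_eq' flip: r_def)
    have \<tau>': "polar_radius E N t' = \<tau> / r"
    proof (cases "t = 0")
      case False
      then show ?thesis using polar_radius_props(2)[OF N False, of "1 / r"] r by (simp add: t'_def \<tau>_def)
    qed (simp add: t'_def \<tau>_def polar_radius_def)
    define v where "v = \<phi> (t' + y)"
    have "\<bar>v - 1\<bar> \<le> C * (\<tau> / r) powr \<beta>"
      unfolding v_def y1[symmetric] \<tau>'[symmetric]
    proof (rule C(2))
      show "d \<le> norm y" using d(2)[of y] y1 by (cases "norm y < d") auto
      show "norm y \<le> b'" using b[of y] y1 d(1) by (simp add: b'_def)
      show "polar_radius E N t' \<le> 1" using \<tau>' r by simp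
    qed
    also have "\<dots> = C * \<tau> powr \<beta> * r powr (- \<beta>)"
      using \<tau>0 r by (simp add: powr_divide powr_minus field_simps)
    finally have v: "\<bar>v - 1\<bar> \<le> C * \<tau> powr \<beta> * r powr (- \<beta>)" .
    have "2 * C * \<tau> powr \<beta> = ((2 * C * \<tau> powr \<beta>) powr (1 / \<beta>)) powr \<beta>"
      using C(1) \<beta> by (simp add: powr_powr)
    also have "\<dots> \<le> r powr \<beta>" using r \<beta> by (intro powr_mono2) auto
    finally have "C * \<tau> powr \<beta> * r powr (- \<beta>) \<le> 1 / 2"
      using r by (simp add: powr_minus field_simps)
    with v have v2: "1 / 2 \<le> v" "v \<le> 2" by linarith+
    have "t + x = mat_powr r E *v (t' + y)"
      using r unfolding matrix_vector_right_distrib by (simp add: t'_def y_def inverse_orbit)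
    then have "\<phi> (t + x) = r * v" using r by (simp add: v_def hom_eq')
    then have "mat_powr (\<phi> (t + x)) H - mat_powr (\<phi> x) H = mat_powr r H ** (mat_powr v H - mat 1)"
      using r v2 by (simp add: mat_powr_mult bounded_bilinear.diff_right[OF bounded_bilinear_matrix_mult] flip: r_def)
    then have "norm (mat_powr (\<phi> (t + x)) H - mat_powr (\<phi> x) H) \<le> norm (mat_powr r H) * norm (mat_powr v H - mat 1)"
      by (simp add: norm_matrix_mult_le)
    also have "\<dots> \<le> (K1 * r powr a) * (L * (C * \<tau> powr \<beta> * r powr (- \<beta>)))"
    proof (intro mult_mono K1(2) r)
      show "norm (mat_powr v H - mat 1) \<le> L * (C * \<tau> powr \<beta> * r powr (- \<beta>))"
        using L(1) v by (intro order_trans[OF L(2)[OF v2]] mult_left_mono) auto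
    qed (use K1 L C in auto)
    also have "\<dots> = (K1 * L * C * \<tau> powr \<beta>) * r powr (a - \<beta>)"
      by (simp add: powr_diff powr_minus field_simps)
    also have "\<dots> \<le> K * r powr (a - \<beta>)" unfolding K_def by (intro mult_right_mono) auto
    finally show ?thesis by (simp add: r_def)
  qed
  moreover have "R > 0" by (simp add: R_def)
  moreover have "K > 0" using K1 L C by (simp add: K_def add_nonneg_pos)
  ultimately show ?thesis by blast
qed

lemma integrable_lborel_shift:
  fixes f :: "real^'d \<Rightarrow> real"
  assumes "integrable lborel f"
  shows "integrable lborel (\<lambda>x. f (t + x))"
proof -
  have "f \<in> borel_measurable borel" using borel_measurable_integrable[OF assms] by simp
  moreover have "integrable (distr lborel borel ((+) t)) f" using assms by (simp add: lborel_distr_plus)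
  ultimately show ?thesis by (subst (asm) integrable_distr_eq) auto
qed

text \<open>Cancellation in the increment is used only for \<open>\<phi> x \<ge> R\<close>.
  Elsewhere the two powers are bounded separately; their singularities at \<open>- t\<close> and at
  the origin are translates of one another, so one integrable function \<open>near\<close> serves
  both.\<close>

lemma integrable_increment:
  fixes H :: "real^'m^'m"
  assumes N: "polar_norm E N" and adm: "admissible \<beta> E N \<phi>" and \<beta>: "\<beta> > 0" and a: "max_re_eig H < a" "a < \<beta>"
    and \<delta>: "\<delta> < min_re_eig H" "\<delta> \<le> 0"
    and p: "p > 0" "(a - \<beta>) * p + trace E < 0" "\<delta> * p + trace E > 0"
  shows "integrable lborel (\<lambda>x. norm (mat_powr (\<phi> (t + x)) H - mat_powr (\<phi> x) H) powr p)"
proof -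
  obtain R K where R: "R > 0" and K: "K > 0" "\<And>x. \<phi> x \<ge> R \<Longrightarrow>
      norm (mat_powr (\<phi> (t + x)) H - mat_powr (\<phi> x) H) \<le> K * \<phi> x powr (a - \<beta>)"
    using increment_far[OF N adm \<beta> a(1), of t] by blast
  have "compact (\<phi> ` ((+) t ` closure {x. \<phi> x \<le> R}))"
    by (rule compact_continuous_image[OF continuous_on_subset[OF cont subset_UNIV] compact_translation])
       (simp add: bounded_sublevel)
  then have "bounded (\<phi> ` ((+) t ` closure {x. \<phi> x \<le> R}))" by (rule compact_imp_bounded)
  then obtain R' where R': "R' > 0" "\<And>y. y \<in> \<phi> ` ((+) t ` closure {x. \<phi> x \<le> R}) \<Longrightarrow> norm y \<le> R'"
    unfolding bounded_pos by blast
  \<comment> \<open>A common bound for \<open>\<phi> x\<close> and \<open>\<phi> (t + x)\<close>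
    while \<open>\<phi> x < R\<close>; the second is bounded by compactness of the translated
    sublevel set.\<close>
  define S where "S = max R R' + 1"
  have S: "S > 0" "R \<le> S" using R by (auto simp: S_def)
  have tS: "\<phi> (t + x) < S" if "\<phi> x < R" for x
  proof -
    have "x \<in> closure {x. \<phi> x \<le> R}" using that by (intro subsetD[OF closure_subset]) simp
    then have "norm (\<phi> (t + x)) \<le> R'" by (intro R'(2)) auto
    then show ?thesis using nonneg[of "t + x"] by (simp add: S_def)
  qed
  obtain L where L: "L > 0" "\<And>s. 0 \<le> s \<Longrightarrow> s \<le> S \<Longrightarrow> norm (mat_powr s H) \<le> L * s powr \<delta>"
    using mat_powr_bound_le[OF \<delta> S(1)] by blast
  let ?f = "\<lambda>x. mat_powr (\<phi> (t + x)) H - mat_powr (\<phi> x) H"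
  define near where "near x = indicator {x. \<phi> x < S} x * \<phi> x powr (\<delta> * p)" for x
  define w where "w x = K powr p * (indicator {x. \<phi> x \<ge> R} x * \<phi> x powr ((a - \<beta>) * p))
      + (2 * L) powr p * (near (t + x) + near x)" for x
  have near_int: "integrable lborel near"
    unfolding near_def using \<delta> p S by (intro integrable_near) (auto simp: mult_nonpos_nonneg)
  have near0: "near x \<ge> 0" for x by (simp add: near_def)
  have bound: "norm (?f x) powr p \<le> w x" for x
  proof (cases "\<phi> x \<ge> R")
    case True
    have "norm (?f x) powr p \<le> (K * \<phi> x powr (a - \<beta>)) powr p"
      using K(2)[OF True] p by (intro powr_mono2) auto
    also have "\<dots> = K powr p * \<phi> x powr ((a - \<beta>) * p)"
      using K(1) by (simp add: powr_mult powr_powr)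
    also have "\<dots> \<le> w x" using True near0 by (simp add: w_def)
    finally show ?thesis .
  next
    case False
    then have x: "\<phi> x < S" "\<phi> (t + x) < S" using tS[of x] S(2) by auto
    define y z where "y = \<phi> (t + x) powr \<delta>" and "z = \<phi> x powr \<delta>"
    have yz: "y \<ge> 0" "z \<ge> 0" by (auto simp: y_def z_def)
    have "norm (?f x) \<le> norm (mat_powr (\<phi> (t + x)) H) + norm (mat_powr (\<phi> x) H)"
      by (rule norm_triangle_ineq4)
    also have "\<dots> \<le> L * y + L * z"
      unfolding y_def z_def using x nonneg by (intro add_mono L(2)) (auto intro: less_imp_le)
    also have "\<dots> \<le> 2 * L * max y z"
    proof -
      have "L * y \<le> L * max y z" "L * z \<le> L * max y z" using L(1) by (auto intro!: mult_left_mono)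
      then show ?thesis by linarith
    qed
    finally have "norm (?f x) powr p \<le> (2 * L * max y z) powr p"
      using p by (intro powr_mono2) auto
    also have "\<dots> = (2 * L) powr p * (max y z) powr p"
      using L(1) yz by (simp add: powr_mult)
    also have "\<dots> \<le> (2 * L) powr p * (y powr p + z powr p)"
      by (intro mult_left_mono) (auto simp: max_def)
    also have "\<dots> \<le> w x"
      using x False by (simp add: w_def near_def y_def z_def powr_powr)
    finally show ?thesis .
  qed
  show ?thesis
  proof (rule Bochner_Integration.integrable_bound)
    have "(a - \<beta>) * p \<le> 0" using a p by (intro mult_nonpos_nonneg) auto
    then have "integrable lborel (\<lambda>x. indicator {x. \<phi> x \<ge> R} x * \<phi> x powr ((a - \<beta>) * p))"
      by (rule integrable_far[OF _ p(2) R])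
    then show "integrable lborel w"
      unfolding w_def using near_int integrable_lborel_shift[OF near_int, of t]
      by (intro Bochner_Integration.integrable_add integrable_mult_right)
    show "AE x in lborel. norm (norm (?f x) powr p) \<le> norm (w x)"
      by (intro AE_I2) (simp add: order_trans[OF bound abs_ge_self])
    show "(\<lambda>x. norm (?f x) powr p) \<in> borel_measurable lborel"
      by measurable
  qed
qed

end

lemma integrable_lborel_uminus:
  fixes f :: "'a::euclidean_space \<Rightarrow> real"
  assumes "integrable lborel f"
  shows "integrable lborel (\<lambda>x. f (- x))"
proof -
  have "distr lborel borel uminus = (lborel :: 'a measure)"
    using lborel_affine[of "- 1" "0 :: 'a"] by (simp add: density_1)
  then have "integrable (distr lborel borel uminus) f" using assms by simp
  moreover have "f \<in> borel_measurable borel" using borel_measurable_integrable[OF assms] by simp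
  ultimately show ?thesis by (subst (asm) integrable_distr_eq) auto
qed

section \<open>Existence of the moving average integral\<close>

theorem theorem4p2:
  fixes \<mu> :: "(real^'m) measure"
    and B D :: "real^'m^'m"
    and E :: "real^'d^'d"
    and normE :: "real^'d \<Rightarrow> real"
    and P :: "'w measure"
    and M :: "(real^'d) set \<Rightarrow> 'w \<Rightarrow> real^'m"
    and \<phi> :: "real^'d \<Rightarrow> real"
    and \<beta> q :: real
  assumes "full_distribution \<mu>"
    and "strictly_operator_stable \<mu> B"
    and "indep_scattered_random_measure P M \<mu> lborel"
    and "D \<in> Q_matrices"
    and "E \<in> Q_matrices"
    and "q = trace E"
    and "polar_norm E normE"
    and "continuous_on UNIV \<phi>"
    and "E_homogeneous E \<phi>"
    and "\<beta> > 0"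
    and "admissible \<beta> E normE \<phi>"
    and "min_re_eig (D - q *\<^sub>R B) + min_re_eig (q *\<^sub>R B) > 0"
    and "max_re_eig (D - q *\<^sub>R B) + max_re_eig (q *\<^sub>R B) < \<beta>"
  shows "\<forall>t. stoch_integrable P M lborel
           (\<lambda>s. mat_powr (\<phi> (t - s)) (D - q *\<^sub>R B) - mat_powr (\<phi> (- s)) (D - q *\<^sub>R B))"
proof
  fix t :: "real^'d"
  let ?H = "D - q *\<^sub>R B"
  let ?f = "\<lambda>s. mat_powr (\<phi> (t - s)) ?H - mat_powr (\<phi> (- s)) ?H"
  interpret scattered_measure P M \<mu> lborel
    by unfold_locales (rule assms(3))
  interpret homogeneous_function E \<phi>
    using assms by unfold_locales (auto simp: admissible_def)
  have B: "min_re_eig B > 0"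
    by (rule strictly_operator_stable_min_re_eig_pos[OF assms(1,2)])
  have q: "q > 0"
    using trace_pos[OF assms(5)] assms(6) by simp
  \<comment> \<open>The two eigenvalue hypotheses solved for \<open>B\<close>, using that the
    spectral bounds of \<open>q *\<^sub>R B\<close> are \<open>q\<close> times those of
    \<open>B\<close>.\<close>
  have "- min_re_eig ?H / q < min_re_eig B" "max_re_eig B < (\<beta> - max_re_eig ?H) / q"
    using assms(12,13) q by (simp_all add: min_re_eig_scaleR max_re_eig_scaleR field_simps)
  \<comment> \<open>Strict inequalities leave room on both sides. The \<open>max 0\<close> keeps
    \<open>b\<^sub>1\<close> positive, so that the exponent \<open>1 / b\<^sub>1\<close> is
    meaningful when the other bound is negative.\<close>
  then obtain b\<^sub>1 b\<^sub>2 where b1: "max 0 (- min_re_eig ?H / q) < b\<^sub>1" "b\<^sub>1 < min_re_eig B"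
    and b2: "max_re_eig B < b\<^sub>2" "b\<^sub>2 < (\<beta> - max_re_eig ?H) / q"
    using dense B by (metis max_less_iff_conj)
  have b: "0 < b\<^sub>1" "b\<^sub>1 < b\<^sub>2" "0 < b\<^sub>2"
    using b1 b2(1) min_le_max_re_eig[of B] by auto
  have "max_re_eig ?H < \<beta> - q * b\<^sub>2"
    using b2(2) q by (simp add: field_simps)
  then obtain a where a: "max_re_eig ?H < a" "a < \<beta> - q * b\<^sub>2"
    using dense by blast
  \<comment> \<open>The \<open>min 0\<close> makes \<open>\<delta>\<close> nonpositive, as the
    estimate of powers of \<open>\<phi>\<close> near 0 demands.\<close>
  have "- q * b\<^sub>1 < min 0 (min_re_eig ?H)"
    using b1(1) b q by (simp add: field_simps)
  then obtain \<delta> where \<delta>: "- q * b\<^sub>1 < \<delta>" "\<delta> < min 0 (min_re_eig ?H)"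
    using dense by blast
  have a\<beta>: "a < \<beta>" using a(2) b q by (smt (verit) mult_pos_pos)
  \<comment> \<open>The conditions read \<open>a - \<beta> + q * c < 0\<close> and
    \<open>\<delta> + q * c > 0\<close>. The first is tightest at \<open>c = b\<^sub>2\<close>, the
    second at \<open>c = b\<^sub>1\<close>, so the choices of \<open>a\<close> and
    \<open>\<delta>\<close> cover the whole range.\<close>
  have int: "integrable lborel (\<lambda>s. norm (?f s) powr (1 / c))" if c: "b\<^sub>1 \<le> c" "c \<le> b\<^sub>2" for c
  proof -
    have c0: "c > 0" using b(1) c by simp
    have "q * c \<le> q * b\<^sub>2" using q c by (intro mult_left_mono) auto
    then have 1: "(a - \<beta>) * (1 / c) + trace E < 0"
      using a(2) c0 by (simp add: field_simps flip: assms(6))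
    have "q * b\<^sub>1 \<le> q * c" using q c by (intro mult_left_mono) auto
    then have "0 < \<delta> + q * c" using \<delta>(1) by linarith
    then have 2: "\<delta> * (1 / c) + trace E > 0"
      using c0 by (simp add: field_simps flip: assms(6))
    have "integrable lborel (\<lambda>x. norm (mat_powr (\<phi> (t + x)) ?H - mat_powr (\<phi> x) ?H) powr (1 / c))"
      using integrable_increment[OF assms(7,11,10) a(1) a\<beta> _ _ _ 1 2] \<delta>(2) c0 by simp
    from integrable_lborel_uminus[OF this] show ?thesis by simp
  qed
  obtain K where "K > 0" "\<And>u. norm (log_char \<mu> u) \<le> K * (norm u powr (1 / b\<^sub>1) + norm u powr (1 / b\<^sub>2))"
    using norm_log_char_le[OF assms(2) b(1) b1(2) b2(1)] by blast
  then show "stoch_integrable P M lborel ?f"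
    using b int[of b\<^sub>1] int[of b\<^sub>2]
    by (intro stoch_integrableI[of "1 / b\<^sub>1" "1 / b\<^sub>2" K]) auto
qed

end
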